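(* Let $\varepsilon \in (0,1]$, $r > 0$ and $p \ge 2$. For some $c \lesssim \frac{p}{\varepsilon}$, there exists a data structure for the $(c,r)$-NNS problem over $n$-point sets in $\ell_p^d$ with (i) pre-processing time $\mathrm{poly}(nd)$; (ii) space $O(n^{1+\varepsilon}\log(n)\cdot \mathrm{poly}(d))$; (iii) query time $O(n^{\varepsilon}\log(n)\cdot \mathrm{poly}(d))$.
   Context: $\ell_p^d$ is $\mathbb{R}^d$ with the norm $\|x\|_p=(\sum_{i=1}^d|x_i|^p)^{1/p}$ and distance $\|x-y\|_p$. The notation $A\lesssim B$ means $A\le C_0 B$ for an absolute constant $C_0$ independent of all other parameters; $\mathrm{poly}(A)$ denotes a polynomial in $A$. The $(c,r)$-near neighbor search ($(c,r)$-NNS) problem over a metric space $(\mathcal{M},\mathrm{dist})$: given a set $P$ of $n$ points of $\mathcal{M}$, build a data structure such that, given any query point $q\in\mathcal{M}$ with the guarantee that $\mathrm{dist}(x^*,q)\le r$ for some $x^*\in P$, the data structure outputs a point $x\in P$ with $\mathrm{dist}(x,q)\le cr$ with probability at least $2/3$. Space is measured in words of memory. *)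

theory Defs
  imports
    "HOL-Probability.Probability_Mass_Function"
    "HOL-Computational_Algebra.Polynomial"
begin

section \<open>The space \<open>\<ell>\<^sub>p\<^sup>d\<close>\<close>

text \<open>
  The dimension varies inside the statement (one program serves all dimensions), so a point of
  \<open>\<real>\<^sup>d\<close> is a list of length \<open>d\<close>.
\<close>

definition points :: "nat \<Rightarrow> real list set" where
  "points d = {x. length x = d}"

definition lp_norm :: "real \<Rightarrow> real list \<Rightarrow> real" where
  "lp_norm p x = (\<Sum>i<length x. \<bar>x ! i\<bar> powr p) powr (1 / p)"

definition lp_dist :: "real \<Rightarrow> real list \<Rightarrow> real list \<Rightarrow> real" where
  "lp_dist p x y = lp_norm p (map2 (-) x y)"


section \<open>A randomized real RAM\<close>

text \<open>
  A word is either an integer of absolute value at most \<open>W\<close> or a real number, as in the usual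
  real RAM with word-size integers. Both kinds of word have a register file and a random-access
  memory, and addresses are integer words. Real arithmetic, including the power function needed
  to evaluate \<open>\<ell>\<^sub>p\<close> norms, is exact and has unit cost; there is no conversion from reals to
  integers (no floor function), and programs contain integer constants only. Randomness enters
  through uniform integers.

  The input is a read-only array of reals; the output is a pair of write-only tapes.
  Integer overflow, a negative address, reading outside the input and drawing from an empty range
  are faults.
\<close>

type_synonym reg = nat

record ram =
  ireg :: "reg \<Rightarrow> int"
  rreg :: "reg \<Rightarrow> real"
  imem :: "nat \<Rightarrow> int"
  rmem :: "nat \<Rightarrow> real"
  inp  :: "real list"
  iout :: "int list"
  rout :: "real list"

datatype iop = IPlus | IMinus | ITimes | IDiv | IMod
datatype rop = RPlus | RMinus | RTimes | RDivide | RPowr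

text \<open>The target register, if there is one, comes first.\<close>

datatype instr =
    IConst reg int
  | IOp iop reg reg reg
  | ILoad reg reg
  | IStore reg reg
  | IRand reg reg
  | IEmit reg
  | ROfInt reg reg
  | ROp rop reg reg reg
  | RLoad reg reg
  | RStore reg reg
  | RInput reg reg
  | REmit reg

datatype test = ILess reg reg | RLess reg reg

datatype com =
    SKIP
  | Do instr
  | Seq com com
  | Cond test com com
  | Loop test com

fun iop_sem :: "iop \<Rightarrow> int \<Rightarrow> int \<Rightarrow> int" where
  "iop_sem IPlus x y = x + y"
| "iop_sem IMinus x y = x - y"
| "iop_sem ITimes x y = x * y"
| "iop_sem IDiv x y = x div y"
| "iop_sem IMod x y = x mod y"

fun rop_sem :: "rop \<Rightarrow> real \<Rightarrow> real \<Rightarrow> real" where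
  "rop_sem RPlus x y = x + y"
| "rop_sem RMinus x y = x - y"
| "rop_sem RTimes x y = x * y"
| "rop_sem RDivide x y = x / y"
| "rop_sem RPowr x y = x powr y"

fun test_sem :: "test \<Rightarrow> ram \<Rightarrow> bool" where
  "test_sem (ILess a b) s = (ireg s a < ireg s b)"
| "test_sem (RLess a b) s = (rreg s a < rreg s b)"

definition set_ireg :: "int \<Rightarrow> reg \<Rightarrow> int \<Rightarrow> ram \<Rightarrow> ram option" where
  "set_ireg W a v s = (if \<bar>v\<bar> \<le> W then Some (s\<lparr>ireg := (ireg s)(a := v)\<rparr>) else None)"

definition set_rreg :: "reg \<Rightarrow> real \<Rightarrow> ram \<Rightarrow> ram" where
  "set_rreg a v s = s\<lparr>rreg := (rreg s)(a := v)\<rparr>"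

text \<open>\<open>None\<close> is a fault.\<close>

fun exec :: "int \<Rightarrow> instr \<Rightarrow> ram \<Rightarrow> ram option pmf" where
  "exec W (IConst a k) s = return_pmf (set_ireg W a k s)"
| "exec W (IOp f a b c) s = return_pmf (set_ireg W a (iop_sem f (ireg s b) (ireg s c)) s)"
| "exec W (ILoad a b) s = return_pmf
     (if 0 \<le> ireg s b then set_ireg W a (imem s (nat (ireg s b))) s else None)"
| "exec W (IStore a b) s = return_pmf
     (if 0 \<le> ireg s a then Some (s\<lparr>imem := (imem s)(nat (ireg s a) := ireg s b)\<rparr>) else None)"
| "exec W (IRand a b) s =
     (if 0 < ireg s b then map_pmf (\<lambda>v. set_ireg W a v s) (pmf_of_set {0..<ireg s b})
      else return_pmf None)"
| "exec W (IEmit a) s = return_pmf (Some (s\<lparr>iout := iout s @ [ireg s a]\<rparr>))"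
| "exec W (ROfInt a b) s = return_pmf (Some (set_rreg a (of_int (ireg s b)) s))"
| "exec W (ROp f a b c) s = return_pmf (Some (set_rreg a (rop_sem f (rreg s b) (rreg s c)) s))"
| "exec W (RLoad a b) s = return_pmf
     (if 0 \<le> ireg s b then Some (set_rreg a (rmem s (nat (ireg s b))) s) else None)"
| "exec W (RStore a b) s = return_pmf
     (if 0 \<le> ireg s a then Some (s\<lparr>rmem := (rmem s)(nat (ireg s a) := rreg s b)\<rparr>) else None)"
| "exec W (RInput a b) s = return_pmf
     (if 0 \<le> ireg s b \<and> nat (ireg s b) < length (inp s)
      then Some (set_rreg a (inp s ! nat (ireg s b)) s) else None)"
| "exec W (REmit a) s = return_pmf (Some (s\<lparr>rout := rout s @ [rreg s a]\<rparr>))"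

type_synonym conf = "(com \<times> ram) option"

fun step :: "int \<Rightarrow> com \<Rightarrow> ram \<Rightarrow> conf pmf" where
  "step W SKIP s = return_pmf (Some (SKIP, s))"
| "step W (Do i) s = map_pmf (map_option (\<lambda>t. (SKIP, t))) (exec W i s)"
| "step W (Seq a b) s =
     (if a = SKIP then return_pmf (Some (b, s))
      else map_pmf (map_option (\<lambda>(a', t). (Seq a' b, t))) (step W a s))"
| "step W (Cond t a b) s = return_pmf (Some (if test_sem t s then a else b, s))"
| "step W (Loop t a) s = return_pmf (Some (if test_sem t s then Seq a (Loop t a) else SKIP, s))"

fun run :: "int \<Rightarrow> nat \<Rightarrow> com \<Rightarrow> ram \<Rightarrow> conf pmf" where
  "run W 0 a s = return_pmf (Some (a, s))"
| "run W (Suc k) a s = bind_pmf (run W k a s)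
     (\<lambda>z. case z of None \<Rightarrow> return_pmf None | Some (a', t) \<Rightarrow> step W a' t)"

type_synonym words = "int list \<times> real list"

fun result :: "conf \<Rightarrow> words option" where
  "result (Some (SKIP, t)) = Some (iout t, rout t)"
| "result _ = None"

text \<open>
  Whatever the random choices, the program halts within \<open>T\<close> steps without a fault, and its output
  has distribution \<open>\<mu>\<close>.
\<close>

definition computes :: "int \<Rightarrow> com \<Rightarrow> ram \<Rightarrow> nat \<Rightarrow> words pmf \<Rightarrow> bool" where
  "computes W a s T \<mu> \<longleftrightarrow> map_pmf result (run W T a s) = map_pmf Some \<mu>"

text \<open>
  Initially the input is \<open>xs\<close>, the memories hold \<open>m\<close> (zero elsewhere), and the first registers
  hold the parameters; all other registers are zero.
\<close>

definition init :: "int list \<Rightarrow> real list \<Rightarrow> real list \<Rightarrow> words \<Rightarrow> ram" where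
  "init ipar rpar xs m =
     \<lparr>ireg = (\<lambda>k. if k < length ipar then ipar ! k else 0),
      rreg = (\<lambda>k. if k < length rpar then rpar ! k else 0),
      imem = (\<lambda>k. if k < length (fst m) then fst m ! k else 0),
      rmem = (\<lambda>k. if k < length (snd m) then snd m ! k else 0),
      inp = xs, iout = [], rout = []\<rparr>"


section \<open>Near neighbor search\<close>

text \<open>
  \<open>A q\<close> is the distribution of the answer to query \<open>q\<close>, over the randomness of both the
  pre-processing and the query. The guarantee is for each fixed query.
\<close>

definition solves_NNS ::
  "('a \<Rightarrow> 'a \<Rightarrow> real) \<Rightarrow> 'a set \<Rightarrow> real \<Rightarrow> real \<Rightarrow> 'a set \<Rightarrow> ('a \<Rightarrow> 'a pmf) \<Rightarrow> bool" where
  "solves_NNS dst M c r P A \<longleftrightarrow>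
     (\<forall>q\<in>M. (\<exists>x\<in>P. dst x q \<le> r) \<longrightarrow> measure_pmf.prob (A q) {x \<in> P. dst x q \<le> c * r} \<ge> 2 / 3)"

text \<open>
  \<open>pre\<close> reads the points \<open>ps\<close> one after the other, in at most \<open>Tpre\<close> steps, and outputs the data
  structure, of at most \<open>S\<close> words. \<open>qry\<close> starts with that data structure in memory, reads the query
  point, and outputs the coordinates of its answer in at most \<open>Tqry\<close> steps. Both programs know
  \<open>n\<close>, \<open>d\<close>, \<open>\<epsilon>\<close>, \<open>r\<close> and \<open>p\<close>.
\<close>

definition lp_NNS_data_structure ::
  "int \<Rightarrow> com \<Rightarrow> com \<Rightarrow> real \<Rightarrow> real \<Rightarrow> real \<Rightarrow> real \<Rightarrow> nat \<Rightarrow> real list list \<Rightarrow>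
   nat \<Rightarrow> nat \<Rightarrow> nat \<Rightarrow> bool" where
  "lp_NNS_data_structure W pre qry \<epsilon> r p c d ps Tpre S Tqry \<longleftrightarrow>
     (let ipar = [int (length ps), int d]; rpar = [\<epsilon>, r, p] in
      \<exists>(D :: words pmf) (ans :: words \<Rightarrow> real list \<Rightarrow> words pmf).
        computes W pre (init ipar rpar (concat ps) ([], [])) Tpre D \<and>
        (\<forall>m\<in>set_pmf D. length (fst m) + length (snd m) \<le> S) \<and>
        (\<forall>m\<in>set_pmf D. \<forall>q\<in>points d. (\<exists>x\<in>set ps. lp_dist p x q \<le> r) \<longrightarrow>
           computes W qry (init ipar rpar q m) Tqry (ans m q)) \<and>
        solves_NNS (lp_dist p) (points d) c r (set ps)
          (\<lambda>q. bind_pmf D (\<lambda>m. map_pmf snd (ans m q))))"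

end

theory Submission
  imports Defs
begin

text \<open>
  The data structure consists of about \<open>3 n\<^sup>\<epsilon>\<close> independent random trees whose nodes are sets of
  points. Let \<open>R = 120 p r / \<epsilon>\<close>. If some point of a node has half of the node within distance \<open>2R\<close>,
  a query within \<open>4R\<close> of that point is answered by it; any other query may discard the ball of radius
  \<open>2R\<close> around it, as a near neighbor in that ball would have put the query within \<open>4R\<close>.

  Otherwise the node is cut by \<open>x\<^sub>j \<le> t\<close>, where the pair \<open>(j, t)\<close> has density proportional to
  \<open>p \<bar>t - m\<^sub>j\<bar>\<^sup>p\<^sup>-\<^sup>1\<close> with \<open>m\<close> the coordinate-wise median, and \<open>t\<close> lies between two order statistics, so that
  each side gets at least a \<open>1 / (8d)\<close> fraction of the points and the depth is \<open>O(d log n)\<close>. This cut measure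
  is the \<open>\<ell>\<^sub>1\<close> metric pulled back along the (clamped) coordinate-wise signed \<open>p\<close>-th power. Since \<open>m\<close> is a
  median and few points are near it, the average mass of the cuts that separate a point \<open>x\<close> from the node is of order
  \<open>\<parallel>x - m\<parallel>\<^sup>p + R\<^sup>p\<close>, while the mass of those that separate it from a query at distance \<open>r\<close> is at most \<open>\<epsilon> / 40\<close>
  times this. With \<open>\<alpha>\<^sup>-\<^sup>\<epsilon> \<ge> 1 + \<epsilon> (1 - \<alpha>)\<close> this gives, by induction on the depth, that the query follows its
  near neighbor \<open>x\<close> through a node of size \<open>s\<close> with probability at least \<open>s\<^sup>-\<^sup>\<epsilon>\<close>, up to the error made by
  drawing the cuts from a grid.
\<close>

section \<open>Executions of the random access machine\<close>

text \<open>The mass of the cuts between \<open>x\<close> and a query is bounded with a term of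
  order \<open>R^p\<close> that stays even if \<open>x\<close> sits at the median; only the spread
  of the node can pay for it. Without a dense point more than half of the points are farther than
  \<open>R\<close> from the median, which is why balls are removed. Cutting between order statistics
  makes the depth independent of the spread; at rank \<open>s / (8d)\<close> it affects at most a
  quarter of the points over all \<open>2d\<close> tails, so a quarter still pays. The constant 120
  balances the two sides: it makes \<open>3 * p / \<theta> = \<epsilon> / 40\<close>, and 40 is 5
  (median) times 4 (paying quarter) times 2 (a separated query forfeits its unit and the gain). The
  machine draws integers only, so cuts come from a grid of \<open>N\<close> points. A count of cuts
  is off by at most 1 per coordinate, and \<open>N = 6 n^2 d\<close> keeps the accumulated error at
  most half of \<open>n powr - \<epsilon>\<close>. All nodes of a level share one random number: a
  query follows a single node per level, so independence of the levels suffices.\<close>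

definition exc :: "int \<Rightarrow> com \<Rightarrow> ram \<Rightarrow> nat \<Rightarrow> ram pmf \<Rightarrow> bool" where
  "exc W c s T \<nu> \<longleftrightarrow> run W T c s = map_pmf (\<lambda>t. Some (SKIP, t)) \<nu>"

lemma run_add:
  "run W (j + k) c s =
     bind_pmf (run W j c s) (\<lambda>z. case z of None \<Rightarrow> return_pmf None | Some (a, t) \<Rightarrow> run W k a t)"
proof (induction k)
  case 0
  have "run W j c s = bind_pmf (run W j c s) return_pmf"
    by (simp add: bind_return_pmf')
  also have "\<dots> = bind_pmf (run W j c s)
      (\<lambda>z. case z of None \<Rightarrow> return_pmf None | Some (a, t) \<Rightarrow> run W 0 a t)"
    by (intro bind_pmf_cong refl) (auto split: option.splits)
  finally show ?case by simp
next
  case (Suc k)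
  show ?case
    by (simp add: Suc bind_assoc_pmf)
       (intro bind_pmf_cong refl, auto split: option.splits simp: bind_return_pmf)
qed

lemma run_Suc_first:
  "run W (Suc k) c s =
     bind_pmf (step W c s) (\<lambda>z. case z of None \<Rightarrow> return_pmf None | Some (a, t) \<Rightarrow> run W k a t)"
  using run_add[of W "Suc 0" k c s] by (simp add: bind_return_pmf)

lemma run_SKIP: "run W k SKIP s = return_pmf (Some (SKIP, s))"
  by (induction k) (simp_all add: bind_return_pmf)

lemma exc_SKIP: "exc W SKIP s T (return_pmf s)"
  by (simp add: exc_def run_SKIP)

text \<open>A halted program idles in \<open>SKIP\<close>, so \<open>T\<close> is an upper bound on
  the running time and not its exact value.\<close>

lemma exc_mono:
  assumes "exc W c s T \<nu>" "T \<le> T'"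
  shows "exc W c s T' \<nu>"
  using assms(1) run_add[of W T "T' - T" c s] assms(2)
  by (simp add: exc_def bind_map_pmf run_SKIP map_pmf_def[symmetric])

lemma exc_Do:
  assumes "exec W i s = map_pmf Some \<nu>"
  shows "exc W (Do i) s (Suc 0) \<nu>"
  using assms by (simp add: exc_def bind_return_pmf pmf.map_comp o_def)

text \<open>No outcome of the whole run is faulty or unfinished, so no branch after the first step
  contains such an outcome either: the first step is fault-free, each branch has its own
  distribution of final states, and \<nu> is their mixture.\<close>

lemma exc_first_step:
  assumes "exc W c s (Suc T) \<nu>"
  obtains \<sigma> \<nu>' where "step W c s = map_pmf Some \<sigma>"
    "\<And>a t. (a, t) \<in> set_pmf \<sigma> \<Longrightarrow> exc W a t T (\<nu>' (a, t))" "\<nu> = bind_pmf \<sigma> \<nu>'"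
proof -
  let ?f = "\<lambda>z. case z of None \<Rightarrow> return_pmf None | Some (a, t) \<Rightarrow> run W T a t"
  have eq: "bind_pmf (step W c s) ?f = map_pmf (\<lambda>t. Some (SKIP, t)) \<nu>"
    using assms unfolding exc_def run_Suc_first .
  have supp: "w \<in> (\<lambda>t. Some (SKIP, t)) ` set_pmf \<nu>"
    if "z \<in> set_pmf (step W c s)" "w \<in> set_pmf (?f z)" for z w
  proof -
    have "w \<in> set_pmf (bind_pmf (step W c s) ?f)" using that by auto
    then show ?thesis unfolding eq by simp
  qed
  have ex: "\<exists>y. z = Some y" if "z \<in> set_pmf (step W c s)" for z
    using supp[OF that] by (cases z) auto
  define \<sigma> where "\<sigma> = map_pmf the (step W c s)"
  have st: "step W c s = map_pmf Some \<sigma>"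
  proof -
    have "map_pmf Some \<sigma> = map_pmf (\<lambda>z. Some (the z)) (step W c s)"
      by (simp add: \<sigma>_def pmf.map_comp o_def)
    also have "\<dots> = map_pmf (\<lambda>z. z) (step W c s)"
      using ex by (intro map_pmf_cong refl) force
    finally show ?thesis by simp
  qed
  define \<nu>' where "\<nu>' = (\<lambda>(a, t). map_pmf (\<lambda>z. snd (the z)) (run W T a t))"
  have e: "exc W a t T (\<nu>' (a, t))" if "(a, t) \<in> set_pmf \<sigma>" for a t
  proof -
    have "w \<in> (\<lambda>t. Some (SKIP, t)) ` set_pmf \<nu>" if "w \<in> set_pmf (run W T a t)" for w
      using supp[of "Some (a, t)" w] that \<open>(a, t) \<in> set_pmf \<sigma>\<close> unfolding st by auto
    then have "map_pmf (\<lambda>z. Some (SKIP, snd (the z))) (run W T a t) = map_pmf (\<lambda>z. z) (run W T a t)"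
      by (intro map_pmf_cong refl) force
    then show ?thesis by (simp add: exc_def \<nu>'_def pmf.map_comp o_def)
  qed
  have "map_pmf (\<lambda>t. Some (SKIP, t)) \<nu> = bind_pmf \<sigma> (\<lambda>(a, t). run W T a t)"
    unfolding eq[symmetric] st by (simp add: bind_map_pmf)
  also have "\<dots> = bind_pmf \<sigma> (\<lambda>y. map_pmf (\<lambda>t. Some (SKIP, t)) (\<nu>' y))"
    using e by (intro bind_pmf_cong refl) (auto simp: exc_def)
  also have "\<dots> = map_pmf (\<lambda>t. Some (SKIP, t)) (bind_pmf \<sigma> \<nu>')"
    by (simp add: map_bind_pmf)
  finally have "\<nu> = bind_pmf \<sigma> \<nu>'"
    by (rule pmf.inj_map_strong[rotated]) auto
  with st e that show ?thesis by blast
qed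

lemma exc_SKIP_D:
  assumes "exc W SKIP s T \<nu>"
  shows "\<nu> = return_pmf s"
proof -
  have "map_pmf (\<lambda>t. Some (SKIP, t)) (return_pmf s) = map_pmf (\<lambda>t. Some (SKIP, t)) \<nu>"
    using assms unfolding exc_def run_SKIP by simp
  then show ?thesis by (rule pmf.inj_map_strong[rotated, symmetric]) auto
qed

lemma exc_SKIP_Seq: "exc W b s T \<mu> \<Longrightarrow> exc W (Seq SKIP b) s (Suc T) \<mu>"
  unfolding exc_def by (simp add: run_Suc_first bind_return_pmf del: run.simps)

text \<open>Induction on \<open>T1\<close> peels off one step of \<open>a\<close> at a time. A
  branch may finish \<open>a\<close> early; monotonicity then supplies idle steps. The additional 1
  is the step that discards \<open>SKIP\<close>.\<close>

lemma exc_Seq: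
  assumes "exc W a s T1 \<nu>" "\<And>t. t \<in> set_pmf \<nu> \<Longrightarrow> exc W b t T2 (\<mu> t)"
  shows "exc W (Seq a b) s (T1 + T2 + 1) (bind_pmf \<nu> \<mu>)"
  using assms
proof (induction T1 arbitrary: a s \<nu>)
  case 0
  obtain t where t: "t \<in> set_pmf \<nu>" using set_pmf_not_empty[of \<nu>] by blast
  have "return_pmf (Some (a, s)) = map_pmf (\<lambda>t. Some (SKIP, t)) \<nu>"
    using 0(1) by (simp add: exc_def)
  from arg_cong[OF this, of set_pmf]
  have "(\<lambda>t. Some (SKIP, t)) ` set_pmf \<nu> = {Some (a, s)}" by simp
  moreover have "Some (SKIP, t) \<in> (\<lambda>t. Some (SKIP, t)) ` set_pmf \<nu>" using t by blast
  ultimately have a: "a = SKIP" by simp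
  then have "\<nu> = return_pmf s" using 0(1) exc_SKIP_D by blast
  then show ?case using a 0(2)[of s] exc_SKIP_Seq by (simp add: bind_return_pmf)
next
  case (Suc T1)
  show ?case
  proof (cases "a = SKIP")
    case True
    then have \<nu>: "\<nu> = return_pmf s" using Suc.prems(1) exc_SKIP_D by blast
    have "exc W b s (Suc T1 + T2) (\<mu> s)"
      using Suc.prems(2)[of s] by (rule exc_mono) (simp_all add: \<nu>)
    then show ?thesis using True exc_SKIP_Seq by (simp add: \<nu> bind_return_pmf)
  next
    case False
    obtain \<sigma> \<nu>' where \<sigma>: "step W a s = map_pmf Some \<sigma>"
      "\<And>a t. (a, t) \<in> set_pmf \<sigma> \<Longrightarrow> exc W a t T1 (\<nu>' (a, t))" "\<nu> = bind_pmf \<sigma> \<nu>'"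
      using exc_first_step[OF Suc.prems(1)] by blast
    have *: "exc W (Seq a' b) t (T1 + T2 + 1) (bind_pmf (\<nu>' (a', t)) \<mu>)"
      if "(a', t) \<in> set_pmf \<sigma>" for a' t
    proof (rule Suc.IH[OF \<sigma>(2)[OF that]])
      fix u assume "u \<in> set_pmf (\<nu>' (a', t))"
      then have "u \<in> set_pmf \<nu>" unfolding \<sigma>(3) set_bind_pmf using that by blast
      then show "exc W b u T2 (\<mu> u)" by (rule Suc.prems(2))
    qed
    have "run W (Suc (T1 + T2 + 1)) (Seq a b) s =
        bind_pmf \<sigma> (\<lambda>(a', t). run W (T1 + T2 + 1) (Seq a' b) t)"
      unfolding run_Suc_first using False
      by (simp add: \<sigma>(1) bind_map_pmf pmf.map_comp o_def del: run.simps)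
         (intro bind_pmf_cong refl, simp add: split_beta del: run.simps)
    also have "\<dots> = bind_pmf \<sigma> (\<lambda>y. map_pmf (\<lambda>t. Some (SKIP, t)) (bind_pmf (\<nu>' y) \<mu>))"
      using * by (intro bind_pmf_cong refl) (auto simp: exc_def)
    also have "\<dots> = map_pmf (\<lambda>t. Some (SKIP, t)) (bind_pmf \<nu> \<mu>)"
      by (simp add: \<sigma>(3) bind_assoc_pmf map_bind_pmf)
    finally show ?thesis by (simp add: exc_def)
  qed
qed

lemma exc_Cond:
  assumes "exc W (if test_sem t s then a else b) s T \<nu>"
  shows "exc W (Cond t a b) s (Suc T) \<nu>"
  using assms unfolding exc_def by (simp add: run_Suc_first bind_return_pmf del: run.simps)

lemma exc_Loop:
  assumes "exc W (if test_sem t s then Seq a (Loop t a) else SKIP) s T \<nu>"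
  shows "exc W (Loop t a) s (Suc T) \<nu>"
  using assms unfolding exc_def by (simp add: run_Suc_first bind_return_pmf del: run.simps)

section \<open>Total correctness of the deterministic code, with step counts\<close>

definition ok :: "int \<Rightarrow> com \<Rightarrow> nat \<Rightarrow> ram \<Rightarrow> (ram \<Rightarrow> bool) \<Rightarrow> bool" where
  "ok W c T s Q \<longleftrightarrow> (\<exists>t. exc W c s T (return_pmf t) \<and> Q t)"

lemma ok_conseq:
  assumes "ok W c T s Q" "\<And>t. Q t \<Longrightarrow> Q' t" "T \<le> T'"
  shows "ok W c T' s Q'"
  using assms exc_mono unfolding ok_def by blast

lemma ok_SKIP: "Q s \<Longrightarrow> ok W SKIP T s Q"
  using exc_SKIP unfolding ok_def by blast

lemma ok_Seq:
  assumes "ok W a T1 s (\<lambda>t. ok W b T2 t Q)" "T1 + T2 + 1 \<le> T"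
  shows "ok W (Seq a b) T s Q"
proof -
  obtain t u where "exc W a s T1 (return_pmf t)" "exc W b t T2 (return_pmf u)" "Q u"
    using assms(1) unfolding ok_def by blast
  then have "exc W (Seq a b) s (T1 + T2 + 1) (bind_pmf (return_pmf t) (\<lambda>_. return_pmf u))"
    by (intro exc_Seq) auto
  then have "exc W (Seq a b) s T (return_pmf u)"
    using assms(2) by (intro exc_mono[of W _ s "T1 + T2 + 1" _ T]) (simp_all add: bind_return_pmf)
  then show ?thesis using \<open>Q u\<close> unfolding ok_def by blast
qed

lemma ok_Cond:
  assumes "test_sem t s \<Longrightarrow> ok W a T s Q" "\<not> test_sem t s \<Longrightarrow> ok W b T s Q" "Suc T \<le> T'"
  shows "ok W (Cond t a b) T' s Q"
proof -
  obtain u where "exc W (if test_sem t s then a else b) s T (return_pmf u)" "Q u"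
    using assms(1,2) unfolding ok_def by (cases "test_sem t s") auto
  then show ?thesis
    using exc_mono[OF exc_Cond assms(3)] unfolding ok_def by blast
qed

lemma ok_Loop_exit: "\<not> test_sem t s \<Longrightarrow> Q s \<Longrightarrow> 1 \<le> T \<Longrightarrow> ok W (Loop t a) T s Q"
  unfolding ok_def
  by (intro exI[of _ s] conjI exc_mono[OF exc_Loop[of W t s a 0]]) (simp_all add: exc_SKIP)

lemma ok_Loop_enter:
  assumes "test_sem t s" "ok W a T1 s (\<lambda>u. ok W (Loop t a) T2 u Q)" "T1 + T2 + 2 \<le> T"
  shows "ok W (Loop t a) T s Q"
proof -
  have "ok W (Seq a (Loop t a)) (T1 + T2 + 1) s Q"
    using assms(2) by (rule ok_Seq) simp
  then obtain u where "exc W (Seq a (Loop t a)) s (T1 + T2 + 1) (return_pmf u)" "Q u"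
    unfolding ok_def by blast
  then have "exc W (Loop t a) s (Suc (T1 + T2 + 1)) (return_pmf u)"
    using assms(1) by (intro exc_Loop) simp
  then have "exc W (Loop t a) s T (return_pmf u)"
    by (rule exc_mono) (use assms(3) in simp)
  then show ?thesis using \<open>Q u\<close> unfolding ok_def by blast
qed

text \<open>Faults become side conditions. \<open>IRand\<close> is excluded because
  \<open>ok\<close> speaks of a single outcome; randomness is thereby confined to the one loop that
  is treated with \<open>exc\<close>.\<close>

fun wpi :: "int \<Rightarrow> instr \<Rightarrow> (ram \<Rightarrow> bool) \<Rightarrow> ram \<Rightarrow> bool" where
  "wpi W (IConst a k) Q s = (\<bar>k\<bar> \<le> W \<and> Q (s\<lparr>ireg := (ireg s)(a := k)\<rparr>))"
| "wpi W (IOp f a b c) Q s = (\<bar>iop_sem f (ireg s b) (ireg s c)\<bar> \<le> W \<and>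
     Q (s\<lparr>ireg := (ireg s)(a := iop_sem f (ireg s b) (ireg s c))\<rparr>))"
| "wpi W (ILoad a b) Q s = (0 \<le> ireg s b \<and> \<bar>imem s (nat (ireg s b))\<bar> \<le> W \<and>
     Q (s\<lparr>ireg := (ireg s)(a := imem s (nat (ireg s b)))\<rparr>))"
| "wpi W (IStore a b) Q s = (0 \<le> ireg s a \<and>
     Q (s\<lparr>imem := (imem s)(nat (ireg s a) := ireg s b)\<rparr>))"
| "wpi W (IRand a b) Q s = False"
| "wpi W (IEmit a) Q s = Q (s\<lparr>iout := iout s @ [ireg s a]\<rparr>)"
| "wpi W (ROfInt a b) Q s = Q (s\<lparr>rreg := (rreg s)(a := of_int (ireg s b))\<rparr>)"
| "wpi W (ROp f a b c) Q s = Q (s\<lparr>rreg := (rreg s)(a := rop_sem f (rreg s b) (rreg s c))\<rparr>)"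
| "wpi W (RLoad a b) Q s = (0 \<le> ireg s b \<and>
     Q (s\<lparr>rreg := (rreg s)(a := rmem s (nat (ireg s b)))\<rparr>))"
| "wpi W (RStore a b) Q s = (0 \<le> ireg s a \<and>
     Q (s\<lparr>rmem := (rmem s)(nat (ireg s a) := rreg s b)\<rparr>))"
| "wpi W (RInput a b) Q s = (0 \<le> ireg s b \<and> nat (ireg s b) < length (inp s) \<and>
     Q (s\<lparr>rreg := (rreg s)(a := inp s ! nat (ireg s b))\<rparr>))"
| "wpi W (REmit a) Q s = Q (s\<lparr>rout := rout s @ [rreg s a]\<rparr>)"

lemma wpi_exec: "wpi W i Q s \<Longrightarrow> \<exists>t. exec W i s = return_pmf (Some t) \<and> Q t"
  by (cases i) (simp_all add: set_ireg_def set_rreg_def)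

lemma ok_Do:
  assumes "wpi W i Q s"
  shows "ok W (Do i) (Suc 0) s Q"
proof -
  obtain t where "exec W i s = return_pmf (Some t)" "Q t" using wpi_exec[OF assms] by blast
  then show ?thesis unfolding ok_def by (intro exI[of _ t] conjI exc_Do) simp_all
qed

fun blk :: "instr list \<Rightarrow> com" where
  "blk [] = SKIP"
| "blk (i # is) = Seq (Do i) (blk is)"

text \<open>Loop-free code is evaluated symbolically in one go, while every loop is treated by an
  invariant rule such as \<open>ok_for\<close>.\<close>

fun wp :: "int \<Rightarrow> com \<Rightarrow> (ram \<Rightarrow> bool) \<Rightarrow> ram \<Rightarrow> bool" where
  "wp W SKIP Q s = Q s"
| "wp W (Do i) Q s = wpi W i Q s"
| "wp W (Seq a b) Q s = wp W a (wp W b Q) s"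
| "wp W (Cond t a b) Q s = (if test_sem t s then wp W a Q s else wp W b Q s)"
| "wp W (Loop t a) Q s = False"

fun cost :: "com \<Rightarrow> nat" where
  "cost SKIP = 0"
| "cost (Do i) = 1"
| "cost (Seq a b) = cost a + cost b + 1"
| "cost (Cond t a b) = max (cost a) (cost b) + 1"
| "cost (Loop t a) = 0"

lemma ok_wp: "wp W c Q s \<Longrightarrow> cost c \<le> T \<Longrightarrow> ok W c T s Q"
proof (induction c arbitrary: Q s T)
  case SKIP
  then show ?case by (simp add: ok_SKIP)
next
  case (Do i)
  then show ?case using ok_conseq[OF ok_Do[of W i Q s]] by simp
next
  case (Seq a b)
  have "ok W a (cost a) s (wp W b Q)" using Seq by simp
  then have "ok W a (cost a) s (\<lambda>t. ok W b (cost b) t Q)"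
    by (rule ok_conseq) (use Seq in simp_all)
  then show ?case using Seq.prems(2) by (intro ok_Seq) simp_all
next
  case (Cond t a b)
  show ?case
    by (rule ok_Cond[of t s W a "max (cost a) (cost b)"]) (use Cond in simp_all)
qed simp

text \<open>Subroutines keep their local variables in registers from \<open>K\<close> on.\<close>

definition agr :: "nat \<Rightarrow> ram \<Rightarrow> ram \<Rightarrow> bool" where
  "agr K s t \<longleftrightarrow> (\<forall>k<K. ireg t k = ireg s k) \<and> (\<forall>k<K. rreg t k = rreg s k) \<and> inp t = inp s"

definition same_mem :: "ram \<Rightarrow> ram \<Rightarrow> bool" where
  "same_mem s t \<longleftrightarrow> imem t = imem s \<and> rmem t = rmem s \<and> iout t = iout s \<and> rout t = rout s"

lemma agr_refl: "agr K s s" by (simp add: agr_def)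

text \<open>Register 2 holds the constant 1 throughout.\<close>

definition upto_loop :: "reg \<Rightarrow> reg \<Rightarrow> com \<Rightarrow> com" where
  "upto_loop c b body = Seq (Do (IConst c 0))
     (Loop (ILess c b) (Seq body (Do (IOp IPlus c c 2))))"

text \<open>The body may overwrite every register above \<open>c\<close>. The increment is not part
  of \<open>body\<close>, hence its postcondition refers to the state with the counter already
  advanced. A round costs 4 steps besides the body: the increment, the test and two discarded
  \<open>SKIP\<close>s.\<close>

lemma ok_for:
  assumes b: "b < c" "2 < c" "ireg s 2 = 1" "ireg s b = int B" "int B \<le> W"
    and start: "I 0 (s\<lparr>ireg := (ireg s)(c := 0)\<rparr>)"
    and body: "\<And>i t. i < B \<Longrightarrow> agr c s t \<Longrightarrow> ireg t c = int i \<Longrightarrow> I i t \<Longrightarrow>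
      ok W body T t (\<lambda>u. agr (Suc c) t u \<and> I (Suc i) (u\<lparr>ireg := (ireg u)(c := int (Suc i))\<rparr>))"
    and Q: "\<And>u. agr c s u \<Longrightarrow> I B u \<Longrightarrow> Q u"
    and T': "B * (T + 4) + 3 \<le> T'"
  shows "ok W (upto_loop c b body) T' s Q"
proof -
  let ?body = "Seq body (Do (IOp IPlus c c 2))"
  have loop: "ok W (Loop (ILess c b) ?body) ((B - i) * (T + 4) + 1) t Q"
    if "i \<le> B" "agr c s t" "ireg t c = int i" "I i t" for i t
    using that
  proof (induction "B - i" arbitrary: i t)
    case 0
    then have "i = B" by simp
    with 0 b show ?case by (intro ok_Loop_exit Q) (simp_all add: agr_def)
  next
    case (Suc m)
    then have i: "i < B" by simp
    have "ok W ?body (T + 2) t (\<lambda>u. ok W (Loop (ILess c b) ?body) ((B - Suc i) * (T + 4) + 1) u Q)"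
    proof (rule ok_Seq[OF ok_conseq[OF body[OF i Suc.prems(2-4)] _ order_refl]])
      fix u assume u: "agr (Suc c) t u \<and> I (Suc i) (u\<lparr>ireg := (ireg u)(c := int (Suc i))\<rparr>)"
      have c: "ireg u c = int i" "ireg u 2 = 1"
        using u Suc.prems b by (simp_all add: agr_def)
      show "ok W (Do (IOp IPlus c c 2)) (Suc 0) u
          (\<lambda>u. ok W (Loop (ILess c b) ?body) ((B - Suc i) * (T + 4) + 1) u Q)"
      proof (rule ok_Do)
        have "ok W (Loop (ILess c b) ?body) ((B - Suc i) * (T + 4) + 1)
            (u\<lparr>ireg := (ireg u)(c := int (Suc i))\<rparr>) Q"
          using u i Suc.prems Suc(2) by (intro Suc(1)) (auto simp: agr_def)
        then show "wpi W (IOp IPlus c c 2)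
            (\<lambda>u. ok W (Loop (ILess c b) ?body) ((B - Suc i) * (T + 4) + 1) u Q) u"
          using c i b(5) by (simp add: add.commute)
      qed
    qed simp
    then show ?case
    proof (rule ok_Loop_enter[rotated])
      show "test_sem (ILess c b) t" using Suc.prems b i by (simp add: agr_def)
      have "(B - i) * (T + 4) = (B - Suc i) * (T + 4) + (T + 4)"
        using i by (metis Suc_diff_Suc add.commute mult_Suc)
      then show "T + 2 + ((B - Suc i) * (T + 4) + 1) + 2 \<le> (B - i) * (T + 4) + 1" by simp
    qed
  qed
  show ?thesis unfolding upto_loop_def
  proof (rule ok_Seq[OF ok_Do])
    show "wpi W (IConst c 0) (\<lambda>u. ok W (Loop (ILess c b) ?body) (B * (T + 4) + 1) u Q) s"
      using loop[of 0 "s\<lparr>ireg := (ireg s)(c := 0)\<rparr>"] b start by (simp add: agr_def)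
  qed (use T' in simp)
qed


section \<open>Power inequalities\<close>

text \<open>\<open>powr\<close> is even in its base, so a single \<open>RPowr\<close> on a
  coordinate difference yields the power of its absolute value without a sign test.\<close>

lemma real_powr_abs: "(x :: real) powr e = \<bar>x\<bar> powr e"
  by (simp add: abs_if uminus_powr_eq)

definition spow :: "real \<Rightarrow> real \<Rightarrow> real" where
  "spow e z = (if z < 0 then - (z powr e) else z powr e)"

lemma spow_eq: "spow e z = sgn z * \<bar>z\<bar> powr e"
  unfolding spow_def by (subst (1 2) real_powr_abs) (simp add: sgn_if)

lemma abs_spow: "\<bar>spow e z\<bar> = \<bar>z\<bar> powr e"
  by (simp add: spow_eq abs_mult sgn_if)

lemma spow_less:
  assumes "0 < e" "x < y"
  shows "spow e x < spow e y"
proof -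
  consider "0 \<le> x" | "y \<le> 0" "x < 0" | "x < 0" "0 < y" by linarith
  then show ?thesis
  proof cases
    case 1
    then show ?thesis using assms by (simp add: spow_def powr_less_mono2)
  next
    case 2
    then have "(-y) powr e < (-x) powr e" using assms by (intro powr_less_mono2) auto
    then show ?thesis using 2 assms by (cases "y = 0") (simp_all add: spow_def uminus_powr_eq)
  next
    case 3
    then have "0 < x powr e" "0 < y powr e" by auto
    then have "0 < x powr e + y powr e" by (rule add_pos_pos)
    then show ?thesis using 3 by (simp add: spow_def)
  qed
qed

lemma spow_le_iff: "0 < e \<Longrightarrow> spow e x \<le> spow e y \<longleftrightarrow> x \<le> y"
  using spow_less[of e x y] spow_less[of e y x] by (cases x y rule: linorder_cases) auto

lemma spow_0 [simp]: "spow e 0 = 0"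
  by (simp add: spow_def)

lemma spow_inverse:
  assumes "0 < e"
  shows "spow e (spow (1 / e) w) = w"
proof -
  have "\<bar>spow (1 / e) w\<bar> powr e = \<bar>w\<bar>" using assms by (simp add: abs_spow powr_powr)
  moreover have "sgn (spow (1 / e) w) = sgn w" by (auto simp: spow_eq sgn_mult sgn_if)
  ultimately show ?thesis
    by (simp add: spow_eq[of e]) (simp add: sgn_if abs_if)
qed

text \<open>Comparing a coordinate with a threshold obtained by a \<open>p\<close>-th root amounts
  to comparing signed powers with a point drawn on the transformed axis.\<close>

lemma le_spow_root_iff:
  assumes "0 < e"
  shows "y \<le> m + spow (1 / e) w \<longleftrightarrow> spow e (y - m) \<le> w"
  using spow_le_iff[OF assms, of "y - m" "spow (1 / e) w"] spow_inverse[OF assms, of w] by auto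

text \<open>Mean value theorem. The left end 0 is treated by hand, as the derivative is taken at
  positive bases.\<close>

lemma powr_diff_le:
  fixes a b p :: real
  assumes "0 \<le> a" "a \<le> b" "1 \<le> p"
  shows "b powr p - a powr p \<le> p * (b - a) * b powr (p - 1)"
proof (cases "a = 0 \<or> a = b")
  case True
  have "b powr p = b * b powr (p - 1)" if "0 < b"
    using that by (simp add: powr_mult_base)
  moreover have "1 * (b * b powr (p - 1)) \<le> p * (b * b powr (p - 1))"
    using assms by (intro mult_right_mono) auto
  ultimately show ?thesis using True assms by (cases "b = 0") (auto simp: mult.assoc)
next
  case False
  then have ab: "0 < a" "a < b" using assms by auto
  have "\<exists>z>a. z < b \<and> b powr p - a powr p = (b - a) * (p * z powr (p - 1))"
    using ab by (intro MVT2) (auto intro!: has_real_derivative_powr)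
  then obtain z where z: "a < z" "z < b" "b powr p - a powr p = (b - a) * (p * z powr (p - 1))"
    by blast
  have "z powr (p - 1) \<le> b powr (p - 1)" using z ab assms by (intro powr_mono2) auto
  then have "(b - a) * (p * z powr (p - 1)) \<le> (b - a) * (p * b powr (p - 1))"
    using ab assms by (intro mult_left_mono) auto
  then show ?thesis using z(3) by (simp add: mult_ac)
qed

text \<open>Equal signs reduce to \<open>powr_diff_le\<close>. For opposite signs 0 lies between
  \<open>a\<close> and \<open>b\<close>: both powers are compared with that of 0, and the absolute
  values add up to \<open>\<bar>a - b\<bar>\<close>.\<close>

lemma spow_diff_le:
  fixes a b p :: real
  assumes "1 \<le> p"
  shows "\<bar>spow p a - spow p b\<bar> \<le> p * \<bar>a - b\<bar> * (\<bar>a\<bar> + \<bar>a - b\<bar>) powr (p - 1)"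
proof -
  let ?B = "\<bar>a\<bar> + \<bar>a - b\<bar>"
  have step: "y powr p - x powr p \<le> p * (y - x) * ?B powr (p - 1)"
    if "0 \<le> x" "x \<le> y" "y \<le> ?B" for x y
  proof -
    have "y powr p - x powr p \<le> p * (y - x) * y powr (p - 1)"
      using that assms by (intro powr_diff_le) auto
    also have "\<dots> \<le> p * (y - x) * ?B powr (p - 1)"
      using that assms by (intro mult_left_mono powr_mono2) auto
    finally show ?thesis .
  qed
  have m: "p * (\<bar>x\<bar> - 0) * ?B powr (p - 1) \<ge> \<bar>x\<bar> powr p" if "\<bar>x\<bar> \<le> ?B" for x
    using step[of 0 "\<bar>x\<bar>"] that assms by simp
  consider "0 \<le> a" "0 \<le> b" | "a < 0" "b < 0" | "0 \<le> a" "b < 0" | "a < 0" "0 \<le> b" by linarith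
  then show ?thesis
  proof cases
    case 1
    then have "a powr p \<le> b powr p" if "a \<le> b" using that assms by (intro powr_mono2) auto
    moreover have "b powr p \<le> a powr p" if "b \<le> a" using that assms 1 by (intro powr_mono2) auto
    ultimately show ?thesis using 1 step[of a b] step[of b a]
      by (cases "a \<le> b") (simp_all add: spow_def)
  next
    case 2
    then have "a powr p \<le> b powr p" if "b \<le> a"
      using that assms powr_mono2[of p "-a" "-b"] by (simp add: uminus_powr_eq)
    moreover have "b powr p \<le> a powr p" if "a \<le> b"
      using that assms 2 powr_mono2[of p "-b" "-a"] by (simp add: uminus_powr_eq)
    ultimately show ?thesis using 2 step[of "-a" "-b"] step[of "-b" "-a"]
      by (cases "a \<le> b") (simp_all add: spow_def uminus_powr_eq)
  next
    case 3
    have "\<bar>spow p a - spow p b\<bar> = \<bar>a\<bar> powr p + \<bar>b\<bar> powr p"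
      using 3 by (cases "a = 0") (simp_all add: spow_eq)
    also have "\<dots> \<le> p * (\<bar>a\<bar> - 0) * ?B powr (p - 1) + p * (\<bar>b\<bar> - 0) * ?B powr (p - 1)"
      using 3 by (intro add_mono m) auto
    also have "\<dots> = p * \<bar>a - b\<bar> * ?B powr (p - 1)" using 3 by (simp add: algebra_simps)
    finally show ?thesis .
  next
    case 4
    have "\<bar>spow p a - spow p b\<bar> = \<bar>a\<bar> powr p + \<bar>b\<bar> powr p"
    proof -
      have "spow p a = - (\<bar>a\<bar> powr p)" "spow p b = \<bar>b\<bar> powr p"
        using 4 by (cases "b = 0"; simp add: spow_eq)+
      moreover have "0 \<le> \<bar>a\<bar> powr p" "0 \<le> \<bar>b\<bar> powr p" by simp_all
      ultimately show ?thesis by linarith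
    qed
    also have "\<dots> \<le> p * (\<bar>a\<bar> - 0) * ?B powr (p - 1) + p * (\<bar>b\<bar> - 0) * ?B powr (p - 1)"
      using 4 by (intro add_mono m) auto
    also have "\<dots> = p * \<bar>a - b\<bar> * ?B powr (p - 1)" using 4 by (simp add: algebra_simps)
    finally show ?thesis .
  qed
qed

text \<open>The left side is at most \<open>exp ((p - 1) / \<theta>)\<close>, hence at most
  \<open>exp 1\<close>: a relative change of at most \<open>1 / p\<close> alters the power by a
  bounded factor. This keeps the approximation linear in \<open>p\<close> instead of
  exponential.\<close>

lemma one_plus_inverse_powr_le:
  fixes p \<theta> :: real
  assumes "1 \<le> p" "p \<le> \<theta>"
  shows "(1 + 1 / \<theta>) powr (p - 1) \<le> 3"
proof -
  have \<theta>: "0 < \<theta>" using assms by simp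
  have "ln (1 + 1 / \<theta>) \<le> 1 / \<theta>" using \<theta> by (intro ln_add_one_self_le_self) auto
  then have "(p - 1) * ln (1 + 1 / \<theta>) \<le> (p - 1) * (1 / \<theta>)" using assms by (intro mult_left_mono) auto
  also have "\<dots> \<le> 1" using assms \<theta> by (simp add: field_simps)
  finally have "exp ((p - 1) * ln (1 + 1 / \<theta>)) \<le> exp 1" by simp
  moreover have "1 + 1 / \<theta> \<noteq> 0" using \<theta> by (simp add: add_pos_pos less_imp_neq[symmetric])
  ultimately show ?thesis using order_trans[OF _ exp_le] by (simp add: powr_def)
qed

text \<open>
  A pointwise substitute for Hoelder's inequality: either the step is at most
  \<open>\<bar>a\<bar> / \<theta>\<close>, or \<open>\<bar>a\<bar>\<close> is less than \<open>\<theta>\<close> times the step.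
\<close>

lemma spow_diff_young:
  fixes a b p \<theta> :: real
  assumes "1 \<le> p" "p \<le> \<theta>"
  shows "\<bar>spow p a - spow p b\<bar> \<le> 3 * p / \<theta> * (\<bar>a\<bar> powr p + \<theta> powr p * \<bar>a - b\<bar> powr p)"
proof -
  let ?h = "\<bar>a - b\<bar>" and ?z = "\<bar>a\<bar>" and ?c = "(1 + 1 / \<theta>) powr (p - 1)"
  have \<theta>: "0 < \<theta>" "0 < p" using assms by simp_all
  have pw: "x * x powr (p - 1) = x powr p" if "0 \<le> x" for x :: real
    using that by (cases "x = 0") (simp_all add: powr_mult_base)
  have c: "?c \<le> 3" using assms by (rule one_plus_inverse_powr_le)
  \<comment> \<open>\<open>M\<close> stands for the larger of \<open>\<bar>a\<bar>\<close> and
    \<theta> times the step, so both cases below are instances.\<close>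
  have key: "p * ?h * (?z + ?h) powr (p - 1) \<le> 3 * p / \<theta> * M powr p"
    if "0 \<le> M" "?h \<le> M / \<theta>" "?z \<le> M" for M
  proof -
    have "(?z + ?h) powr (p - 1) \<le> (M * (1 + 1 / \<theta>)) powr (p - 1)"
      using that assms by (intro powr_mono2) (auto simp: algebra_simps)
    also have "\<dots> = M powr (p - 1) * ?c" by (simp add: powr_mult)
    also have "\<dots> \<le> M powr (p - 1) * 3" using c by (intro mult_left_mono) auto
    finally have "p * ?h * (?z + ?h) powr (p - 1) \<le> p * (M / \<theta>) * (M powr (p - 1) * 3)"
      using that \<theta> by (intro mult_mono) auto
    also have "\<dots> = 3 * p / \<theta> * (M * M powr (p - 1))" by simp
    finally show ?thesis using pw[OF that(1)] by simp
  qed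
  have "\<bar>spow p a - spow p b\<bar> \<le> p * ?h * (?z + ?h) powr (p - 1)"
    using assms(1) by (rule spow_diff_le)
  also have "\<dots> \<le> 3 * p / \<theta> * (?z powr p + \<theta> powr p * ?h powr p)"
  proof (cases "\<theta> * ?h \<le> ?z")
    case True
    then have "p * ?h * (?z + ?h) powr (p - 1) \<le> 3 * p / \<theta> * ?z powr p"
      using \<theta> by (intro key) (auto simp: field_simps)
    also have "\<dots> \<le> 3 * p / \<theta> * (?z powr p + \<theta> powr p * ?h powr p)"
      using \<theta> by (intro mult_left_mono) auto
    finally show ?thesis .
  next
    case False
    then have "p * ?h * (?z + ?h) powr (p - 1) \<le> 3 * p / \<theta> * (\<theta> * ?h) powr p"
      using \<theta> by (intro key) auto
    also have "(\<theta> * ?h) powr p = \<theta> powr p * ?h powr p" by (simp add: powr_mult)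
    also have "3 * p / \<theta> * (\<theta> powr p * ?h powr p) \<le>
        3 * p / \<theta> * (?z powr p + \<theta> powr p * ?h powr p)"
      using \<theta> by (intro mult_left_mono) auto
    finally show ?thesis .
  qed
  finally show ?thesis .
qed

text \<open>Two tangent-line bounds: \<open>ln \<alpha> \<le> \<alpha> - 1\<close> and
  \<open>1 + x \<le> exp x\<close>.\<close>

lemma powr_minus_ge_linear:
  fixes \<alpha> \<epsilon> :: real
  assumes "0 < \<alpha>" "0 \<le> \<epsilon>"
  shows "1 + \<epsilon> * (1 - \<alpha>) \<le> \<alpha> powr - \<epsilon>"
proof -
  have "1 - \<alpha> \<le> - ln \<alpha>" using ln_le_minus_one[OF assms(1)] by simp
  then have "1 + \<epsilon> * (1 - \<alpha>) \<le> 1 + \<epsilon> * - ln \<alpha>" using assms by (intro add_left_mono mult_left_mono)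
  also have "\<dots> \<le> exp (\<epsilon> * - ln \<alpha>)" by (rule exp_ge_add_one_self)
  finally show ?thesis using assms by (simp add: powr_def)
qed

text \<open>Convexity of the power at the midpoint of \<open>\<bar>a\<bar>\<close> and
  \<open>\<bar>b\<bar>\<close>; zero is set apart because the convex function lives on the open
  half-line.\<close>

lemma abs_add_powr_le:
  fixes a b p :: real
  assumes "1 \<le> p"
  shows "\<bar>a + b\<bar> powr p \<le> 2 powr (p - 1) * (\<bar>a\<bar> powr p + \<bar>b\<bar> powr p)"
proof (cases "a = 0 \<or> b = 0")
  case True
  have "1 * (\<bar>a\<bar> powr p + \<bar>b\<bar> powr p) \<le> 2 powr (p - 1) * (\<bar>a\<bar> powr p + \<bar>b\<bar> powr p)"
    using assms by (intro mult_right_mono ge_one_powr_ge_zero) auto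
  then show ?thesis using True by auto
next
  case False
  have cvx: "convex_on {0<..} (\<lambda>x::real. x powr p)"
    using assms by (rule powr_convex)
  have "((1 - 1/2) *\<^sub>R \<bar>a\<bar> + (1/2) *\<^sub>R \<bar>b\<bar>) powr p \<le> (1 - 1/2) * \<bar>a\<bar> powr p + (1/2) * \<bar>b\<bar> powr p"
    using cvx by (rule convex_onD) (use False in auto)
  then have "((\<bar>a\<bar> + \<bar>b\<bar>) / 2) powr p \<le> (\<bar>a\<bar> powr p + \<bar>b\<bar> powr p) / 2"
    by (simp add: add_divide_distrib)
  then have "(\<bar>a\<bar> + \<bar>b\<bar>) powr p \<le> 2 powr p / 2 * (\<bar>a\<bar> powr p + \<bar>b\<bar> powr p)"
    by (simp add: powr_divide field_simps)
  moreover have "\<bar>a + b\<bar> powr p \<le> (\<bar>a\<bar> + \<bar>b\<bar>) powr p" using assms by (intro powr_mono2) auto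
  moreover have "2 powr p / 2 = (2 powr (p - 1) :: real)" by (simp add: powr_diff)
  ultimately show ?thesis by simp
qed

text \<open>Serves as the triangle inequality for \<open>p\<close>-th powers with equal radii: the
  factor \<open>2^(p-1)\<close> from convexity and the two summands combine to exactly
  \<open>2^p\<close>.\<close>

lemma sum_powr_add_le:
  fixes a b :: "nat \<Rightarrow> real" and p M :: real
  assumes "1 \<le> p" "(\<Sum>j\<in>J. \<bar>a j\<bar> powr p) \<le> M powr p" "(\<Sum>j\<in>J. \<bar>b j\<bar> powr p) \<le> M powr p" "0 \<le> M"
  shows "(\<Sum>j\<in>J. \<bar>a j + b j\<bar> powr p) \<le> (2 * M) powr p"
proof -
  have "(\<Sum>j\<in>J. \<bar>a j + b j\<bar> powr p) \<le> (\<Sum>j\<in>J. 2 powr (p - 1) * (\<bar>a j\<bar> powr p + \<bar>b j\<bar> powr p))"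
    using assms by (intro sum_mono abs_add_powr_le)
  also have "\<dots> = 2 powr (p - 1) * ((\<Sum>j\<in>J. \<bar>a j\<bar> powr p) + (\<Sum>j\<in>J. \<bar>b j\<bar> powr p))"
    by (simp add: sum_distrib_left sum.distrib distrib_left)
  also have "\<dots> \<le> 2 powr (p - 1) * (M powr p + M powr p)"
    using assms by (intro mult_left_mono add_mono) auto
  also have "\<dots> = (2 * M) powr p" using assms by (simp add: powr_mult powr_diff)
  finally show ?thesis .
qed

text \<open>The grid points in a half-open interval are the integers between two ceilings. Each
  ceiling errs by less than 1, and the two errors enter with opposite signs.\<close>

lemma card_nat_grid_interval:
  fixes a b \<Lambda> :: real
  assumes "0 < \<Lambda>" "0 < N" "0 \<le> a" "a \<le> b" "b \<le> \<Lambda>"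
  shows "\<bar>real (card {v. v < N \<and> a \<le> \<Lambda> * real v / real N \<and> \<Lambda> * real v / real N < b})
           - real N * (b - a) / \<Lambda>\<bar> \<le> 1"
proof -
  define \<alpha> \<beta> where "\<alpha> = a * N / \<Lambda>" and "\<beta> = b * N / \<Lambda>"
  have ab: "0 \<le> \<alpha>" "\<alpha> \<le> \<beta>" "\<beta> \<le> N"
    using assms by (auto simp: \<alpha>_def \<beta>_def field_simps intro!: divide_right_mono)
  have "{v. v < N \<and> a \<le> \<Lambda> * real v / real N \<and> \<Lambda> * real v / real N < b} =
      {v. v < N \<and> \<alpha> \<le> real v \<and> real v < \<beta>}"
    using assms by (auto simp: \<alpha>_def \<beta>_def field_simps)
  also have "\<dots> = {nat \<lceil>\<alpha>\<rceil>..<nat \<lceil>\<beta>\<rceil>}"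
    using ab by (auto simp: nat_le_iff ceiling_le_iff less_ceiling_iff zless_nat_eq_int_zless)
  finally have grid: "{v. v < N \<and> a \<le> \<Lambda> * real v / real N \<and> \<Lambda> * real v / real N < b} =
      {nat \<lceil>\<alpha>\<rceil>..<nat \<lceil>\<beta>\<rceil>}" .
  have "real (card {v. v < N \<and> a \<le> \<Lambda> * real v / real N \<and> \<Lambda> * real v / real N < b}) =
      of_int \<lceil>\<beta>\<rceil> - of_int \<lceil>\<alpha>\<rceil>"
    unfolding grid using ab ceiling_mono[OF ab(2)] by (subst card_atLeastLessThan, subst of_nat_diff) (simp_all add: nat_mono, linarith+)
  moreover have "real N * (b - a) / \<Lambda> = \<beta> - \<alpha>"
    using assms by (simp add: \<alpha>_def \<beta>_def field_simps)
  ultimately show ?thesis by linarith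
qed

section \<open>Loops as functions\<close>

text \<open>What a scanning loop leaves in a register that it overwrites at every hit, with
  \<open>z\<close> as its initial content. Choosing representatives, quantiles and cuts in this way
  makes them literally the values that the machine computes.\<close>

primrec last_of :: "(nat \<Rightarrow> 'a) \<Rightarrow> (nat \<Rightarrow> bool) \<Rightarrow> 'a \<Rightarrow> nat \<Rightarrow> 'a" where
  "last_of f P z 0 = z"
| "last_of f P z (Suc i) = (if P i then f i else last_of f P z i)"

lemma last_of_hit: "\<exists>i<k. P i \<Longrightarrow> \<exists>i<k. P i \<and> last_of f P z k = f i"
  by (induction k) (auto simp: less_Suc_eq)

lemma last_of_miss: "\<forall>i<k. \<not> P i \<Longrightarrow> last_of f P z k = z"
  by (induction k) auto

definition num :: "(nat \<Rightarrow> bool) \<Rightarrow> nat \<Rightarrow> nat" where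
  "num P k = card {i. i < k \<and> P i}"

lemma num_0 [simp]: "num P 0 = 0"
  by (simp add: num_def)

lemma num_Suc [simp]: "num P (Suc k) = (if P k then Suc (num P k) else num P k)"
proof -
  have "{i. i < Suc k \<and> P i} = (if P k then insert k {i. i < k \<and> P i} else {i. i < k \<and> P i})"
    by (auto simp: less_Suc_eq)
  then show ?thesis by (simp add: num_def)
qed

lemma num_le: "num P k \<le> k"
  by (induction k) auto


section \<open>A random cut\<close>

locale lp_instance =
  fixes n d :: nat and X :: "nat \<Rightarrow> nat \<Rightarrow> real" and p \<epsilon> r :: real
  assumes n: "1 \<le> n" and d: "1 \<le> d" and p: "2 \<le> p" and eps: "0 < \<epsilon>" "\<epsilon> \<le> 1" and r: "0 < r"
begin

text \<open>A cut costs a relative error of \<open>3 * d / N\<close>, and \<open>good_prob\<close>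
  accumulates at most \<open>n\<close> such errors. The choice makes the total
  \<open>1 / (2 * n)\<close>, at most half of \<open>n powr - \<epsilon>\<close>.\<close>

definition N :: nat where "N = 6 * n * n * d"

definition dst :: "(nat \<Rightarrow> real) \<Rightarrow> (nat \<Rightarrow> real) \<Rightarrow> real" where
  "dst x y = (\<Sum>j<d. (x j - y j) powr p)"

text \<open>
  All distances are compared through their \<open>p\<close>-th powers: \<open>thr2\<close> and \<open>thr4\<close> stand for the
  radii \<open>2R\<close> and \<open>4R\<close> with \<open>R = 120 p r / \<epsilon>\<close>.
\<close>

definition thr2 :: real where "thr2 = (240 * p / \<epsilon> * r) powr p"
definition thr4 :: real where "thr4 = (240 * p / \<epsilon> * r + 240 * p / \<epsilon> * r) powr p"

text \<open>A node of one or two points always has a dense point, so cuts are made in larger nodes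
  only.\<close>

definition dense :: "nat set \<Rightarrow> nat \<Rightarrow> bool" where
  "dense S i \<longleftrightarrow> i \<in> S \<and> card S \<le> 2 * card {y\<in>S. dst (X i) (X y) \<le> thr2}"

definition ball :: "nat set \<Rightarrow> bool" where "ball S \<longleftrightarrow> (\<exists>i<n. dense S i)"

text \<open>The default 0 is the index of an actual point, so a query can compare itself with
  \<open>rep S\<close> at every node: whatever passes the test at radius \<open>4R\<close> is a
  correct answer.\<close>

definition rep :: "nat set \<Rightarrow> nat" where "rep S = last_of id (dense S) 0 n"

text \<open>\<open>card S / (8 * d)\<close> rounded up. Strictly beyond the two order statistics of
  all \<open>d\<close> coordinates there are at most \<open>2 * d * (kap S - 1)\<close> points, a
  quarter of the node, while each side of a cut still misses \<open>kap S\<close> points.\<close>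

definition kap :: "nat set \<Rightarrow> nat" where "kap S = (card S + 8 * d - 1) div (8 * d)"

text \<open>Ranks count from 1; \<open>qt\<close> is 0 if there is no point of rank \<open>k\<close>.\<close>

definition kth :: "nat set \<Rightarrow> nat \<Rightarrow> nat \<Rightarrow> nat \<Rightarrow> bool" where
  "kth S j k i \<longleftrightarrow> i \<in> S \<and> card {y\<in>S. X y j < X i j} < k \<and> k \<le> card {y\<in>S. X y j \<le> X i j}"

definition qt :: "nat set \<Rightarrow> nat \<Rightarrow> nat \<Rightarrow> real" where
  "qt S j k = last_of (\<lambda>i. X i j) (kth S j k) 0 n"

definition med :: "nat set \<Rightarrow> nat \<Rightarrow> real" where "med S j = qt S j ((card S + 1) div 2)"
definition lo :: "nat set \<Rightarrow> nat \<Rightarrow> real" where "lo S j = qt S j (kap S)"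
definition hi :: "nat set \<Rightarrow> nat \<Rightarrow> real" where "hi S j = qt S j (card S + 1 - kap S)"
definition cA :: "nat set \<Rightarrow> nat \<Rightarrow> real" where "cA S j = spow p (lo S j - med S j)"
definition cB :: "nat set \<Rightarrow> nat \<Rightarrow> real" where "cB S j = spow p (hi S j - med S j)"
text \<open>The intervals from \<open>cA\<close> to \<open>cB\<close> of the coordinates are laid
  end to end, and \<open>pre\<close> marks the joints. One point of the joined axis then selects the
  coordinate and the threshold together.\<close>

definition pre :: "nat set \<Rightarrow> nat \<Rightarrow> real" where "pre S j = (\<Sum>i<j. cB S i - cA S i)"
definition uu :: "nat set \<Rightarrow> nat \<Rightarrow> real" where "uu S v = pre S d * real v / real N"
definition pick :: "nat set \<Rightarrow> nat \<Rightarrow> nat \<Rightarrow> bool" where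
  "pick S v j \<longleftrightarrow> pre S j \<le> uu S v \<and> uu S v < pre S (Suc j)"
definition coord :: "nat set \<Rightarrow> nat \<Rightarrow> nat" where "coord S v = last_of id (pick S v) 0 d"
definition thr :: "nat set \<Rightarrow> nat \<Rightarrow> real" where
  "thr S v = last_of (\<lambda>j. med S j + spow (1 / p) (cA S j + (uu S v - pre S j))) (pick S v) 0 d"

definition cut :: "nat set \<Rightarrow> nat \<Rightarrow> (nat \<Rightarrow> real) \<Rightarrow> bool" where
  "cut S v x \<longleftrightarrow> x (coord S v) \<le> thr S v"

definition side :: "nat set \<Rightarrow> nat \<Rightarrow> nat \<Rightarrow> nat set" where
  "side S v i = {y\<in>S. cut S v (X y) \<longleftrightarrow> cut S v (X i)}"

definition \<theta> :: real where "\<theta> = 120 * p / \<epsilon>"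

lemma N_pos: "0 < N" using n d by (simp add: N_def)

lemma theta: "p \<le> \<theta>" "0 < \<theta>" "3 * p / \<theta> = \<epsilon> / 40"
  using p eps by (auto simp: \<theta>_def field_simps intro: order_trans[of _ "120 * p"])

lemma thr2_eq: "thr2 = (2 * (\<theta> * r)) powr p"
  by (simp add: thr2_def \<theta>_def mult.assoc)

lemma dst_abs: "dst x y = (\<Sum>j<d. \<bar>x j - y j\<bar> powr p)"
  unfolding dst_def by (intro sum.cong refl real_powr_abs)

lemma dst_commute: "dst x y = dst y x"
  by (simp add: dst_abs abs_minus_commute)

lemma dst_triangle:
  assumes "dst x y \<le> M powr p" "dst y z \<le> M powr p" "0 \<le> M"
  shows "dst x z \<le> (2 * M) powr p"
  using sum_powr_add_le[of p "\<lambda>j. x j - y j" "{..<d}" M "\<lambda>j. y j - z j"] assms p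
  by (simp add: dst_abs)

text \<open>Division with remainder. The third bound limits the points affected by clamping, the
  fourth yields the geometric decrease of the node sizes.\<close>

lemma kap_bounds:
  assumes "0 < card S"
  shows "1 \<le> kap S" "kap S \<le> (card S + 1) div 2" "8 * d * (kap S - 1) \<le> card S" "card S \<le> 8 * d * kap S"
proof -
  define s where "s = card S"
  define k where "k = kap S"
  have k: "k = (s + 8 * d - 1) div (8 * d)" by (simp add: k_def s_def kap_def)
  have s: "0 < s" using assms by (simp add: s_def)
  have e: "8 * d * k + (s + 8 * d - 1) mod (8 * d) = s + 8 * d - 1"
    unfolding k by (rule mult_div_mod_eq)
  have m: "(s + 8 * d - 1) mod (8 * d) < 8 * d" using d by (intro mod_less_divisor) simp
  have 1: "1 \<le> k"
  proof (rule ccontr)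
    assume "\<not> 1 \<le> k" then have "k = 0" by simp
    then show False using e m s by simp
  qed
  moreover have 3: "8 * d * (k - 1) \<le> s"
  proof -
    have "8 * d * (k - 1) + 8 * d = 8 * d * k" using 1 by (cases k) simp_all
    then show ?thesis using e by linarith
  qed
  moreover have "s \<le> 8 * d * k" using e m s by linarith
  moreover have "k \<le> (s + 1) div 2"
  proof -
    have "8 * (k - 1) \<le> 8 * d * (k - 1)" using d by (intro mult_right_mono) auto
    then have "8 * (k - 1) \<le> s" using 3 by linarith
    then show ?thesis using 1 s by linarith
  qed
  ultimately show "1 \<le> kap S" "kap S \<le> (card S + 1) div 2" "8 * d * (kap S - 1) \<le> card S"
    "card S \<le> 8 * d * kap S"
    by (simp_all add: k_def s_def)
qed

text \<open>Coordinates may be tied. Among the points with at least \<open>k\<close> points weakly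
  below, one with the smallest coordinate works: if \<open>k\<close> points were strictly below it,
  the highest of these would be a smaller candidate.\<close>

lemma kth_exists:
  assumes "S \<subseteq> {..<n}" "1 \<le> k" "k \<le> card S"
  shows "\<exists>i<n. kth S j k i"
proof -
  have fin: "finite S" using assms(1) finite_subset by blast
  let ?T = "{i\<in>S. k \<le> card {y\<in>S. X y j \<le> X i j}}"
  have "S \<noteq> {}" using assms by auto
  then have "Max ((\<lambda>i. X i j) ` S) \<in> (\<lambda>i. X i j) ` S" using fin by (intro Max_in) auto
  then obtain m where m: "m \<in> S" "X m j = Max ((\<lambda>i. X i j) ` S)" by auto
  have "{y\<in>S. X y j \<le> X m j} = S" using m fin by auto
  then have "m \<in> ?T" using m assms by simp
  then have "?T \<noteq> {}" "finite ?T" using fin by auto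
  then have "Min ((\<lambda>i. X i j) ` ?T) \<in> (\<lambda>i. X i j) ` ?T" by (intro Min_in) auto
  then obtain i where i: "i \<in> ?T" "X i j = Min ((\<lambda>i. X i j) ` ?T)" by auto
  have min: "X i j \<le> X y j" if "y \<in> ?T" for y
    using that \<open>finite ?T\<close> unfolding i(2) by (intro Min_le) auto
  have "card {y\<in>S. X y j < X i j} < k"
  proof (rule ccontr)
    let ?L = "{y\<in>S. X y j < X i j}"
    assume *: "\<not> card ?L < k"
    then have "0 < card ?L" using assms(2) by linarith
    then have "?L \<noteq> {}" by (metis card.empty less_irrefl)
    then have "Max ((\<lambda>i. X i j) ` ?L) \<in> (\<lambda>i. X i j) ` ?L" using fin by (intro Max_in) auto
    then obtain y where y: "y \<in> ?L" "X y j = Max ((\<lambda>i. X i j) ` ?L)" by auto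
    have "?L \<subseteq> {z\<in>S. X z j \<le> X y j}" using fin unfolding y(2) by auto
    then have "card ?L \<le> card {z\<in>S. X z j \<le> X y j}" using fin by (intro card_mono) auto
    then have "y \<in> ?T" using * y by auto
    then show False using min[of y] y by auto
  qed
  then show ?thesis using i assms(1) by (auto simp: kth_def)
qed

lemma qt:
  assumes "S \<subseteq> {..<n}" "1 \<le> k" "k \<le> card S"
  shows "card {y\<in>S. X y j < qt S j k} < k" "k \<le> card {y\<in>S. X y j \<le> qt S j k}"
proof -
  obtain i where i: "kth S j k i" "qt S j k = X i j"
    using last_of_hit[OF kth_exists[OF assms], of j "\<lambda>i. X i j" 0] unfolding qt_def by blast
  show "card {y\<in>S. X y j < qt S j k} < k" "k \<le> card {y\<in>S. X y j \<le> qt S j k}"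
    using i(1) unfolding i(2) by (simp_all add: kth_def)
qed

lemma qt_mono:
  assumes "S \<subseteq> {..<n}" "1 \<le> k" "k \<le> k'" "k' \<le> card S"
  shows "qt S j k \<le> qt S j k'"
proof (rule ccontr)
  assume *: "\<not> ?thesis"
  have "finite S" using assms(1) finite_subset by blast
  then have "card {y\<in>S. X y j \<le> qt S j k'} \<le> card {y\<in>S. X y j < qt S j k}"
    using * by (intro card_mono) auto
  then show False using qt(1)[of S k j] qt(2)[of S k' j] assms by linarith
qed

lemma card_ge_qt:
  assumes "S \<subseteq> {..<n}" "1 \<le> k" "k \<le> card S"
  shows "card S + 1 - k \<le> card {y\<in>S. qt S j k \<le> X y j}"
proof -
  have fin: "finite S" using assms(1) finite_subset by blast
  have "card S = card ({y\<in>S. X y j < qt S j k} \<union> {y\<in>S. qt S j k \<le> X y j})"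
    by (rule arg_cong[of _ _ card]) auto
  also have "\<dots> = card {y\<in>S. X y j < qt S j k} + card {y\<in>S. qt S j k \<le> X y j}"
    using fin by (intro card_Un_disjoint) auto
  finally show ?thesis using qt(1)[OF assms, of j] by linarith
qed

end

section \<open>Geometry of a cut in a node without dense points\<close>

locale cut_node = lp_instance +
  fixes S :: "nat set"
  assumes S: "S \<subseteq> {..<n}" "S \<noteq> {}" and not_ball: "\<not> ball S"
begin

lemma finS [simp]: "finite S" using S finite_subset by blast

lemma cardS: "0 < card S" using S by (simp add: card_gt_0_iff)

lemma lo_med: "lo S j \<le> med S j" and med_hi: "med S j \<le> hi S j"
  using kap_bounds[OF cardS] cardS unfolding lo_def med_def hi_def
  by (intro qt_mono S(1); linarith)+

lemma card_le_med: "card S \<le> 2 * card {y\<in>S. X y j \<le> med S j}"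
  using qt(2)[OF S(1), of "(card S + 1) div 2" j] cardS unfolding med_def by linarith

lemma card_ge_med: "card S \<le> 2 * card {y\<in>S. med S j \<le> X y j}"
  using card_ge_qt[OF S(1), of "(card S + 1) div 2" j] cardS unfolding med_def by linarith

lemma card_less_lo: "card {y\<in>S. X y j < lo S j} \<le> kap S - 1"
  using qt(1)[OF S(1), of "kap S" j] kap_bounds[OF cardS] unfolding lo_def by linarith

lemma card_le_lo: "kap S \<le> card {y\<in>S. X y j \<le> lo S j}"
  using qt(2)[OF S(1), of "kap S" j] kap_bounds[OF cardS] unfolding lo_def by linarith

lemma card_ge_hi: "kap S \<le> card {y\<in>S. hi S j \<le> X y j}"
  using card_ge_qt[OF S(1), of "card S + 1 - kap S" j] kap_bounds[OF cardS] cardS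
  unfolding hi_def by linarith

lemma card_greater_hi: "card {y\<in>S. hi S j < X y j} \<le> kap S - 1"
proof -
  have "card S = card ({y\<in>S. hi S j < X y j} \<union> {y\<in>S. X y j \<le> hi S j})"
    by (rule arg_cong[of _ _ card]) auto
  also have "\<dots> = card {y\<in>S. hi S j < X y j} + card {y\<in>S. X y j \<le> hi S j}"
    by (intro card_Un_disjoint) auto
  finally show ?thesis
    using qt(2)[OF S(1), of "card S + 1 - kap S" j] kap_bounds[OF cardS] cardS
    unfolding hi_def by linarith
qed

definition clamp :: "nat \<Rightarrow> real \<Rightarrow> real" where
  "clamp j y = max (lo S j) (min (hi S j) y)"

text \<open>The clamped signed \<open>p\<close>-th power embeds the node into \<open>\<ell>\<^sub>1\<close>, with the median at the origin.\<close>

definition cl :: "nat \<Rightarrow> real \<Rightarrow> real" where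
  "cl j y = spow p (clamp j y - med S j)"

text \<open>The position of a coordinate value on the axis of joined intervals.\<close>

definition \<Phi> :: "nat \<Rightarrow> real \<Rightarrow> real" where
  "\<Phi> j y = pre S j + (cl j y - cA S j)"

definition \<Delta> :: "(nat \<Rightarrow> real) \<Rightarrow> (nat \<Rightarrow> real) \<Rightarrow> real" where
  "\<Delta> x y = (\<Sum>j<d. \<bar>cl j (x j) - cl j (y j)\<bar>)"

definition sep :: "(nat \<Rightarrow> real) \<Rightarrow> (nat \<Rightarrow> real) \<Rightarrow> nat set" where
  "sep x y = {v. v < N \<and> cut S v x \<noteq> cut S v y}"

lemma ppos: "0 < p" "1 \<le> p" using p by auto

lemma clamp_bounds: "lo S j \<le> clamp j y" "clamp j y \<le> hi S j"
  using lo_med[of j] med_hi[of j] by (auto simp: clamp_def)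

lemma cl_bounds: "cA S j \<le> cl j y" "cl j y \<le> cB S j"
  using clamp_bounds[of j y] by (simp_all add: cA_def cB_def cl_def spow_le_iff ppos)

lemma Phi_bounds: "pre S j \<le> \<Phi> j y" "\<Phi> j y \<le> pre S (Suc j)"
  using cl_bounds[of j y] by (simp_all add: \<Phi>_def pre_def)

lemma pre_mono: "i \<le> j \<Longrightarrow> pre S i \<le> pre S j"
proof (induction rule: dec_induct)
  case (step j)
  then show ?case using Phi_bounds[of j 0] by linarith
qed simp

lemma pre_0: "pre S 0 = 0" by (simp add: pre_def)

lemma pre_nonneg: "0 \<le> pre S j" using pre_mono[of 0 j] by (simp add: pre_0)

lemma pick_unique: "pick S v i \<Longrightarrow> pick S v j \<Longrightarrow> i = j"
  using pre_mono[of "Suc i" j] pre_mono[of "Suc j" i] unfolding pick_def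
  by (cases i j rule: linorder_cases) (auto simp: Suc_le_eq)

lemma pick_exists:
  assumes "0 < pre S d" "v < N"
  shows "\<exists>j<d. pick S v j"
proof -
  have u: "0 \<le> uu S v" "uu S v < pre S d"
    using assms by (auto simp: uu_def field_simps)
  define j where "j = (LEAST j. uu S v < pre S j)"
  have j: "uu S v < pre S j" unfolding j_def using u(2) by (rule LeastI)
  have jd: "j \<le> d" unfolding j_def using u(2) by (rule Least_le)
  have "j \<noteq> 0" using j u(1) by (auto simp: pre_0 intro!: gr0I)
  then obtain i where i: "j = Suc i" by (cases j) auto
  have "\<not> uu S v < pre S i" using not_less_Least[of i "\<lambda>j. uu S v < pre S j"] i by (simp add: j_def)
  then show ?thesis using i j jd unfolding pick_def by (intro exI[of _ i]) auto
qed

text \<open>\<open>le_spow_root_iff\<close> moves the comparison to the joined axis, and clamping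
  does not affect it because the threshold lies in the half-open range from \<open>lo\<close> to
  \<open>hi\<close>. Half-openness, inherited from \<open>pick\<close>, also puts the points at
  \<open>lo\<close> and those at \<open>hi\<close> on different sides.\<close>

lemma cut_iff:
  assumes "v < N" "j < d" "pick S v j"
  shows "cut S v x \<longleftrightarrow> \<Phi> j (x j) \<le> uu S v" "coord S v = j" "lo S j \<le> thr S v" "thr S v < hi S j"
proof -
  have ex: "\<exists>j<d. pick S v j" using assms by blast
  show J: "coord S v = j"
    using last_of_hit[OF ex, of id 0] pick_unique assms unfolding coord_def by auto
  define w where "w = cA S j + (uu S v - pre S j)"
  have t: "thr S v = med S j + spow (1 / p) w"
    using last_of_hit[OF ex, of "\<lambda>j. med S j + spow (1 / p) (cA S j + (uu S v - pre S j))" 0]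
      pick_unique assms unfolding thr_def w_def by auto
  have w: "cA S j \<le> w" "w < cB S j"
    using assms(3) by (auto simp: pick_def w_def pre_def)
  have le: "y \<le> thr S v \<longleftrightarrow> spow p (y - med S j) \<le> w" for y
    unfolding t by (rule le_spow_root_iff) (rule ppos)
  show lo: "lo S j \<le> thr S v" unfolding le using w by (simp add: cA_def)
  show hi: "thr S v < hi S j" using le[of "hi S j"] w by (simp add: cB_def)
  have "x j \<le> thr S v \<longleftrightarrow> clamp j (x j) \<le> thr S v"
    using lo hi by (auto simp: clamp_def)
  also have "\<dots> \<longleftrightarrow> cl j (x j) \<le> w" by (simp add: le cl_def)
  also have "\<dots> \<longleftrightarrow> \<Phi> j (x j) \<le> uu S v" by (auto simp: \<Phi>_def w_def)
  finally show "cut S v x \<longleftrightarrow> \<Phi> j (x j) \<le> uu S v" by (simp add: cut_def J)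
qed

text \<open>A grid point separates \<open>x\<close> and \<open>y\<close> exactly if it lies between
  their positions in the interval of its coordinate. These \<open>d\<close> half-open ranges are
  disjoint, and each is counted with an error of at most 1.\<close>

lemma card_sep:
  assumes "0 < pre S d"
  shows "\<bar>real (card (sep x y)) - real N / pre S d * \<Delta> x y\<bar> \<le> d"
proof -
  define a b where "a j = min (\<Phi> j (x j)) (\<Phi> j (y j))" and "b j = max (\<Phi> j (x j)) (\<Phi> j (y j))" for j
  define I where "I j = {v. v < N \<and> a j \<le> uu S v \<and> uu S v < b j}" for j
  have minmax: "(min s t \<le> u \<and> u < max s t) \<longleftrightarrow> ((s \<le> u) \<noteq> (t \<le> u))" for s t u :: real
    by linarith
  have I_iff: "v \<in> I j \<longleftrightarrow> v < N \<and> (\<Phi> j (x j) \<le> uu S v) \<noteq> (\<Phi> j (y j) \<le> uu S v)" for v j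
    by (simp add: I_def a_def b_def minmax)
  have I_pick: "pick S v j" if "v \<in> I j" for v j
    using that Phi_bounds[of j "x j"] Phi_bounds[of j "y j"]
    by (auto simp: I_def a_def b_def pick_def)
  have "sep x y = (\<Union>j<d. I j)"
  proof (intro equalityI subsetI)
    fix v assume v: "v \<in> sep x y"
    then have vN: "v < N" and c: "cut S v x \<noteq> cut S v y" by (auto simp: sep_def)
    obtain j where j: "j < d" "pick S v j" using pick_exists[OF assms vN] by blast
    then have "v \<in> I j" using c vN cut_iff(1)[OF vN j, of x] cut_iff(1)[OF vN j, of y]
      by (simp add: I_iff)
    then show "v \<in> (\<Union>j<d. I j)" using j by blast
  next
    fix v assume "v \<in> (\<Union>j<d. I j)"
    then obtain j where j: "j < d" "v \<in> I j" by blast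
    then have vN: "v < N" by (simp add: I_iff)
    note c = cut_iff(1)[OF vN j(1) I_pick[OF j(2)]]
    show "v \<in> sep x y" using c[of x] c[of y] j(2) by (simp add: sep_def I_iff)
  qed
  moreover have "card (\<Union>j<d. I j) = (\<Sum>j<d. card (I j))"
  proof (intro card_UN_disjoint ballI impI)
    show "I j \<inter> I j' = {}" if "j \<noteq> j'" for j j'
      using that I_pick pick_unique by blast
  qed (simp_all add: I_def)
  ultimately have c: "real (card (sep x y)) = (\<Sum>j<d. real (card (I j)))" by simp
  have "\<bar>real (card (I j)) - real N / pre S d * \<bar>cl j (x j) - cl j (y j)\<bar>\<bar> \<le> 1" if "j < d" for j
  proof -
    have "0 \<le> a j" "b j \<le> pre S d"
      using pre_nonneg[of j] pre_mono[of "Suc j" d] Phi_bounds[of j "x j"] Phi_bounds[of j "y j"] that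
      by (auto simp: a_def b_def)
    then have "\<bar>real (card (I j)) - real N * (b j - a j) / pre S d\<bar> \<le> 1"
      unfolding I_def uu_def using assms N_pos
      by (intro card_nat_grid_interval) (auto simp: a_def b_def)
    moreover have "b j - a j = \<bar>cl j (x j) - cl j (y j)\<bar>"
      by (auto simp: a_def b_def \<Phi>_def)
    ultimately show ?thesis by simp
  qed
  then have "(\<Sum>j<d. \<bar>real (card (I j)) - real N / pre S d * \<bar>cl j (x j) - cl j (y j)\<bar>\<bar>) \<le> (\<Sum>j<d. 1)"
    by (intro sum_mono) auto
  moreover have "\<bar>real (card (sep x y)) - real N / pre S d * \<Delta> x y\<bar>
      \<le> (\<Sum>j<d. \<bar>real (card (I j)) - real N / pre S d * \<bar>cl j (x j) - cl j (y j)\<bar>\<bar>)"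
    unfolding c \<Delta>_def sum_distrib_left sum_subtractf[symmetric] by (rule sum_abs)
  ultimately show ?thesis by simp
qed

lemma cl_sign:
  "y \<le> med S j \<Longrightarrow> cl j y \<le> 0" "med S j \<le> y \<Longrightarrow> 0 \<le> cl j y"
  using lo_med[of j] med_hi[of j] spow_le_iff[OF ppos(1), of "clamp j y - med S j" 0]
    spow_le_iff[OF ppos(1), of 0 "clamp j y - med S j"]
  by (auto simp: cl_def clamp_def)

text \<open>For at least half of the points the median lies between their coordinate and \<open>y\<close>.\<close>

lemma gain_coord:
  fixes y :: real
  shows "real (card S) * \<bar>cl j y\<bar> + (\<Sum>i\<in>S. \<bar>cl j (X i j)\<bar>) \<le> 5 * (\<Sum>i\<in>S. \<bar>cl j y - cl j (X i j)\<bar>)"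
proof -
  let ?D = "\<Sum>i\<in>S. \<bar>cl j y - cl j (X i j)\<bar>"
  have half: "real (card S) * \<bar>cl j y\<bar> \<le> 2 * ?D"
  proof -
    \<comment> \<open>The points across the median from \<open>y\<close>: their images are at
      distance at least \<open>\<bar>cl j y\<bar>\<close> from that of \<open>y\<close>.\<close>
    define H where "H = (if 0 \<le> cl j y then {i\<in>S. X i j \<le> med S j} else {i\<in>S. med S j \<le> X i j})"
    have "card S \<le> 2 * card H" using card_le_med card_ge_med by (simp add: H_def)
    then have "real (card S) * \<bar>cl j y\<bar> \<le> real (2 * card H) * \<bar>cl j y\<bar>"
      by (intro mult_right_mono) auto
    also have "\<dots> = 2 * (\<Sum>i\<in>H. \<bar>cl j y\<bar>)" by simp
    also have "(\<Sum>i\<in>H. \<bar>cl j y\<bar>) \<le> (\<Sum>i\<in>H. \<bar>cl j y - cl j (X i j)\<bar>)"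
    proof (intro sum_mono)
      fix i assume "i \<in> H"
      then show "\<bar>cl j y\<bar> \<le> \<bar>cl j y - cl j (X i j)\<bar>"
        using cl_sign[where j = j and y = "X i j"] by (cases "0 \<le> cl j y") (auto simp: H_def)
    qed
    also have "\<dots> \<le> ?D" by (intro sum_mono2) (auto simp: H_def)
    finally show ?thesis by simp
  qed
  \<comment> \<open>The first term is at most 2 times \<open>?D\<close>, so by the triangle
    inequality the second is at most 3 times \<open>?D\<close>: this is the 5.\<close>
  have "(\<Sum>i\<in>S. \<bar>cl j (X i j)\<bar>) \<le> (\<Sum>i\<in>S. \<bar>cl j y - cl j (X i j)\<bar> + \<bar>cl j y\<bar>)"
    by (intro sum_mono) auto
  also have "\<dots> = ?D + real (card S) * \<bar>cl j y\<bar>" by (simp add: sum.distrib)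
  finally show ?thesis using half by linarith
qed

definition nrm :: "(nat \<Rightarrow> real) \<Rightarrow> real" where "nrm x = (\<Sum>j<d. \<bar>cl j (x j)\<bar>)"

lemma gain:
  "real (card S) * nrm x + (\<Sum>i\<in>S. nrm (X i)) \<le> 5 * (\<Sum>i\<in>S. \<Delta> x (X i))"
proof -
  have "real (card S) * nrm x + (\<Sum>i\<in>S. nrm (X i)) =
      (\<Sum>j<d. real (card S) * \<bar>cl j (x j)\<bar> + (\<Sum>i\<in>S. \<bar>cl j (X i j)\<bar>))"
    by (simp add: nrm_def sum_distrib_left sum.distrib) (rule sum.swap)
  also have "\<dots> \<le> (\<Sum>j<d. 5 * (\<Sum>i\<in>S. \<bar>cl j (x j) - cl j (X i j)\<bar>))"
    by (intro sum_mono gain_coord)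
  also have "\<dots> = 5 * (\<Sum>i\<in>S. \<Delta> x (X i))"
    by (simp add: \<Delta>_def sum_distrib_left[symmetric]) (rule sum.swap)
  finally show ?thesis .
qed

text \<open>In each coordinate \<open>spow_diff_young\<close> charges the separation partly to the
  norm of \<open>x\<close> and partly to the step, enlarged by \<theta>; the steps add up to
  \<open>R^p\<close>. Clamping is 1-Lipschitz, so it does not enlarge the step to
  \<open>q\<close>.\<close>

lemma loss:
  assumes "dst x q \<le> r powr p"
  shows "\<Delta> x q \<le> \<epsilon> / 40 * (nrm x + (\<theta> * r) powr p)"
proof -
  have "\<Delta> x q \<le> (\<Sum>j<d. \<epsilon> / 40 * (\<bar>cl j (x j)\<bar> + \<theta> powr p * \<bar>x j - q j\<bar> powr p))"
    unfolding \<Delta>_def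
  proof (intro sum_mono)
    fix j
    let ?a = "clamp j (x j) - med S j" and ?b = "clamp j (q j) - med S j"
    have "\<bar>cl j (x j) - cl j (q j)\<bar> \<le> \<epsilon> / 40 * (\<bar>?a\<bar> powr p + \<theta> powr p * \<bar>?a - ?b\<bar> powr p)"
      unfolding cl_def theta(3)[symmetric] using ppos(2) theta(1) by (rule spow_diff_young)
    also have "\<dots> \<le> \<epsilon> / 40 * (\<bar>cl j (x j)\<bar> + \<theta> powr p * \<bar>x j - q j\<bar> powr p)"
      unfolding cl_def abs_spow using eps ppos
      by (intro mult_left_mono add_left_mono powr_mono2) (auto simp: clamp_def)
    finally show "\<bar>cl j (x j) - cl j (q j)\<bar> \<le> \<epsilon> / 40 * (\<bar>cl j (x j)\<bar> + \<theta> powr p * \<bar>x j - q j\<bar> powr p)" .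
  qed
  also have "\<dots> = \<epsilon> / 40 * (nrm x + \<theta> powr p * dst x q)"
    by (simp add: nrm_def dst_abs sum_distrib_left sum.distrib distrib_left)
  also have "\<dots> \<le> \<epsilon> / 40 * (nrm x + \<theta> powr p * r powr p)"
    using assms eps by (intro mult_left_mono add_left_mono) auto
  finally show ?thesis by (simp add: powr_mult)
qed

text \<open>
  If half of the points were within \<open>R\<close> of the median, each of them would be dense. Hence a quarter
  of the points are both far from the median and not moved by the clamping.
\<close>

lemma mean_nrm: "real (card S) * (\<theta> * r) powr p \<le> 4 * (\<Sum>i\<in>S. nrm (X i))"
proof -
  define M where "M = \<theta> * r"
  have M: "0 \<le> M" using theta r by (simp add: M_def)
  define Near where "Near = {i\<in>S. dst (X i) (med S) \<le> M powr p}"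
  define Out where "Out = (\<Union>j<d. {y\<in>S. X y j < lo S j} \<union> {y\<in>S. hi S j < X y j})"
  have near: "2 * card Near < card S"
  proof (rule ccontr)
    assume *: "\<not> ?thesis"
    then obtain i where i: "i \<in> Near" using cardS by (cases "Near = {}") auto
    have "dst (X i) (X y) \<le> thr2" if "y \<in> Near" for y
      unfolding thr2_eq M_def[symmetric]
      using that i M dst_commute[of "X y"] by (intro dst_triangle[of _ "med S"]) (auto simp: Near_def)
    then have "Near \<subseteq> {y\<in>S. dst (X i) (X y) \<le> thr2}" by (auto simp: Near_def)
    then have "card Near \<le> card {y\<in>S. dst (X i) (X y) \<le> thr2}" by (intro card_mono) auto
    then have "dense S i" using * i by (auto simp: dense_def Near_def)
    then show False using not_ball S(1) i by (auto simp: ball_def Near_def)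
  qed
  \<comment> \<open>Two tails of at most \<open>kap S - 1\<close> points in each of \<open>d\<close>
    coordinates make up at most a quarter of the node.\<close>
  have "card Out \<le> (\<Sum>j<d. card ({y\<in>S. X y j < lo S j} \<union> {y\<in>S. hi S j < X y j}))"
    unfolding Out_def by (rule card_UN_le) simp
  also have "\<dots> \<le> (\<Sum>j<d. (kap S - 1) + (kap S - 1))"
    using card_less_lo card_greater_hi
    by (intro sum_mono order_trans[OF card_Un_le] add_mono)
  finally have "4 * card Out \<le> 8 * d * (kap S - 1)" by (simp add: distrib_left)
  then have out: "4 * card Out \<le> card S" using kap_bounds(3)[OF cardS] by linarith
  define G where "G = S - (Near \<union> Out)"
  have "card S - card (Near \<union> Out) \<le> card G"
    unfolding G_def by (rule diff_card_le_card_Diff) (auto simp: Near_def Out_def)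
  then have G: "card S \<le> 4 * card G" using near out card_Un_le[of Near Out] by linarith
  have "M powr p \<le> nrm (X i)" if "i \<in> G" for i
  proof -
    have "nrm (X i) = dst (X i) (med S)"
      unfolding nrm_def dst_abs
    proof (intro sum.cong refl)
      fix j assume "j \<in> {..<d}"
      then have "lo S j \<le> X i j" "X i j \<le> hi S j" using that by (auto simp: G_def Out_def not_less)
      then have "clamp j (X i j) = X i j" by (simp add: clamp_def)
      then show "\<bar>cl j (X i j)\<bar> = \<bar>X i j - med S j\<bar> powr p" by (simp add: cl_def abs_spow)
    qed
    then show ?thesis using that by (auto simp: G_def Near_def)
  qed
  then have "real (card G) * M powr p \<le> (\<Sum>i\<in>G. nrm (X i))"
    using sum_bounded_below[of G "M powr p" "\<lambda>i. nrm (X i)"] by auto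
  also have "\<dots> \<le> (\<Sum>i\<in>S. nrm (X i))"
    by (intro sum_mono2) (auto simp: G_def nrm_def sum_nonneg)
  finally have "4 * (real (card G) * M powr p) \<le> 4 * (\<Sum>i\<in>S. nrm (X i))" by simp
  moreover have "real (card S) * M powr p \<le> real (4 * card G) * M powr p"
    using G by (intro mult_right_mono) auto
  ultimately show ?thesis unfolding M_def by simp
qed

text \<open>If the joined axis had length 0, every clamped coordinate would sit at its median and
  all norms would vanish, against \<open>mean_nrm\<close>. Hence a node that is not a ball can be
  cut.\<close>

lemma pre_pos: "0 < pre S d"
proof (rule ccontr)
  assume *: "\<not> ?thesis"
  have "cl j y = 0" if "j < d" for j y
  proof -
    have "pre S (Suc j) \<le> 0" using pre_mono[of "Suc j" d] that * by linarith
    moreover have "0 \<le> pre S j" by (rule pre_nonneg)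
    ultimately have "cB S j \<le> cA S j" by (simp add: pre_def)
    moreover have "cA S j \<le> 0" "0 \<le> cB S j"
      using lo_med[of j] med_hi[of j] spow_le_iff[OF ppos(1), of _ 0] spow_le_iff[OF ppos(1), of 0]
      by (auto simp: cA_def cB_def)
    ultimately show ?thesis using cl_bounds[of j y] by linarith
  qed
  then have "nrm x = 0" for x by (simp add: nrm_def)
  then have "real (card S) * (\<theta> * r) powr p \<le> 0" using mean_nrm by simp
  moreover have "0 < real (card S) * (\<theta> * r) powr p" using cardS theta r by simp
  ultimately show False by linarith
qed

text \<open>At least \<open>kap S\<close> points lie at or beyond the order statistic of the other
  side, and they are cut off whatever the threshold, because
  \<open>lo \<le> thr < hi\<close>.\<close>

lemma side_shrink:
  assumes "v < N"
  shows "card (side S v i) + kap S \<le> card S"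
proof -
  obtain j where j: "j < d" "pick S v j" using pick_exists[OF pre_pos assms] by blast
  note c = cut_iff[OF assms j]
  define Opp where "Opp = (if cut S v (X i) then {y\<in>S. hi S j \<le> X y j} else {y\<in>S. X y j \<le> lo S j})"
  have Opp: "kap S \<le> card Opp" using card_ge_hi card_le_lo by (simp add: Opp_def)
  have "card (side S v i) + card Opp = card (side S v i \<union> Opp)"
    using c(2-4) by (intro card_Un_disjoint[symmetric]) (auto simp: side_def Opp_def cut_def)
  also have "\<dots> \<le> card S" by (intro card_mono) (auto simp: side_def Opp_def)
  finally show ?thesis using Opp by linarith
qed

lemma side_nonempty: "i \<in> S \<Longrightarrow> i \<in> side S v i" by (simp add: side_def)

text \<open>Gain and loss cancel. Shrinking the node raises the potential
  \<open>card^-\<epsilon>\<close> by at least \<open>\<epsilon> * Z * (A + G) / 5\<close> in total,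
  relative to its old value; separation from the query costs at most twice
  \<open>\<epsilon> * Z * (A + G) / 10\<close>. What remains is rounding: \<open>d\<close> from the
  gain and \<open>2 * d\<close> from the loss.\<close>

lemma cut_step:
  assumes i: "i \<in> S" and q: "dst (X i) q \<le> r powr p"
  shows "(real N - 3 * d) * card S powr - \<epsilon> \<le>
    (\<Sum>v<N. if cut S v (X i) = cut S v q then real (card (side S v i)) powr - \<epsilon> else 0)"
proof -
  define s where "s = real (card S)"
  \<comment> \<open>Grid points per unit of length on the joined axis.\<close>
  define Z where "Z = real N / pre S d"
  define A where "A = nrm (X i)"
  define G where "G = (\<Sum>y\<in>S. nrm (X y)) / s"
  define \<alpha> where "\<alpha> v = real (card (side S v i)) / s" for v
  have s: "0 < s" using cardS by (simp add: s_def)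
  have Z: "0 \<le> Z" using pre_nonneg by (simp add: Z_def)
  have "s * (\<theta> * r) powr p \<le> s * (4 * G)" using mean_nrm s by (simp add: s_def G_def)
  then have G: "(\<theta> * r) powr p \<le> 4 * G" using s by simp
  have A: "0 \<le> A" by (simp add: A_def nrm_def sum_nonneg)
  have sepq: "real (card (sep (X i) q)) \<le> \<epsilon> / 10 * (Z * (A + G)) + d"
  proof -
    have "\<Delta> (X i) q \<le> \<epsilon> / 40 * (A + 4 * G)"
      using loss[OF q] G eps by (fastforce simp: A_def intro: order_trans mult_left_mono add_left_mono)
    also have "\<dots> \<le> \<epsilon> / 40 * (4 * (A + G))" using A eps by (intro mult_left_mono) auto
    finally have "Z * \<Delta> (X i) q \<le> Z * (\<epsilon> / 40 * (4 * (A + G)))" using Z by (intro mult_left_mono)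
    moreover have "Z * (\<epsilon> / 40 * (4 * (A + G))) = \<epsilon> / 10 * (Z * (A + G))" by simp
    ultimately show ?thesis using card_sep[OF pre_pos, of "X i" q] unfolding Z_def[symmetric] by linarith
  qed
  have gn: "s * (Z * (A + G) / 5 - d) \<le> (\<Sum>y\<in>S. real (card (sep (X i) (X y))))"
  proof -
    have "s * (A + G) \<le> 5 * (\<Sum>y\<in>S. \<Delta> (X i) (X y))"
      using gain[of "X i"] s by (simp add: A_def G_def s_def[symmetric] distrib_left)
    then have "Z * (s * (A + G)) \<le> Z * (5 * (\<Sum>y\<in>S. \<Delta> (X i) (X y)))" using Z by (intro mult_left_mono)
    then have "s * (Z * (A + G) / 5 - d) \<le> (\<Sum>y\<in>S. Z * \<Delta> (X i) (X y) - d)"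
      by (simp add: sum_subtractf sum_distrib_left s_def[symmetric] algebra_simps)
    also have "\<dots> \<le> (\<Sum>y\<in>S. real (card (sep (X i) (X y))))"
    proof (intro sum_mono)
      fix y show "Z * \<Delta> (X i) (X y) - d \<le> real (card (sep (X i) (X y)))"
        using card_sep[OF pre_pos, of "X i" "X y"] by (simp add: Z_def[symmetric] abs_le_iff)
    qed
    finally show ?thesis .
  qed
  \<comment> \<open>Double counting of the pairs of a cut and a point separated by it: cut
    \<open>v\<close> separates \<open>X i\<close> from \<open>s * (1 - \<alpha> v)\<close>
    points.\<close>
  have "(\<Sum>y\<in>S. real (card (sep (X i) (X y)))) = (\<Sum>y\<in>S. \<Sum>v<N. of_bool (cut S v (X i) \<noteq> cut S v (X y)))"
  proof (intro sum.cong refl)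
    fix y
    have "sep (X i) (X y) = {v\<in>{..<N}. cut S v (X i) \<noteq> cut S v (X y)}" by (auto simp: sep_def)
    then show "real (card (sep (X i) (X y))) = (\<Sum>v<N. of_bool (cut S v (X i) \<noteq> cut S v (X y)))"
      by (simp add: of_bool_def sum.If_cases Int_def)
  qed
  also have "\<dots> = (\<Sum>v<N. \<Sum>y\<in>S. of_bool (cut S v (X i) \<noteq> cut S v (X y)))" by (rule sum.swap)
  also have "\<dots> = (\<Sum>v<N. s * (1 - \<alpha> v))"
  proof (intro sum.cong refl)
    fix v
    have "(\<Sum>y\<in>S. of_bool (cut S v (X i) \<noteq> cut S v (X y))) = real (card (S - side S v i))"
      by (simp add: of_bool_def sum.If_cases) (rule arg_cong[of _ _ card], auto simp: side_def)
    also have "\<dots> = s - real (card (side S v i))"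
      unfolding s_def by (subst card_Diff_subset) (auto simp: side_def card_mono of_nat_diff)
    also have "\<dots> = s * (1 - \<alpha> v)" using s by (simp add: \<alpha>_def algebra_simps)
    finally show "(\<Sum>y\<in>S. of_bool (cut S v (X i) \<noteq> cut S v (X y))) = s * (1 - \<alpha> v)" .
  qed
  also have "\<dots> = s * (\<Sum>v<N. 1 - \<alpha> v)" by (rule sum_distrib_left[symmetric])
  finally have "Z * (A + G) / 5 - d \<le> (\<Sum>v<N. 1 - \<alpha> v)" using gn s by simp
  then have gn': "\<epsilon> * (Z * (A + G) / 5 - d) \<le> \<epsilon> * (\<Sum>v<N. 1 - \<alpha> v)"
    using eps by (intro mult_left_mono) auto
  have "\<epsilon> * real d \<le> 1 * real d" using eps by (intro mult_right_mono) auto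
  moreover have "\<epsilon> * (Z * (A + G) / 5 - d) = \<epsilon> / 10 * (Z * (A + G)) * 2 - \<epsilon> * real d"
    by (simp add: field_simps)
  ultimately have "real N - 3 * d \<le> real N + \<epsilon> * (\<Sum>v<N. 1 - \<alpha> v) - 2 * real (card (sep (X i) q))"
    using gn' sepq by linarith
  also have "\<dots> = (\<Sum>v<N. 1 + \<epsilon> * (1 - \<alpha> v) - 2 * of_bool (cut S v (X i) \<noteq> cut S v q))"
  proof -
    have "sep (X i) q = {v\<in>{..<N}. cut S v (X i) \<noteq> cut S v q}" by (auto simp: sep_def)
    then have "real (card (sep (X i) q)) = (\<Sum>v<N. of_bool (cut S v (X i) \<noteq> cut S v q))"
      by (simp add: of_bool_def sum.If_cases Int_def)
    then show ?thesis by (simp add: sum_subtractf sum.distrib sum_distrib_left right_diff_distrib)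
  qed
  \<comment> \<open>A separated query contributes 0 on the right. Subtracting 2 makes its term on
    the left nonpositive, as \<open>\<epsilon> * (1 - \<alpha> v) \<le> 1\<close>; this is why the
    loss counts twice.\<close>
  also have "\<dots> \<le> (\<Sum>v<N. if cut S v (X i) = cut S v q then \<alpha> v powr - \<epsilon> else 0)"
  proof (intro sum_mono)
    fix v
    have "0 < card (side S v i)" using side_nonempty[OF i, of v] by (auto simp: card_gt_0_iff side_def)
    then have \<alpha>: "0 < \<alpha> v" using s by (simp add: \<alpha>_def)
    then have "1 + \<epsilon> * (1 - \<alpha> v) \<le> \<alpha> v powr - \<epsilon>" using eps by (intro powr_minus_ge_linear) auto
    moreover have "\<epsilon> * (1 - \<alpha> v) \<le> \<epsilon> * 1" using eps \<alpha> by (intro mult_left_mono) auto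
    then have "\<epsilon> * (1 - \<alpha> v) \<le> 1" using eps by linarith
    ultimately show "1 + \<epsilon> * (1 - \<alpha> v) - 2 * of_bool (cut S v (X i) \<noteq> cut S v q)
        \<le> (if cut S v (X i) = cut S v q then \<alpha> v powr - \<epsilon> else 0)"
      by simp
  qed
  finally have "(real N - 3 * d) * s powr - \<epsilon> \<le>
      (\<Sum>v<N. if cut S v (X i) = cut S v q then \<alpha> v powr - \<epsilon> else 0) * s powr - \<epsilon>"
    by (intro mult_right_mono) auto
  also have "\<dots> = (\<Sum>v<N. if cut S v (X i) = cut S v q then real (card (side S v i)) powr - \<epsilon> else 0)"
    unfolding sum_distrib_right
    using s by (intro sum.cong refl) (auto simp: \<alpha>_def powr_divide)
  finally show ?thesis by (simp add: s_def)
qed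

end


lemma prob_bind_pmf:
  fixes A :: "'b set"
  shows "measure_pmf.prob (bind_pmf p f) A = measure_pmf.expectation p (\<lambda>x. measure_pmf.prob (f x) A)"
proof -
  have *: "measure_pmf.prob q A = pmf (map_pmf (\<lambda>y. y \<in> A) q) True" for q :: "'b pmf"
    by (simp add: pmf_map vimage_def)
  show ?thesis unfolding * map_bind_pmf by (rule pmf_bind)
qed

lemma prob_bind_uniform:
  assumes "0 < N"
  shows "measure_pmf.prob (bind_pmf (pmf_of_set {..<N}) f) A = (\<Sum>v<N. measure_pmf.prob (f v) A) / real N"
proof -
  have "{..<N} \<noteq> {}" using assms by auto
  then show ?thesis by (simp add: prob_bind_pmf integral_pmf_of_set)
qed

section \<open>Random trees\<close>

context lp_instance
begin

definition lft :: "nat set \<Rightarrow> nat \<Rightarrow> nat \<Rightarrow> bool" where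
  "lft S v i \<longleftrightarrow> (if ball S then dst (X (rep S)) (X i) \<le> thr2 else cut S v (X i))"

text \<open>A child is labelled by its largest index, which is what a scan of the points leaves
  behind. Labels of different children differ because each is a member of its child.\<close>

definition pL :: "nat set \<Rightarrow> nat \<Rightarrow> int" where
  "pL S v = last_of int (\<lambda>i. i \<in> S \<and> lft S v i) (- 1) n"
definition pR :: "nat set \<Rightarrow> nat \<Rightarrow> int" where
  "pR S v = last_of int (\<lambda>i. i \<in> S \<and> \<not> lft S v i) (- 1) n"
text \<open>At a ball an unanswered query always continues with the remainder. Entering the
  remainder as both children lets the query follow the stored cut without knowing the kind of the
  node.\<close>

definition chL :: "nat set \<Rightarrow> nat \<Rightarrow> int" where
  "chL S v = (if ball S then pR S v else pL S v)"

text \<open>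
  The nodes of one level are given by a labelling \<open>lam\<close> of the points; the label of a node is one of
  its members, and the label -1 marks a point that has been removed with a ball.
\<close>

definition cls :: "(nat \<Rightarrow> int) \<Rightarrow> int \<Rightarrow> nat set" where
  "cls lam a = {i. i < n \<and> lam i = a}"

definition newlab :: "nat set \<Rightarrow> nat \<Rightarrow> nat \<Rightarrow> int" where
  "newlab S v i = (if lft S v i then (if ball S then - 1 else pL S v) else pR S v)"

definition nx :: "(nat \<Rightarrow> int) \<Rightarrow> nat \<Rightarrow> nat \<Rightarrow> int" where
  "nx lam v i = (if lam i < 0 then - 1 else newlab (cls lam (lam i)) v i)"

text \<open>A state \<open>(a, b)\<close> of a query: the label of the current node, and an answer found so far or -1.\<close>

definition qstep :: "(nat \<Rightarrow> real) \<Rightarrow> nat set \<Rightarrow> nat \<Rightarrow> int \<times> int \<Rightarrow> int \<times> int" where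
  "qstep q S v ab = (if fst ab < 0 then ab
     else if dst q (X (rep S)) \<le> thr4 then (- 1, int (rep S))
     else (if cut S v q then chL S v else pR S v, snd ab))"

primrec walk :: "(nat \<Rightarrow> real) \<Rightarrow> nat list \<Rightarrow> (nat \<Rightarrow> int) \<Rightarrow> int \<times> int \<Rightarrow> int \<times> int" where
  "walk q [] lam ab = ab"
| "walk q (v # vs) lam ab = walk q vs (nx lam v) (qstep q (cls lam (fst ab)) v ab)"

text \<open>Running out of levels counts as failure; with enough levels no node is left by then,
  since the sizes decrease geometrically.\<close>

primrec good :: "(nat \<Rightarrow> real) \<Rightarrow> nat \<Rightarrow> nat list \<Rightarrow> nat set \<Rightarrow> bool" where
  "good q i [] S \<longleftrightarrow> False"
| "good q i (v # vs) S \<longleftrightarrow>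
     (if ball S then dst (X (rep S)) (X i) \<le> thr2 \<or>
        good q i vs {y\<in>S. \<not> dst (X (rep S)) (X y) \<le> thr2}
      else cut S v (X i) = cut S v q \<and> good q i vs (side S v i))"

lemma rep_ball: "ball S \<Longrightarrow> rep S < n \<and> dense S (rep S)"
  using last_of_hit[of n "dense S" id 0] by (auto simp: ball_def rep_def)

lemma rep_less: "rep S < n"
  using rep_ball[of S] n last_of_miss[of n "dense S" id 0]
  by (cases "ball S") (auto simp: ball_def rep_def)

lemma pL_cases: "pL S v = - 1 \<or> (\<exists>j<n. j \<in> S \<and> lft S v j \<and> pL S v = int j)"
  using last_of_hit[of n "\<lambda>i. i \<in> S \<and> lft S v i" int "- 1"]
    last_of_miss[of n "\<lambda>i. i \<in> S \<and> lft S v i" int "- 1"] by (auto simp: pL_def)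

lemma pR_cases: "pR S v = - 1 \<or> (\<exists>j<n. j \<in> S \<and> \<not> lft S v j \<and> pR S v = int j)"
  using last_of_hit[of n "\<lambda>i. i \<in> S \<and> \<not> lft S v i" int "- 1"]
    last_of_miss[of n "\<lambda>i. i \<in> S \<and> \<not> lft S v i" int "- 1"] by (auto simp: pR_def)

lemma pL_nonneg: "i \<in> S \<Longrightarrow> i < n \<Longrightarrow> lft S v i \<Longrightarrow> 0 \<le> pL S v"
  using last_of_hit[of n "\<lambda>i. i \<in> S \<and> lft S v i" int "- 1"] unfolding pL_def by fastforce

lemma pR_nonneg: "i \<in> S \<Longrightarrow> i < n \<Longrightarrow> \<not> lft S v i \<Longrightarrow> 0 \<le> pR S v"
  using last_of_hit[of n "\<lambda>i. i \<in> S \<and> \<not> lft S v i" int "- 1"] unfolding pR_def by fastforce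

lemma nx_range: "nx lam v i = - 1 \<or> (\<exists>j<n. nx lam v i = int j)"
  using pL_cases[of "cls lam (lam i)" v] pR_cases[of "cls lam (lam i)" v]
  by (auto simp: nx_def newlab_def)

lemma nx_nonneg_D:
  assumes "0 \<le> nx lam v y"
  obtains j where "j < n" "nx lam v y = int j" "lam j = lam y" "0 \<le> lam y"
    "lft (cls lam (lam y)) v j = lft (cls lam (lam y)) v y"
proof -
  have "0 \<le> lam y" using assms by (auto simp: nx_def split: if_splits)
  moreover have "\<exists>j<n. j \<in> cls lam (lam y) \<and> nx lam v y = int j \<and>
      lft (cls lam (lam y)) v j = lft (cls lam (lam y)) v y"
    using assms pL_cases[of "cls lam (lam y)" v] pR_cases[of "cls lam (lam y)" v]
    by (auto simp: nx_def newlab_def split: if_splits)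
  ultimately show ?thesis using that by (auto simp: cls_def)
qed

text \<open>A nonnegative new label is a point with the same old label that went to the same side,
  so equal new labels force both to agree. The converse is immediate, as \<open>nx\<close> depends
  only on the old node and the side.\<close>

lemma cls_nx:
  assumes "0 \<le> nx lam v y"
  shows "cls (nx lam v) (nx lam v y) =
    {z \<in> cls lam (lam y). lft (cls lam (lam y)) v z = lft (cls lam (lam y)) v y}"
proof (intro equalityI subsetI)
  fix z assume "z \<in> cls (nx lam v) (nx lam v y)"
  then have z: "z < n" "nx lam v z = nx lam v y" by (auto simp: cls_def)
  obtain j where j: "nx lam v y = int j" "lam j = lam y"
    "lft (cls lam (lam y)) v j = lft (cls lam (lam y)) v y"
    using nx_nonneg_D[OF assms] by metis
  obtain k where k: "nx lam v z = int k" "lam k = lam z"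
    "lft (cls lam (lam z)) v k = lft (cls lam (lam z)) v z"
    using nx_nonneg_D[of lam v z] assms z(2) by metis
  have "k = j" using j k z by simp
  then show "z \<in> {z \<in> cls lam (lam y). lft (cls lam (lam y)) v z = lft (cls lam (lam y)) v y}"
    using j k z by (auto simp: cls_def)
next
  fix z assume "z \<in> {z \<in> cls lam (lam y). lft (cls lam (lam y)) v z = lft (cls lam (lam y)) v y}"
  then show "z \<in> cls (nx lam v) (nx lam v y)" by (auto simp: cls_def nx_def newlab_def)
qed

lemma nx_nonneg:
  assumes "y < n" "0 \<le> lam y" "\<not> (ball (cls lam (lam y)) \<and> lft (cls lam (lam y)) v y)"
  shows "0 \<le> nx lam v y"
  using assms pL_nonneg[of y "cls lam (lam y)" v] pR_nonneg[of y "cls lam (lam y)" v]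
  by (auto simp: nx_def newlab_def cls_def)

lemma snd_qstep_nonneg: "0 \<le> snd ab \<Longrightarrow> 0 \<le> snd (qstep q S v ab)"
  by (simp add: qstep_def)

lemma walk_nonneg: "0 \<le> snd ab \<Longrightarrow> 0 \<le> snd (walk q vs lam ab)"
  by (induction vs arbitrary: lam ab) (simp_all add: snd_qstep_nonneg)

lemma thr4_eq: "thr4 = (2 * (2 * (\<theta> * r))) powr p"
  by (simp add: thr4_def \<theta>_def mult.assoc)

text \<open>While nothing has been found, the query carries the label of its near neighbor. If a
  ball contains that neighbor, the distances \<open>r \<le> 2R\<close> and \<open>2R\<close> put the
  representative within \<open>4R\<close> of the query, which stops there.\<close>

lemma walk_good:
  assumes "i < n" "dst (X i) q \<le> r powr p" "0 \<le> lam i" "good q i vs (cls lam (lam i))"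
  shows "0 \<le> snd (walk q vs lam (lam i, b))"
  using assms(3,4)
proof (induction vs arbitrary: lam)
  case (Cons v vs)
  define S where "S = cls lam (lam i)"
  have step: "walk q (v # vs) lam (lam i, b) = walk q vs (nx lam v) (qstep q S v (lam i, b))"
    by (simp add: S_def)
  show ?case
  proof (cases "dst q (X (rep S)) \<le> thr4")
    case True
    then show ?thesis unfolding step using Cons.prems(1)
      by (intro walk_nonneg) (simp add: qstep_def)
  next
    case False
    have M: "0 \<le> 2 * (\<theta> * r)" "r \<le> 2 * (\<theta> * r)"
      using theta p r mult_right_mono[of 1 \<theta> r] by auto
    have "r powr p \<le> (2 * (\<theta> * r)) powr p" using M r p by (intro powr_mono2) auto
    then have "dst q (X i) \<le> (2 * (\<theta> * r)) powr p" using assms(2) dst_commute[of q "X i"] by simp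
    then have far: "\<not> dst (X (rep S)) (X i) \<le> thr2"
      using False dst_triangle[of q "X i" "2 * (\<theta> * r)" "X (rep S)"] M
        dst_commute[of "X i" "X (rep S)"] unfolding thr2_eq thr4_eq by auto
    have same: "cut S v q = cut S v (X i)" if "\<not> ball S"
      using Cons.prems(2) that by (simp add: S_def)
    have nn: "0 \<le> nx lam v i"
      using far Cons.prems(1) assms(1) by (intro nx_nonneg) (auto simp: S_def lft_def)
    have next_: "qstep q S v (lam i, b) = (nx lam v i, b)"
      using False Cons.prems(1) far same
      by (auto simp: qstep_def nx_def newlab_def chL_def lft_def S_def[symmetric])
    have "good q i vs (cls (nx lam v) (nx lam v i))"
    proof (cases "ball S")
      case True
      then have "cls (nx lam v) (nx lam v i) = {y\<in>S. \<not> dst (X (rep S)) (X y) \<le> thr2}"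
        unfolding cls_nx[OF nn] S_def[symmetric] using far by (auto simp: lft_def)
      then show ?thesis using Cons.prems(2) True far by (simp add: S_def[symmetric])
    next
      case F: False
      then have "cls (nx lam v) (nx lam v i) = side S v i"
        unfolding cls_nx[OF nn] S_def[symmetric] by (auto simp: lft_def side_def)
      then show ?thesis using Cons.prems(2) F by (simp add: S_def[symmetric])
    qed
    then show ?thesis unfolding step next_ using nn by (intro Cons.IH)
  qed
qed simp

abbreviation tape :: "nat \<Rightarrow> nat list pmf" where
  "tape k \<equiv> replicate_pmf k (pmf_of_set {..<N})"

lemma tape_Suc: "tape (Suc k) = bind_pmf (pmf_of_set {..<N}) (\<lambda>v. map_pmf ((#) v) (tape k))"
  by (simp add: map_pmf_def)

text \<open>The error is linear in the node size on purpose: a cut costs at most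
  \<open>3 * d / N\<close>, and the side that is kept has at least one point less, which releases
  that amount for the induction. The last hypothesis passes to the child with its size, for a ball
  because the remainder is at most half, and excludes running out of levels.\<close>

lemma good_prob:
  assumes "S \<subseteq> {..<n}" "i \<in> S" "dst (X i) q \<le> r powr p"
    "real (card S) * (1 - 1 / (8 * real d)) ^ L < 1"
  shows "real (card S) powr - \<epsilon> - real (card S) * (3 * real d / real N) \<le>
    measure_pmf.prob (tape L) {vs. good q i vs S}"
  using assms(1,2,4)
proof (induction L arbitrary: S)
  case 0
  then have "card S = 0" by simp
  then show ?case using 0 finite_subset[of S "{..<n}"] by (auto simp: card_eq_0_iff)
next
  case (Suc L)
  define s where "s = real (card S)"
  define \<eta> where "\<eta> = 3 * real d / real N"
  have fin: "finite S" using Suc.prems finite_subset by blast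
  have s1: "1 \<le> s" using Suc.prems fin by (auto simp: s_def Suc_le_eq card_gt_0_iff)
  have \<eta>: "0 \<le> \<eta>" by (simp add: \<eta>_def)
  have dd: "8 \<le> 8 * real d" using d by simp
  have base: "0 \<le> 1 - 1 / (8 * real d)" "1/2 \<le> 1 - 1 / (8 * real d)" using dd by (auto simp: field_simps)
  have shrink: "real (card S') * (1 - 1 / (8 * real d)) ^ L < 1"
    if "real (card S') \<le> s * (1 - 1 / (8 * real d))" for S' :: "nat set"
  proof -
    have "real (card S') * (1 - 1 / (8 * real d)) ^ L \<le> s * (1 - 1 / (8 * real d)) * (1 - 1 / (8 * real d)) ^ L"
      using that base by (intro mult_right_mono) auto
    also have "\<dots> = s * (1 - 1 / (8 * real d)) ^ Suc L" by simp
    finally show ?thesis using Suc.prems(3) by (simp add: s_def)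
  qed
  have prob: "measure_pmf.prob (tape (Suc L)) {vs. good q i vs S} =
      (\<Sum>v<N. measure_pmf.prob (tape L) {vs. good q i (v # vs) S}) / real N"
    unfolding tape_Suc by (subst prob_bind_uniform[OF N_pos]) (simp add: vimage_def)
  show ?case
  proof (cases "ball S")
    case True
    define S' where "S' = {y\<in>S. \<not> dst (X (rep S)) (X y) \<le> thr2}"
    have "card S = card (S' \<union> {y\<in>S. dst (X (rep S)) (X y) \<le> thr2})"
      by (rule arg_cong[of _ _ card]) (auto simp: S'_def)
    also have "\<dots> = card S' + card {y\<in>S. dst (X (rep S)) (X y) \<le> thr2}"
      using fin by (intro card_Un_disjoint) (auto simp: S'_def)
    finally have "2 * card S' \<le> card S" using rep_ball[OF True] by (auto simp: dense_def)
    then have half: "2 * real (card S') \<le> s" unfolding s_def by linarith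
    have "s powr - \<epsilon> - s * \<eta> \<le> measure_pmf.prob (tape L) {vs. good q i (v # vs) S}" for v
    proof (cases "i \<in> S'")
      case False
      then have "{vs. good q i (v # vs) S} = UNIV" using True Suc.prems by (auto simp: S'_def)
      moreover have "s powr - \<epsilon> \<le> 1" using s1 eps powr_mono[of "-\<epsilon>" 0 s] by simp
      moreover have "0 \<le> s * \<eta>" using s1 \<eta> by simp
      ultimately show ?thesis by simp
    next
      case i': True
      then have pos: "0 < real (card S')" using fin by (auto simp: card_gt_0_iff S'_def)
      have "s * (1/2) \<le> s * (1 - 1 / (8 * real d))" using s1 base by (intro mult_left_mono) auto
      then have "real (card S') powr - \<epsilon> - real (card S') * \<eta> \<le> measure_pmf.prob (tape L) {vs. good q i vs S'}"
        unfolding \<eta>_def using half Suc.prems i' by (intro Suc.IH shrink) (auto simp: S'_def)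
      moreover have "{vs. good q i (v # vs) S} = {vs. good q i vs S'}"
        using True i' by (auto simp: S'_def)
      moreover have "s powr - \<epsilon> \<le> real (card S') powr - \<epsilon>"
        using half pos s1 eps by (intro powr_mono2') auto
      moreover have "real (card S') * \<eta> \<le> s * \<eta>" using half s1 \<eta> by (intro mult_right_mono) auto
      ultimately show ?thesis by simp
    qed
    then have "(\<Sum>v<N. s powr - \<epsilon> - s * \<eta>) \<le> (\<Sum>v<N. measure_pmf.prob (tape L) {vs. good q i (v # vs) S})"
      by (intro sum_mono)
    then show ?thesis unfolding prob s_def[symmetric] \<eta>_def[symmetric]
      using N_pos by (simp add: field_simps)
  next
    case False
    then interpret cut_node n d X p \<epsilon> r S using Suc.prems by unfold_locales auto
    let ?c = "\<lambda>v. cut S v (X i) = cut S v q"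
    have v_bound: "(if ?c v then real (card (side S v i)) powr - \<epsilon> else 0) - (s - 1) * \<eta>
        \<le> measure_pmf.prob (tape L) {vs. good q i (v # vs) S}" if v: "v < N" for v
    proof (cases "?c v")
      case True
      have "card (side S v i) + kap S \<le> card S" using side_shrink[OF v] .
      then have sh: "real (card (side S v i)) + real (kap S) \<le> s" unfolding s_def by linarith
      have "s \<le> real (8 * d * kap S)" unfolding s_def using kap_bounds(4)[OF cardS] by (rule of_nat_mono)
      then have "s / (8 * real d) \<le> real (kap S)" using dd by (simp add: field_simps)
      then have "real (card (side S v i)) \<le> s * (1 - 1 / (8 * real d))"
        using sh by (simp add: algebra_simps)
      then have "real (card (side S v i)) powr - \<epsilon> - real (card (side S v i)) * \<eta> \<le>
          measure_pmf.prob (tape L) {vs. good q i vs (side S v i)}"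
        unfolding \<eta>_def using Suc.prems side_nonempty by (intro Suc.IH shrink) (auto simp: side_def)
      moreover have "1 \<le> kap S" using kap_bounds(1)[OF cardS] .
      then have "real (card (side S v i)) * \<eta> \<le> (s - 1) * \<eta>" using sh \<eta> by (intro mult_right_mono) auto
      ultimately show ?thesis using True False by simp
    next
      case F: False
      have "0 \<le> (s - 1) * \<eta>" using s1 \<eta> by simp
      then show ?thesis using F False measure_nonneg[of "tape L"] by simp
    qed
    have "(real N - 3 * d) * s powr - \<epsilon> - real N * ((s - 1) * \<eta>) \<le>
        (\<Sum>v<N. (if ?c v then real (card (side S v i)) powr - \<epsilon> else 0) - (s - 1) * \<eta>)"
      using cut_step[OF Suc.prems(2) assms(3)] by (simp add: sum_subtractf s_def)
    also have "\<dots> \<le> (\<Sum>v<N. measure_pmf.prob (tape L) {vs. good q i (v # vs) S})"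
      using v_bound by (intro sum_mono) auto
    finally have "((real N - 3 * d) * s powr - \<epsilon> - real N * ((s - 1) * \<eta>)) / real N \<le>
        measure_pmf.prob (tape (Suc L)) {vs. good q i vs S}"
      unfolding prob by (intro divide_right_mono) auto
    moreover have "((real N - 3 * d) * s powr - \<epsilon> - real N * ((s - 1) * \<eta>)) / real N =
        s powr - \<epsilon> - \<eta> * s powr - \<epsilon> - (s - 1) * \<eta>"
      using N_pos by (simp add: \<eta>_def field_simps)
    moreover have "\<eta> * s powr - \<epsilon> \<le> \<eta> * 1"
      using s1 eps powr_mono[of "-\<epsilon>" 0 s] \<eta> by (intro mult_left_mono) auto
    ultimately show ?thesis unfolding s_def[symmetric] \<eta>_def[symmetric] by (simp add: algebra_simps)
  qed
qed

text \<open>Levels \<open>\<tau> L, \<dots>, (\<tau> + 1) L - 1\<close> belong to tree \<open>\<tau>\<close>.\<close>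

context
  fixes L :: nat and vs :: "nat list"
begin

primrec ulam :: "nat \<Rightarrow> nat \<Rightarrow> int" where
  "ulam 0 = (\<lambda>_. 0)"
| "ulam (Suc g) = nx (if g mod L = 0 then (\<lambda>_. 0) else ulam g) (vs ! g)"

text \<open>The labels with which level \<open>g\<close> starts: \<open>ulam\<close> describes the
  end of the level before, and the first level of a tree puts all points back into node 0.\<close>

definition glam :: "nat \<Rightarrow> nat \<Rightarrow> int" where
  "glam g = (if g mod L = 0 then (\<lambda>_. 0) else ulam g)"

text \<open>A new tree resets the node but keeps the answer, so one successful tree is
  enough.\<close>

primrec uq :: "(nat \<Rightarrow> real) \<Rightarrow> nat \<Rightarrow> int \<times> int" where
  "uq q 0 = (- 1, - 1)"
| "uq q (Suc g) = (let ab = (if g mod L = 0 then (0, snd (uq q g)) else uq q g) in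
     qstep q (cls (glam g) (fst ab)) (vs ! g) ab)"

end

section \<open>From one tree to independent trees\<close>

lemma walk_snoc:
  "walk q (vs @ [v]) lam ab =
     qstep q (cls (foldl nx lam vs) (fst (walk q vs lam ab))) v (walk q vs lam ab)"
  by (induction vs arbitrary: lam ab) simp_all

text \<open>Stated from the end of the first level on, because the restart happens while that level
  is processed. The later level numbers of the tree are not divisible by \<open>L\<close>.\<close>

lemma tree_block:
  assumes "Suc k \<le> L" "\<tau> * L + Suc k \<le> length vs"
  shows "ulam L vs (\<tau> * L + Suc k) = foldl nx (\<lambda>_. 0) (take (Suc k) (drop (\<tau> * L) vs)) \<and>
    uq L vs q (\<tau> * L + Suc k) =
      walk q (take (Suc k) (drop (\<tau> * L) vs)) (\<lambda>_. 0) (0, snd (uq L vs q (\<tau> * L)))"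
  using assms
proof (induction k)
  case 0
  then have "take (Suc 0) (drop (\<tau> * L) vs) = [vs ! (\<tau> * L)]"
    by (simp add: take_Suc_conv_app_nth)
  then show ?case by (simp add: glam_def Let_def)
next
  case (Suc k)
  have "take (Suc (Suc k)) (drop (\<tau> * L) vs) =
      take (Suc k) (drop (\<tau> * L) vs) @ [vs ! (\<tau> * L + Suc k)]"
    using Suc.prems by (simp add: take_Suc_conv_app_nth[of "Suc k"])
  moreover have "(\<tau> * L + Suc k) mod L \<noteq> 0" using Suc.prems by simp
  ultimately show ?case using Suc
    by (simp only: add_Suc_right ulam.simps uq.simps) (simp add: glam_def Let_def walk_snoc)
qed

lemma uq_nonneg_mono:
  assumes "0 \<le> snd (uq L vs q g)" "g \<le> g'"
  shows "0 \<le> snd (uq L vs q g')"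
  using assms(2,1) by (induction rule: dec_induct) (auto simp: Let_def intro!: snd_qstep_nonneg)

text \<open>Finding an answer is random but its quality is not: an answer is stored only after its
  own distance test.\<close>

lemma uq_found:
  assumes "0 \<le> snd (uq L vs q g)"
  shows "nat (snd (uq L vs q g)) < n \<and> dst q (X (nat (snd (uq L vs q g)))) \<le> thr4"
  using assms by (induction g) (auto simp: Let_def qstep_def rep_less split: if_splits)

definition hit :: "(nat \<Rightarrow> real) \<Rightarrow> nat \<Rightarrow> nat list \<Rightarrow> bool" where
  "hit q i b \<longleftrightarrow> good q i b {..<n}"

lemma uq_hit:
  assumes "i < n" "dst (X i) q \<le> r powr p" "1 \<le> L" "\<tau> < NT" "length vs = NT * L"
    "hit q i (take L (drop (\<tau> * L) vs))"
  shows "0 \<le> snd (uq L vs q (NT * L))"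
proof -
  obtain k where k: "L = Suc k" using assms(3) by (cases L) auto
  have le: "\<tau> * L + L \<le> NT * L" using assms(4) by (metis Suc_le_eq add.commute mult_Suc mult_le_mono1)
  have "cls (\<lambda>_. 0) 0 = {..<n}" by (auto simp: cls_def)
  then have "0 \<le> snd (walk q (take L (drop (\<tau> * L) vs)) (\<lambda>_. 0) (0, snd (uq L vs q (\<tau> * L))))"
    using walk_good[of i q "\<lambda>_. 0"] assms by (simp add: hit_def)
  then have "0 \<le> snd (uq L vs q (\<tau> * L + L))"
    using tree_block[of k L \<tau> vs q] le assms(5) k by simp
  then show ?thesis using le by (rule uq_nonneg_mono)
qed

text \<open>Distinct blocks of \<open>L\<close> entries of the tape are independent: splitting off
  the first block makes the probability factorize.\<close>

lemma no_hit_prob: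
  assumes "measure_pmf.prob (tape L) {b. \<not> hit q i b} \<le> f"
  shows "measure_pmf.prob (tape (m * L)) {vs. \<forall>\<tau><m. \<not> hit q i (take L (drop (\<tau> * L) vs))} \<le> f ^ m"
proof (induction m)
  case (Suc m)
  let ?B = "{b. \<not> hit q i b}"
  let ?A = "\<lambda>m. {vs. \<forall>\<tau><m. \<not> hit q i (take L (drop (\<tau> * L) vs))}"
  have split: "tape (Suc m * L) = bind_pmf (tape L) (\<lambda>b. map_pmf ((@) b) (tape (m * L)))"
    by (simp add: replicate_pmf_distrib map_pmf_def)
  have iff: "b @ ys \<in> ?A (Suc m) \<longleftrightarrow> b \<in> ?B \<and> ys \<in> ?A m" if "length b = L" for b ys
    using that by (auto simp: All_less_Suc2)
  have "measure_pmf.prob (tape (Suc m * L)) (?A (Suc m)) =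
      measure_pmf.expectation (tape L) (\<lambda>b. indicator ?B b * measure_pmf.prob (tape (m * L)) (?A m))"
    unfolding split prob_bind_pmf
  proof (intro integral_cong_AE)
    show "AE b in tape L. measure_pmf.prob (map_pmf ((@) b) (tape (m * L))) (?A (Suc m)) =
        indicator ?B b * measure_pmf.prob (tape (m * L)) (?A m)"
    proof (rule AE_pmfI)
      fix b assume "b \<in> set_pmf (tape L)"
      then have "length b = L" by (simp add: set_replicate_pmf)
      then have "(@) b -` ?A (Suc m) = (if b \<in> ?B then ?A m else {})"
        using iff by (auto simp: vimage_def)
      then show "measure_pmf.prob (map_pmf ((@) b) (tape (m * L))) (?A (Suc m)) =
        indicator ?B b * measure_pmf.prob (tape (m * L)) (?A m)"
        by (simp only: measure_map_pmf) auto
    qed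
  qed simp_all
  also have "\<dots> = measure_pmf.prob (tape L) ?B * measure_pmf.prob (tape (m * L)) (?A m)"
    by simp
  also have "\<dots> \<le> f * f ^ m"
    using assms Suc order_trans[OF measure_nonneg assms] by (intro mult_mono) auto
  finally show ?case by simp
qed simp

text \<open>With \<open>f\<close> half of \<open>n powr - \<epsilon>\<close>, a tree succeeds with
  probability at least \<open>f\<close>, so all trees fail with probability at most
  \<open>exp (- NT * f) \<le> exp (- 3 / 2) \<le> 1 / 3\<close>. This is the origin of the 3 in the
  number of trees.\<close>

lemma found_prob:
  assumes i: "i < n" "dst (X i) q \<le> r powr p"
    and L: "1 \<le> L" "real n * (1 - 1 / (8 * real d)) ^ L < 1"
    and NT: "3 * real n powr \<epsilon> \<le> real NT"
  shows "2 / 3 \<le> measure_pmf.prob (tape (NT * L)) {vs. 0 \<le> snd (uq L vs q (NT * L))}"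
proof -
  define f where "f = real n powr - \<epsilon> / 2"
  have n1: "1 \<le> real n" using n by simp
  have ne: "1 / real n \<le> real n powr - \<epsilon>"
    using powr_mono[of "-1" "-\<epsilon>" "real n"] n1 eps by (simp add: powr_minus_divide)
  have "real n * (3 * real d / real N) = 1 / (2 * real n)"
    using n d by (simp add: N_def)
  also have "\<dots> \<le> f" using ne n1 by (simp add: f_def field_simps)
  finally have "f \<le> real n powr - \<epsilon> - real n * (3 * real d / real N)" by (simp add: f_def)
  also have "\<dots> \<le> measure_pmf.prob (tape L) {b. hit q i b}"
    using good_prob[of "{..<n}" i q L] i L by (simp add: hit_def)
  finally have "f \<le> measure_pmf.prob (tape L) {b. hit q i b}" .
  moreover have "{b. \<not> hit q i b} = space (measure_pmf (tape L)) - {b. hit q i b}" by auto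
  then have "measure_pmf.prob (tape L) {b. \<not> hit q i b} = 1 - measure_pmf.prob (tape L) {b. hit q i b}"
    by (simp only:) (intro measure_pmf.prob_compl, simp)
  ultimately have "measure_pmf.prob (tape L) {b. \<not> hit q i b} \<le> 1 - f" by simp
  then have "measure_pmf.prob (tape (NT * L)) {vs. \<forall>\<tau><NT. \<not> hit q i (take L (drop (\<tau> * L) vs))} \<le> (1 - f) ^ NT"
    by (rule no_hit_prob)
  also have "\<dots> \<le> exp (- f) ^ NT"
  proof (rule power_mono)
    show "1 - f \<le> exp (- f)" using exp_ge_add_one_self[of "- f"] by simp
    have "real n powr - \<epsilon> \<le> 1" using powr_mono[of "-\<epsilon>" 0 "real n"] n1 eps by simp
    then show "0 \<le> 1 - f" by (simp add: f_def)
  qed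
  also have "\<dots> = exp (- (real NT * f))" by (simp add: exp_of_nat_mult[symmetric])
  also have "\<dots> \<le> exp (- (3 / 2))"
  proof -
    have "3 * real n powr \<epsilon> * f \<le> real NT * f" using NT by (intro mult_right_mono) (auto simp: f_def)
    moreover have "3 * real n powr \<epsilon> * f = 3 / 2" using n1 by (simp add: f_def powr_minus)
    ultimately show ?thesis by simp
  qed
  also have "\<dots> \<le> 1 / 3"
  proof -
    have "1 + 3 / 2 + (3 / 2)\<^sup>2 / 2 \<le> exp (3 / 2 :: real)" by (intro exp_lower_Taylor_quadratic) simp
    then have "3 \<le> exp (3 / 2 :: real)" by (simp add: power2_eq_square)
    then show ?thesis by (simp add: exp_minus field_simps)
  qed
  finally have le: "measure_pmf.prob (tape (NT * L)) {vs. \<forall>\<tau><NT. \<not> hit q i (take L (drop (\<tau> * L) vs))} \<le> 1 / 3" .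
  let ?F = "{vs. 0 \<le> snd (uq L vs q (NT * L))}"
  have "measure_pmf.prob (tape (NT * L)) (UNIV - ?F) \<le>
      measure_pmf.prob (tape (NT * L)) {vs. \<forall>\<tau><NT. \<not> hit q i (take L (drop (\<tau> * L) vs))}"
  proof (rule measure_pmf.finite_measure_mono_AE)
    show "AE vs in tape (NT * L). vs \<in> UNIV - ?F \<longrightarrow> vs \<in> {vs. \<forall>\<tau><NT. \<not> hit q i (take L (drop (\<tau> * L) vs))}"
      using uq_hit[OF i L(1), of _ NT] by (intro AE_pmfI) (auto simp: set_replicate_pmf)
  qed simp
  moreover have "measure_pmf.prob (tape (NT * L)) (UNIV - ?F) = 1 - measure_pmf.prob (tape (NT * L)) ?F"
    using measure_pmf.prob_compl[of ?F "tape (NT * L)"] by simp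
  ultimately show ?thesis using le by simp
qed

end


lemma agr_ireg: "agr K s t \<Longrightarrow> k < K \<Longrightarrow> ireg t k = ireg s k"
  and agr_rreg: "agr K s t \<Longrightarrow> k < K \<Longrightarrow> rreg t k = rreg s k"
  and agr_inp: "agr K s t \<Longrightarrow> inp t = inp s"
  by (simp_all add: agr_def)

text \<open>The case of loops that compute in registers only: memory and outputs are framed, and the
  invariant is blind to the counter.\<close>

lemma ok_pure_loop:
  assumes b: "b < c" "2 < c" "ireg s 2 = 1" "ireg s b = int B" "int B \<le> W"
    and ind: "\<And>i t x. I i (t\<lparr>ireg := (ireg t)(c := x)\<rparr>) = I i t"
    and start: "I 0 s"
    and body: "\<And>i t. i < B \<Longrightarrow> agr c s t \<Longrightarrow> same_mem s t \<Longrightarrow> ireg t c = int i \<Longrightarrow> I i t \<Longrightarrow>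
      ok W body T t (\<lambda>u. agr (Suc c) t u \<and> same_mem t u \<and> I (Suc i) u)"
    and Q: "\<And>u. agr c s u \<Longrightarrow> same_mem s u \<Longrightarrow> I B u \<Longrightarrow> Q u"
  shows "ok W (upto_loop c b body) (B * (T + 4) + 3) s Q"
proof (rule ok_for[where I = "\<lambda>i t. same_mem s t \<and> I i t", OF b])
  show "same_mem s (s\<lparr>ireg := (ireg s)(c := 0)\<rparr>) \<and> I 0 (s\<lparr>ireg := (ireg s)(c := 0)\<rparr>)"
    using start by (simp add: ind same_mem_def)
  fix i t assume *: "i < B" "agr c s t" "ireg t c = int i" "same_mem s t \<and> I i t"
  show "ok W body T t (\<lambda>u. agr (Suc c) t u \<and>
      same_mem s (u\<lparr>ireg := (ireg u)(c := int (Suc i))\<rparr>) \<and> I (Suc i) (u\<lparr>ireg := (ireg u)(c := int (Suc i))\<rparr>))"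
    by (rule ok_conseq[OF body[of i t]]) (use * in \<open>auto simp: ind same_mem_def\<close>)
qed (use Q in auto)

section \<open>The programs\<close>

text \<open>
  Global integer registers: 0 and 1 hold \<open>n\<close> and \<open>d\<close>, 2 the constant 1, 3 the number \<open>L\<close> of levels of a
  tree, 4 the number \<open>NT\<close> of trees, 5 their product, 6 the range \<open>N\<close> of the random numbers, 7 and 8 the
  numbers \<open>n d\<close> and \<open>8 d\<close>. Global real registers: 2 holds \<open>p\<close>, 3 and 4 the \<open>p\<close>-th powers \<open>thr2\<close>
  and \<open>thr4\<close> of the two radii, 5 the exponent \<open>1 / p\<close>, 6 the constant 0.

  While a node is being processed, integer register 16 holds its number, 13 the number of the first
  node of the next level, 11 the random number of the level, 19 the number of its points, 22 and 23 a
  dense point and whether there is one, 24 to 26 the ranks of the order statistics, 30 the coordinate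
  of the cut, 37 and 38 the children; the threshold of the cut is in real register 31.

  During pre-processing the integer memory holds the random numbers (one per level) in cells
  \<open>0, \<dots>, NT L - 1\<close>, followed by one label per point. Node \<open>a\<close> of level \<open>g\<close> has the number \<open>g n + a\<close>; its record
  is four integers (representative, coordinate, left child, right child) and one real threshold.
  A child is given by its number, or -1 if it is empty. A point removed with a ball keeps the number
  of the last node that contained it, which is never looked at again.
\<close>

definition input_instrs :: "reg \<Rightarrow> reg \<Rightarrow> reg \<Rightarrow> instr list" where
  "input_instrs c i j = [IOp ITimes c i 1, IOp IPlus c c j, RInput c c]"

definition dist_body :: "reg \<Rightarrow> reg \<Rightarrow> reg \<Rightarrow> com" where
  "dist_body c i j = blk (input_instrs (c + 2) i c @ input_instrs (c + 3) j c @
     [ROp RMinus (c + 2) (c + 2) (c + 3), ROp RPowr (c + 2) (c + 2) 2, ROp RPlus (c + 1) (c + 1) (c + 2)])"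

text \<open>No instruction loads a real constant or copies a register: 0 is the difference of
  register 6 with itself, a real move adds register 6, and an integer move multiplies by register
  2.\<close>

definition dist_prog :: "reg \<Rightarrow> reg \<Rightarrow> reg \<Rightarrow> com" where
  "dist_prog c i j = Seq (Do (ROp RMinus (c + 1) 6 6)) (upto_loop c 1 (dist_body c i j))"

text \<open>Tests are strict comparisons, so equality of a label with the node number in register 16
  takes two of them.\<close>

definition class_loop :: "reg \<Rightarrow> com \<Rightarrow> com" where
  "class_loop c body = upto_loop c 0 (Seq (blk [IOp IPlus (c + 1) 5 c, ILoad (c + 1) (c + 1)])
     (Cond (ILess (c + 1) 16) SKIP (Cond (ILess 16 (c + 1)) SKIP body)))"

definition rank_prog :: "reg \<Rightarrow> reg \<Rightarrow> reg \<Rightarrow> com" where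
  "rank_prog c j b = Seq (blk [IConst (c + 2) 0, IConst (c + 3) 0]) (class_loop c
     (Seq (blk (input_instrs (c + 4) c j)) (Cond (RLess (c + 4) b)
        (blk [IOp IPlus (c + 2) (c + 2) 2, IOp IPlus (c + 3) (c + 3) 2])
        (Cond (RLess b (c + 4)) SKIP (blk [IOp IPlus (c + 3) (c + 3) 2])))))"

definition qt_body :: "reg \<Rightarrow> reg \<Rightarrow> reg \<Rightarrow> com" where
  "qt_body c j k = Seq (blk (input_instrs (c + 3) c j)) (Seq (rank_prog (c + 4) j (c + 3))
     (Cond (ILess (c + 6) k) (Cond (ILess (c + 7) k) SKIP (blk [ROp RPlus (c + 2) (c + 3) 6])) SKIP))"

definition qt_prog :: "reg \<Rightarrow> reg \<Rightarrow> reg \<Rightarrow> com" where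
  "qt_prog c j k = Seq (Do (ROp RMinus (c + 2) 6 6)) (class_loop c (qt_body c j k))"

definition spow_prog :: "reg \<Rightarrow> reg \<Rightarrow> reg \<Rightarrow> com" where
  "spow_prog c a e = Cond (RLess a 6) (blk [ROp RPowr c a e, ROp RMinus c 6 c]) (blk [ROp RPowr c a e])"

definition bounds_prog :: "reg \<Rightarrow> reg \<Rightarrow> com" where
  "bounds_prog c j = Seq (qt_prog c j 25) (Seq (qt_prog (c + 3) j 24) (Seq (qt_prog (c + 6) j 26)
     (Seq (blk [ROp RMinus (c + 9) (c + 5) (c + 2), ROp RMinus (c + 11) (c + 8) (c + 2)])
       (Seq (spow_prog (c + 10) (c + 9) 2) (spow_prog (c + 12) (c + 11) 2)))))"

definition count_prog :: com where
  "count_prog = Seq (Do (IConst 19 0)) (class_loop 17 (Do (IOp IPlus 19 19 2)))"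

definition near_prog :: com where
  "near_prog = Seq (Do (IConst 26 0)) (class_loop 24
     (Seq (dist_prog 27 20 24) (Cond (RLess 3 28) SKIP (Do (IOp IPlus 26 26 2)))))"

definition rep_prog :: com where
  "rep_prog = Seq (blk [IConst 22 0, IConst 23 0]) (class_loop 20 (Seq near_prog
     (Seq (Do (IOp IPlus 27 26 26)) (Cond (ILess 27 19) SKIP (blk [IOp ITimes 22 20 2, IConst 23 1])))))"

definition ranks_prog :: com where
  "ranks_prog = blk [IOp IPlus 24 19 8, IOp IMinus 24 24 2, IOp IDiv 24 24 8, IOp IPlus 25 19 2,
     IOp IPlus 26 2 2, IOp IDiv 25 25 26, IOp IPlus 26 19 2, IOp IMinus 26 26 24]"

definition total_prog :: com where
  "total_prog = Seq (Do (ROp RMinus 28 6 6)) (Seq (upto_loop 27 1 (Seq (bounds_prog 29 27)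
      (blk [ROp RMinus 42 41 39, ROp RPlus 28 28 42])))
    (blk [ROfInt 29 11, ROp RTimes 28 28 29, ROfInt 29 6, ROp RDivide 28 28 29]))"

definition pick_body :: com where
  "pick_body = Seq (bounds_prog 32 29) (Seq (blk [ROp RMinus 45 44 42, ROp RPlus 46 30 45])
    (Seq (Cond (RLess 28 30) SKIP (Cond (RLess 28 46)
        (Seq (blk [IOp ITimes 30 29 2, ROp RMinus 47 28 30, ROp RPlus 47 42 47])
          (Seq (spow_prog 48 47 5) (Do (ROp RPlus 31 34 48)))) SKIP))
      (Do (ROp RPlus 30 46 6))))"

definition pick_prog :: com where
  "pick_prog = Seq (blk [IConst 30 0, ROp RMinus 30 6 6, ROp RMinus 31 6 6]) (upto_loop 29 1 pick_body)"

definition side_prog :: "reg \<Rightarrow> reg \<Rightarrow> com" where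
  "side_prog c i = Cond (ILess 23 2)
     (Seq (blk (input_instrs c i 30)) (Cond (RLess 31 c) (Do (IConst c 0)) (Do (IConst c 1))))
     (Seq (dist_prog (c + 1) 22 i) (Cond (RLess 3 (c + 2)) (Do (IConst c 0)) (Do (IConst c 1))))"

definition scan_prog :: com where
  "scan_prog = Seq (blk [IConst 34 (- 1), IConst 35 (- 1)]) (class_loop 32 (Seq (side_prog 36 32)
     (Cond (ILess 36 2) (Do (IOp ITimes 35 32 2)) (Do (IOp ITimes 34 32 2)))))"

definition emit_prog :: com where
  "emit_prog = Seq (Do (IConst 36 0)) (Seq (Cond (ILess 34 36) (Do (IConst 37 (- 1))) (Do (IOp IPlus 37 34 13)))
    (Seq (Cond (ILess 35 36) (Do (IConst 38 (- 1))) (Do (IOp IPlus 38 35 13)))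
    (Seq (Cond (ILess 23 2) SKIP (Do (IOp ITimes 37 38 2)))
      (blk [IEmit 22, IEmit 30, IEmit 37, IEmit 38, REmit 31]))))"

text \<open>Relabelling overwrites the membership information on which the other loops rely, so it
  comes last; the side of each point is computed once more.\<close>

definition relabel_prog :: com where
  "relabel_prog = upto_loop 39 0 (Seq (blk [IOp IPlus 40 5 39, ILoad 41 40])
     (Cond (ILess 41 16) SKIP (Cond (ILess 16 41) SKIP (Seq (side_prog 42 39)
       (Cond (ILess 42 2) (Do (IStore 40 38)) (Cond (ILess 23 2) (Do (IStore 40 37)) SKIP))))))"

definition class_prog :: com where
  "class_prog = Seq count_prog (Seq rep_prog (Seq ranks_prog (Seq total_prog (Seq pick_prog
     (Seq scan_prog (Seq emit_prog relabel_prog))))))"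

definition reset_prog :: com where
  "reset_prog = upto_loop 15 0 (blk [IOp IPlus 16 5 15, IStore 16 12])"

definition level_prog :: com where
  "level_prog = Seq (blk [ILoad 11 10, IOp ITimes 12 10 0, IOp IPlus 13 12 0, IOp IMod 14 10 3])
     (Seq (Cond (ILess 14 2) reset_prog SKIP) (upto_loop 15 0 (Seq (Do (IOp IPlus 16 12 15)) class_prog)))"

definition levels_prog :: com where "levels_prog = upto_loop 10 5 level_prog"

definition tape_body :: com where
  "tape_body = Seq (Do (IRand 11 6)) (Seq (Do (IStore 10 11)) (Do (IOp IPlus 10 10 2)))"

definition tape_prog :: com where
  "tape_prog = Seq (Do (IConst 10 0)) (Loop (ILess 10 5) tape_body)"

definition points_prog :: com where
  "points_prog = upto_loop 10 7 (blk [RInput 11 10, REmit 11])"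

definition build_prog :: com where
  "build_prog = Seq tape_prog (Seq points_prog levels_prog)"

definition qdist_body :: com where
  "qdist_body = blk [RInput 20 19, IOp ITimes 21 18 1, IOp IPlus 21 21 19, RLoad 21 21, ROp RMinus 20 20 21,
     ROp RPowr 20 20 2, ROp RPlus 22 22 20]"

definition visit_prog :: com where
  "visit_prog = Seq (blk [IOp IPlus 17 13 13, IOp IPlus 17 17 17, ILoad 18 17, ROp RMinus 22 6 6])
     (Seq (upto_loop 19 1 qdist_body)
       (Cond (RLess 4 22)
         (Seq (blk [IOp IPlus 17 17 2, ILoad 23 17, RInput 23 23, IOp IPlus 24 7 13, RLoad 24 24, IOp IPlus 17 17 2])
           (Cond (RLess 24 23) (blk [IOp IPlus 17 17 2, ILoad 13 17]) (Do (ILoad 13 17))))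
         (blk [IOp ITimes 10 18 2, IConst 13 (- 1)])))"

definition query_body :: com where
  "query_body = Seq (blk [IOp IMod 17 9 3, IConst 15 0])
     (Seq (Cond (ILess 17 2) (Do (IOp ITimes 13 9 0)) SKIP) (Cond (ILess 13 15) SKIP visit_prog))"

definition answer_prog :: com where
  "answer_prog = Seq (Do (IConst 15 0)) (Cond (ILess 10 15) SKIP
     (Seq (Do (IOp ITimes 11 10 1)) (upto_loop 12 1 (blk [IOp IPlus 13 11 12, RLoad 13 13, REmit 13]))))"

definition search_prog :: com where
  "search_prog = Seq (blk [IConst 10 (- 1), IConst 13 (- 1)]) (Seq (upto_loop 9 5 query_body) answer_prog)"

text \<open>The machine has neither a logarithm nor a conversion from reals to integers, so both
  counts come from loops: a power of 2 is doubled until it exceeds \<open>n\<close>, and the number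
  of trees is raised until it reaches \<open>3 * n powr \<epsilon>\<close>. The 240 gives the radius
  \<open>2R\<close>.\<close>

definition params_prog :: com where
  "params_prog =
     Seq (blk [IConst 2 1, IConst 9 240, ROfInt 7 9, ROp RTimes 7 7 2, ROp RDivide 7 7 0, ROp RTimes 7 7 1,
       ROp RPowr 3 7 2, ROp RPlus 8 7 7, ROp RPowr 4 8 2, ROfInt 7 2, ROp RDivide 5 7 2, ROp RMinus 6 7 7,
       IConst 3 0, IConst 9 1, IOp IPlus 10 0 2])
    (Seq (Loop (ILess 9 10) (blk [IOp IPlus 9 9 9, IOp IPlus 3 3 2]))
    (Seq (blk [IConst 8 8, IOp ITimes 8 8 1, IOp ITimes 3 8 3,
       ROfInt 7 0, ROp RPowr 7 7 0, IConst 9 3, ROfInt 8 9, ROp RTimes 7 8 7, IConst 4 0, ROfInt 8 4, ROfInt 9 2])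
    (Seq (Loop (RLess 8 7) (blk [IOp IPlus 4 4 2, ROp RPlus 8 8 9]))
      (blk [IOp ITimes 5 4 3, IOp ITimes 7 0 1, IConst 9 6, IOp ITimes 6 9 0, IOp ITimes 6 6 0, IOp ITimes 6 6 1]))))"

definition pre_prog :: com where "pre_prog = Seq params_prog build_prog"

definition qry_prog :: com where "qry_prog = Seq params_prog search_prog"

section \<open>Distances and cuts\<close>

text \<open>The bound on \<open>W\<close> covers every integer that occurs: addresses of the
  four-word records and of the reals, labels, grid numbers, ranks and program constants.\<close>

locale nns_program = lp_instance +
  fixes xs :: "real list" and W :: int and L NT :: nat
  assumes xs: "length xs = n * d" "X = (\<lambda>i j. xs ! (i * d + j))"
    and W: "int (4 * (NT * L * n) + 4 * n + 6 * n * n * d + 20 * (n * d) + 500) \<le> W"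
    and LN: "1 \<le> L" "1 \<le> NT"
begin

definition glob :: "ram \<Rightarrow> bool" where
  "glob s \<longleftrightarrow> ireg s 0 = int n \<and> ireg s 1 = int d \<and> ireg s 2 = 1 \<and> ireg s 3 = int L \<and>
     ireg s 4 = int NT \<and> ireg s 5 = int (NT * L) \<and> ireg s 6 = int N \<and> ireg s 7 = int (n * d) \<and>
     ireg s 8 = int (8 * d) \<and>
     rreg s 2 = p \<and> rreg s 3 = thr2 \<and> rreg s 4 = thr4 \<and> rreg s 5 = 1 / p \<and> rreg s 6 = 0"

lemma glob_agr: "agr K s t \<Longrightarrow> 9 \<le> K \<Longrightarrow> glob s \<Longrightarrow> glob t"
  by (simp add: glob_def agr_def)

lemma glob_upd [simp]:
  "9 \<le> k \<Longrightarrow> glob (s\<lparr>ireg := (ireg s)(k := x)\<rparr>) = glob s"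
  "9 \<le> k \<Longrightarrow> glob (s\<lparr>rreg := (rreg s)(k := y)\<rparr>) = glob s"
  by (simp_all add: glob_def)

lemma globD:
  assumes "glob s"
  shows "ireg s 0 = int n" "ireg s (Suc 0) = int d" "ireg s 2 = 1" "ireg s 3 = int L"
    "ireg s 4 = int NT" "ireg s 5 = int (NT * L)" "ireg s 6 = int N" "ireg s 7 = int (n * d)"
    "ireg s 8 = int (8 * d)" "rreg s 2 = p" "rreg s 3 = thr2" "rreg s 4 = thr4" "rreg s 5 = 1 / p"
    "rreg s 6 = 0"
  using assms by (simp_all add: glob_def)

lemma idx: "i < n \<Longrightarrow> j < d \<Longrightarrow> i * d + j < n * d"
  by (metis Suc_leI add.commute add_less_cancel_left less_le_trans mult_Suc mult_le_mono1)

lemma W_bounds: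
  "500 \<le> W" "4 * int (NT * L * n) \<le> W" "4 * int n \<le> W" "int (6 * n * n * d) \<le> W" "20 * int (n * d) \<le> W"
  "int (NT * L * n) + int n \<le> W" "int (NT * L) + int n \<le> W" "20 * int d \<le> W" "int n + 8 * int d + 1 \<le> W"
  "4 * int (NT * L * n) + 4 \<le> W"
proof -
  have a: "NT * L \<le> NT * L * n" "d \<le> n * d" using n by simp_all
  note W' = W[unfolded of_nat_add]
  show "500 \<le> W" "4 * int (NT * L * n) \<le> W" "4 * int n \<le> W" "int (6 * n * n * d) \<le> W"
    "20 * int (n * d) \<le> W" "int (NT * L * n) + int n \<le> W" "int (NT * L) + int n \<le> W" "20 * int d \<le> W"
    "int n + 8 * int d + 1 \<le> W" "4 * int (NT * L * n) + 4 \<le> W"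
    using W' a by linarith+
qed

lemma idx_W: "i < n \<Longrightarrow> j < d \<Longrightarrow> int i * int d + int j \<le> W" "i < n \<Longrightarrow> int i * int d \<le> W"
proof -
  show *: "int i * int d + int j \<le> W" if "i < n" "j < d" for i j
  proof -
    have "int (i * d + j) \<le> int (n * d)" using idx[OF that] by linarith
    moreover have "0 \<le> int (n * d)" by simp
    ultimately have "int (i * d + j) \<le> W" using W_bounds(5) by linarith
    then show ?thesis by simp
  qed
  show "int i * int d \<le> W" if "i < n" using *[OF that, of 0] d by simp
qed

lemma nat_idx: "nat (int i * int d + int j) = i * d + j"
  by (metis nat_int of_nat_add of_nat_mult)

lemma xs_nth: "xs ! (i * d + j) = X i j"
  by (simp add: xs)

lemmas input_simps = input_instrs_def nat_idx xs_nth idx_W idx xs(1)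

lemma num_W: "i < n \<Longrightarrow> int (num P i) + 1 \<le> W"
  using num_le[of P i] W_bounds(3) by linarith

lemma ok_dist_prog:
  assumes s: "glob s" "inp s = xs" "8 < c" "a < c" "b < c" "ireg s a = int i" "ireg s b = int j" "i < n" "j < n"
    and Q: "\<And>u. agr c s u \<Longrightarrow> same_mem s u \<Longrightarrow> rreg u (c + 1) = dst (X i) (X j) \<Longrightarrow> Q u"
  shows "ok W (dist_prog c a b) (d * 30 + 10) s Q"
  unfolding dist_prog_def
proof (rule ok_Seq[OF ok_wp[OF _ order_refl]])
  let ?s = "s\<lparr>rreg := (rreg s)(c + 1 := 0)\<rparr>"
  note g = globD[OF s(1)]
  have "ok W (upto_loop c 1 (dist_body c a b)) (d * (18 + 4) + 3) ?s Q"
  proof (rule ok_pure_loop[where I = "\<lambda>k t. rreg t (c + 1) = (\<Sum>l<k. (X i l - X j l) powr p)"])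
    fix k t
    assume t: "k < d" "agr c ?s t" "same_mem ?s t" "ireg t c = int k"
      "rreg t (c + 1) = (\<Sum>l<k. (X i l - X j l) powr p)"
    note r = agr_ireg[OF t(2)] agr_rreg[OF t(2)] agr_inp[OF t(2)]
    show "ok W (dist_body c a b) 18 t
       (\<lambda>u. agr (Suc c) t u \<and> same_mem t u \<and> rreg u (c + 1) = (\<Sum>l<Suc k. (X i l - X j l) powr p))"
      by (rule ok_wp) (use s t in \<open>simp_all add: r g input_simps dist_body_def\<close>,
        simp_all add: agr_def same_mem_def)
  next
    fix u assume u: "agr c ?s u" "same_mem ?s u" "rreg u (c + 1) = (\<Sum>l<d. (X i l - X j l) powr p)"
    show "Q u" using u by (intro Q) (auto simp: agr_def same_mem_def dst_def)
  qed (use s g W_bounds in auto)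
  then show "wp W (Do (ROp RMinus (c + 1) 6 6)) (\<lambda>t. ok W (upto_loop c 1 (dist_body c a b)) (d * (18 + 4) + 3) t Q) s"
    by simp
qed simp

text \<open>A node is not stored as a list; it is read off the labels. Bounding all labels ensures
  that loading one is not a fault.\<close>

definition node :: "nat set \<Rightarrow> ram \<Rightarrow> bool" where
  "node S s \<longleftrightarrow> glob s \<and> inp s = xs \<and> S = {i. i < n \<and> imem s (NT * L + i) = ireg s 16} \<and>
     (\<forall>i<n. \<bar>imem s (NT * L + i)\<bar> \<le> W)"

lemma node_agr: "node S s \<Longrightarrow> agr K s t \<Longrightarrow> same_mem s t \<Longrightarrow> 17 \<le> K \<Longrightarrow> node S t"
  using glob_agr[of K s t] by (simp add: node_def agr_def same_mem_def)

lemma nodeD: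
  assumes "node S s"
  shows "glob s" "inp s = xs" "S \<subseteq> {..<n}"
    "\<And>i. i < n \<Longrightarrow> i \<in> S \<longleftrightarrow> imem s (NT * L + i) = ireg s 16"
  using assms by (auto simp: node_def)

lemma card_num: "S \<subseteq> {..<n} \<Longrightarrow> num (\<lambda>y. y \<in> S \<and> P y) n = card {y\<in>S. P y}"
  unfolding num_def by (rule arg_cong[of _ _ card]) auto

text \<open>Members run the body and other points only advance the index, so the invariant has to
  survive both. By \<open>ind\<close> it does not see the counter and the register into which the
  label is loaded.\<close>

lemma ok_class_loop:
  assumes s: "node S s" "16 < c"
    and ind: "\<And>i t x y. I i (t\<lparr>ireg := (ireg t)(c := x, Suc c := y)\<rparr>) = I i t"
    and start: "I 0 s"
    and body: "\<And>i t. i \<in> S \<Longrightarrow> i < n \<Longrightarrow> agr c s t \<Longrightarrow> same_mem s t \<Longrightarrow> node S t \<Longrightarrow> ireg t c = int i \<Longrightarrow> I i t \<Longrightarrow>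
      ok W body T t (\<lambda>u. agr (c + 2) t u \<and> same_mem t u \<and> I (Suc i) u)"
    and skip: "\<And>i t. i \<notin> S \<Longrightarrow> I i t \<Longrightarrow> I (Suc i) t"
    and Q: "\<And>u. agr c s u \<Longrightarrow> same_mem s u \<Longrightarrow> node S u \<Longrightarrow> I n u \<Longrightarrow> Q u"
  shows "ok W (class_loop c body) (n * (T + 12) + 3) s Q"
proof -
  note g = globD[OF nodeD(1)[OF s(1)]]
  have ind1: "I i (t\<lparr>ireg := (ireg t)(c := x)\<rparr>) = I i t" for i t x
    using ind[of i t x "ireg t (Suc c)"] by (simp add: fun_upd_idem)
  have ind2: "I i (t\<lparr>ireg := (ireg t)(Suc c := x)\<rparr>) = I i t" for i t x
    using ind[of i t "ireg t c" x] by (simp add: fun_upd_idem)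
  have "ok W (class_loop c body) (n * ((T + 8) + 4) + 3) s Q"
    unfolding class_loop_def
  proof (rule ok_pure_loop[where I = I])
    fix i t assume t: "i < n" "agr c s t" "same_mem s t" "ireg t c = int i" "I i t"
    let ?t = "t\<lparr>ireg := (ireg t)(Suc c := imem s (NT * L + i))\<rparr>"
    note r = agr_ireg[OF t(2)]
    have i: "nat (int NT * int L + int i) = NT * L + i" by (metis nat_int of_nat_add of_nat_mult)
    have b: "int NT * int L + int i \<le> W" using W_bounds(7) t(1) by simp
    have lW: "\<bar>imem s (NT * L + i)\<bar> \<le> W" using s(1) t(1) by (simp add: node_def)
    have C: "ok W (Cond (ILess (c + 1) 16) SKIP (Cond (ILess 16 (c + 1)) SKIP body)) (T + 2) ?t
        (\<lambda>u. agr (Suc c) t u \<and> same_mem t u \<and> I (Suc i) u)"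
    proof (cases "i \<in> S")
      case True
      have a: "agr c s ?t" "same_mem s ?t" using t s(2) by (simp_all add: agr_def same_mem_def)
      have "ok W body T ?t (\<lambda>u. agr (c + 2) ?t u \<and> same_mem ?t u \<and> I (Suc i) u)"
        using True t a s(2) node_agr[OF s(1) a] by (intro body) (simp_all add: ind2)
      then have "ok W body T ?t (\<lambda>u. agr (Suc c) t u \<and> same_mem t u \<and> I (Suc i) u)"
        by (rule ok_conseq) (auto simp: agr_def same_mem_def)
      then show ?thesis
        using True nodeD(4)[OF s(1) t(1)] s(2) r[of 16]
        by (intro ok_Cond[where T = "T + 1"] ok_Cond[where T = T]) simp_all
    next
      case False
      have "agr (Suc c) t ?t \<and> same_mem t ?t \<and> I (Suc i) ?t"
        using skip[OF False t(5)] by (simp add: agr_def same_mem_def ind2)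
      then show ?thesis
        using False nodeD(4)[OF s(1) t(1)] s(2) r[of 16]
        by (intro ok_Cond[where T = "T + 1"] ok_Cond[where T = T] ok_SKIP) simp_all
    qed
    show "ok W (Seq (blk [IOp IPlus (c + 1) 5 c, ILoad (c + 1) (c + 1)])
        (Cond (ILess (c + 1) 16) SKIP (Cond (ILess 16 (c + 1)) SKIP body))) (T + 8) t
        (\<lambda>u. agr (Suc c) t u \<and> same_mem t u \<and> I (Suc i) u)"
      by (rule ok_Seq[OF ok_wp[OF _ order_refl]])
        (use C s t(1,3,4) r[of 5] i b lW in \<open>simp add: g same_mem_def\<close>, simp)
  next
    show "I 0 s" by (rule start)
    show "Q u" if "agr c s u" "same_mem s u" "I n u" for u
      using that s node_agr[OF s(1), of c u] by (intro Q) auto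
  qed (use s g W_bounds in \<open>auto simp: ind1\<close>)
  then show ?thesis by (simp add: add.assoc)
qed

lemma ok_rank_prog:
  assumes s: "node S s" "17 < c" "a < c" "b < c" "ireg s a = int j" "j < d" "rreg s b = x"
    and Q: "\<And>u. agr c s u \<Longrightarrow> same_mem s u \<Longrightarrow> node S u \<Longrightarrow> ireg u (c + 2) = int (card {y\<in>S. X y j < x}) \<Longrightarrow>
      ireg u (c + 3) = int (card {y\<in>S. X y j \<le> x}) \<Longrightarrow> Q u"
  shows "ok W (rank_prog c a b) (n * 30 + 10) s Q"
  unfolding rank_prog_def
proof (rule ok_Seq[OF ok_wp[OF _ order_refl]])
  note g = globD[OF nodeD(1)[OF s(1)]] nodeD(2)[OF s(1)]
  let ?b = "Seq (blk (input_instrs (c + 4) c a)) (Cond (RLess (c + 4) b)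
        (blk [IOp IPlus (c + 2) (c + 2) 2, IOp IPlus (c + 3) (c + 3) 2])
        (Cond (RLess b (c + 4)) SKIP (blk [IOp IPlus (c + 3) (c + 3) 2])))"
  let ?s = "s\<lparr>ireg := (ireg s)(c + 2 := 0, c + 3 := 0)\<rparr>"
  let ?I = "\<lambda>i t. ireg t (c + 2) = int (num (\<lambda>y. y \<in> S \<and> X y j < x) i) \<and>
    ireg t (c + 3) = int (num (\<lambda>y. y \<in> S \<and> X y j \<le> x) i)"
  have s': "agr c s ?s" "same_mem s ?s" by (simp_all add: agr_def same_mem_def)
  have n': "node S ?s" using node_agr[OF s(1) s'] s(2) by simp
  have "ok W (class_loop c ?b) (n * (13 + 12) + 3) ?s Q"
  proof (rule ok_class_loop[where I = ?I])
    fix i t assume t: "i \<in> S" "i < n" "agr c ?s t" "same_mem ?s t" "ireg t c = int i" "?I i t"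
    note r = agr_ireg[OF t(3)] agr_rreg[OF t(3)] agr_inp[OF t(3)]
    show "ok W ?b 13 t (\<lambda>u. agr (c + 2) t u \<and> same_mem t u \<and> ?I (Suc i) u)"
      by (rule ok_wp) (use s(2-) t num_W in \<open>simp_all add: r g input_simps\<close>,
        simp_all add: agr_def same_mem_def)
  next
    fix u assume u: "agr c ?s u" "same_mem ?s u" "node S u" "?I n u"
    show "Q u" using u by (intro Q) (auto simp: agr_def same_mem_def card_num nodeD(3)[OF s(1)])
  qed (use n' s in auto)
  then show "wp W (blk [IConst (c + 2) 0, IConst (c + 3) 0]) (\<lambda>t. ok W (class_loop c ?b) (n * (13 + 12) + 3) t Q) s"
    using W_bounds by simp
qed simp


lemma ok_qt_prog:
  assumes s: "node S s" "16 < c" "a < c" "b < c" "ireg s a = int j" "j < d" "ireg s b = int k"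
    and Q: "\<And>u. agr c s u \<Longrightarrow> same_mem s u \<Longrightarrow> node S u \<Longrightarrow> rreg u (c + 2) = qt S j k \<Longrightarrow> Q u"
  shows "ok W (qt_prog c a b) (n * (n * 30 + 40) + 10) s Q"
  unfolding qt_prog_def
proof (rule ok_Seq[OF ok_wp[OF _ order_refl]])
  note g = globD[OF nodeD(1)[OF s(1)]] nodeD(2)[OF s(1)]
  let ?s = "s\<lparr>rreg := (rreg s)(c + 2 := 0)\<rparr>"
  let ?I = "\<lambda>i t. rreg t (c + 2) = last_of (\<lambda>i. X i j) (kth S j k) 0 i"
  have s': "agr c s ?s" "same_mem s ?s" by (simp_all add: agr_def same_mem_def)
  have n': "node S ?s" using node_agr[OF s(1) s'] s(2) by simp
  have "ok W (class_loop c (qt_body c a b)) (n * ((n * 30 + 22) + 12) + 3) ?s Q"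
  proof (rule ok_class_loop[where I = ?I])
    fix i t assume t: "i \<in> S" "i < n" "agr c ?s t" "same_mem ?s t" "node S t" "ireg t c = int i" "?I i t"
    note r = agr_ireg[OF t(3)] agr_rreg[OF t(3)] agr_inp[OF t(3)]
    let ?P = "\<lambda>u. agr (c + 2) t u \<and> same_mem t u \<and> ?I (Suc i) u"
    let ?t = "t\<lparr>ireg := (ireg t)(c + 3 := int i * int d + int j), rreg := (rreg t)(c + 3 := X i j)\<rparr>"
    have t': "agr (c + 3) t ?t" "same_mem t ?t" by (simp_all add: agr_def same_mem_def)
    have nt: "node S ?t" using node_agr[OF t(5) t'] s(2) by simp
    have "ok W (rank_prog (c + 4) a (c + 3)) (n * 30 + 10) ?t (\<lambda>u. ok W (Cond (ILess (c + 6) b)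
        (Cond (ILess (c + 7) b) SKIP (blk [ROp RPlus (c + 2) (c + 3) 6])) SKIP) 4 u ?P)"
    proof (rule ok_rank_prog[OF nt])
      fix u assume u: "agr (c + 4) ?t u" "same_mem ?t u" "node S u"
        "ireg u (c + 4 + 2) = int (card {y \<in> S. X y j < X i j})"
        "ireg u (c + 4 + 3) = int (card {y \<in> S. X y j \<le> X i j})"
      note ru = agr_ireg[OF u(1)] agr_rreg[OF u(1)] agr_inp[OF u(1)]
      have u': "ireg u (c + 6) = int (card {y \<in> S. X y j < X i j})"
        "ireg u (c + 7) = int (card {y \<in> S. X y j \<le> X i j})" using u(4,5) by (simp_all add: add.commute)
      have k: "kth S j k i \<longleftrightarrow> card {y \<in> S. X y j < X i j} < k \<and> k \<le> card {y \<in> S. X y j \<le> X i j}"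
        using t(1) by (simp add: kth_def)
      show "ok W (Cond (ILess (c + 6) b) (Cond (ILess (c + 7) b) SKIP (blk [ROp RPlus (c + 2) (c + 3) 6])) SKIP) 4 u ?P"
        by (rule ok_wp) (use s(2-) t u u' in \<open>simp_all add: ru r g k\<close>,
          simp_all add: agr_def same_mem_def)
    qed (use s(2-) r t in auto)
    from ok_Seq[OF this order_refl]
    have R: "ok W (Seq (rank_prog (c + 4) a (c + 3)) (Cond (ILess (c + 6) b)
        (Cond (ILess (c + 7) b) SKIP (blk [ROp RPlus (c + 2) (c + 3) 6])) SKIP)) (n * 30 + 15) ?t ?P"
      by (rule ok_conseq) simp_all
    define P where "P = ?P"
    show "ok W (qt_body c a b) (n * 30 + 22) t ?P" unfolding qt_body_def P_def[symmetric]
      by (rule ok_Seq[OF ok_wp[OF _ order_refl]])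
        (use s(2-) t R[folded P_def] in \<open>simp add: r g input_simps\<close>, simp add: input_instrs_def)
  next
    fix u assume u: "agr c ?s u" "same_mem ?s u" "node S u" "?I n u"
    show "Q u" using u by (intro Q) (auto simp: agr_def same_mem_def qt_def)
  qed (use n' s in \<open>auto simp: kth_def\<close>)
  then show "wp W (Do (ROp RMinus (c + 2) 6 6)) (\<lambda>t. ok W (class_loop c (qt_body c a b)) (n * ((n * 30 + 22) + 12) + 3) t Q) s"
    by simp
qed (simp add: algebra_simps)

lemma ok_bounds_prog:
  assumes s: "node S s" "26 < c" "a < c" "ireg s a = int j" "j < d" "ireg s 24 = int (kap S)"
      "ireg s 25 = int ((card S + 1) div 2)" "ireg s 26 = int (card S + 1 - kap S)"
    and Q: "\<And>u. agr c s u \<Longrightarrow> same_mem s u \<Longrightarrow> node S u \<Longrightarrow> rreg u (c + 2) = med S j \<Longrightarrow>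
      rreg u (c + 10) = cA S j \<Longrightarrow> rreg u (c + 12) = cB S j \<Longrightarrow> Q u"
  shows "ok W (bounds_prog c a) (3 * (n * (n * 30 + 40) + 10) + 30) s Q"
  unfolding bounds_prog_def
proof (rule ok_Seq[OF ok_qt_prog[OF s(1) _ s(3) _ s(4) s(5) s(7)]])
  let ?c = "Seq (blk [ROp RMinus (c + 9) (c + 5) (c + 2), ROp RMinus (c + 11) (c + 8) (c + 2)])
       (Seq (spow_prog (c + 10) (c + 9) 2) (spow_prog (c + 12) (c + 11) 2))"
  let ?T = "n * (n * 30 + 40) + 10"
  fix u assume u: "agr c s u" "same_mem s u" "node S u" "rreg u (c + 2) = qt S j ((card S + 1) div 2)"
  show "ok W (Seq (qt_prog (c + 3) a 24) (Seq (qt_prog (c + 6) a 26) ?c)) (?T + (?T + 20) + 2) u Q"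
  proof (rule ok_Seq[OF ok_qt_prog[where a = a and b = 24 and j = j and k = "kap S", OF u(3)]])
    fix v assume v: "agr (c + 3) u v" "same_mem u v" "node S v" "rreg v (c + 3 + 2) = qt S j (kap S)"
    show "ok W (Seq (qt_prog (c + 6) a 26) ?c) (?T + 20 + 1) v Q"
    proof (rule ok_Seq[OF ok_qt_prog[where a = a and b = 26 and j = j and k = "card S + 1 - kap S", OF v(3)]])
      fix w assume w: "agr (c + 6) v w" "same_mem v w" "node S w" "rreg w (c + 6 + 2) = qt S j (card S + 1 - kap S)"
      have v5: "rreg v (c + 5) = qt S j (kap S)" and w8: "rreg w (c + 8) = qt S j (card S + 1 - kap S)"
        using v(4) w(4) by (simp_all add: add.commute)
      have vals: "rreg w (c + 2) = med S j" "rreg w (c + 5) = lo S j" "rreg w (c + 8) = hi S j"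
        using u v w v5 w8 by (simp_all add: agr_def med_def lo_def hi_def)
      have a: "agr c s w" "same_mem s w"
        using u v w by (simp_all add: agr_def same_mem_def)
      show "ok W ?c 20 w Q"
        by (rule ok_wp) (use s vals in \<open>simp_all add: globD[OF nodeD(1)[OF w(3)]] spow_prog_def\<close>,
          auto intro!: Q simp: a[unfolded agr_def] a[unfolded same_mem_def] agr_def same_mem_def
            globD[OF nodeD(1)[OF w(3)]] cA_def cB_def spow_def node_agr[OF w(3), of 17])
    qed (use s u v in \<open>auto simp: agr_def\<close>)
  qed (use s u in \<open>auto simp: agr_def\<close>)
qed (use s in auto)

end


section \<open>Processing one node\<close>

context nns_program
begin

lemma ok_count_prog:
  assumes s: "node S s"
    and Q: "\<And>u. agr 17 s u \<Longrightarrow> same_mem s u \<Longrightarrow> node S u \<Longrightarrow> ireg u 19 = int (card S) \<Longrightarrow> Q u"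
  shows "ok W count_prog (n * 20 + 10) s Q"
  unfolding count_prog_def
proof (rule ok_Seq[OF ok_wp[OF _ order_refl]])
  note g = globD[OF nodeD(1)[OF s]]
  let ?s = "s\<lparr>ireg := (ireg s)(19 := 0)\<rparr>"
  let ?I = "\<lambda>i t. ireg t 19 = int (num (\<lambda>y. y \<in> S) i)"
  have s': "agr 17 s ?s" "same_mem s ?s" by (simp_all add: agr_def same_mem_def)
  have n': "node S ?s" using node_agr[OF s s'] by simp
  have "ok W (class_loop 17 (Do (IOp IPlus 19 19 2))) (n * (1 + 12) + 3) ?s Q"
  proof (rule ok_class_loop[where I = ?I])
    fix i t assume t: "i \<in> S" "i < n" "agr 17 ?s t" "same_mem ?s t" "?I i t"
    note r = agr_ireg[OF t(3)]
    show "ok W (Do (IOp IPlus 19 19 2)) 1 t (\<lambda>u. agr (17 + 2) t u \<and> same_mem t u \<and> ?I (Suc i) u)"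
      by (rule ok_wp) (use t num_W in \<open>simp_all add: r g\<close>, simp_all add: agr_def same_mem_def)
  next
    fix u assume u: "agr 17 ?s u" "same_mem ?s u" "node S u" "?I n u"
    show "Q u" using u card_num[OF nodeD(3)[OF s], of "\<lambda>_. True"]
      by (intro Q) (auto simp: agr_def same_mem_def)
  qed (use n' in auto)
  then show "wp W (Do (IConst 19 0)) (\<lambda>t. ok W (class_loop 17 (Do (IOp IPlus 19 19 2))) (n * (1 + 12) + 3) t Q) s"
    using W_bounds by simp
qed (simp add: algebra_simps)

lemma ok_near_prog:
  assumes s: "node S s" "ireg s 20 = int i" "i < n"
    and Q: "\<And>u. agr 24 s u \<Longrightarrow> same_mem s u \<Longrightarrow> node S u \<Longrightarrow>
      ireg u 26 = int (card {y\<in>S. dst (X i) (X y) \<le> thr2}) \<Longrightarrow> Q u"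
  shows "ok W near_prog (n * (d * 30 + 30) + 10) s Q"
  unfolding near_prog_def
proof (rule ok_Seq[OF ok_wp[OF _ order_refl]])
  note g = globD[OF nodeD(1)[OF s(1)]]
  let ?b = "Seq (dist_prog 27 20 24) (Cond (RLess 3 28) SKIP (Do (IOp IPlus 26 26 2)))"
  let ?s = "s\<lparr>ireg := (ireg s)(26 := 0)\<rparr>"
  let ?I = "\<lambda>k t. ireg t 26 = int (num (\<lambda>y. y \<in> S \<and> dst (X i) (X y) \<le> thr2) k)"
  have s': "agr 24 s ?s" "same_mem s ?s" by (simp_all add: agr_def same_mem_def)
  have n': "node S ?s" using node_agr[OF s(1) s'] by simp
  have "ok W (class_loop 24 ?b) (n * ((d * 30 + 10 + 2 + 1) + 12) + 3) ?s Q"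
  proof (rule ok_class_loop[where I = ?I])
    fix k t assume t: "k \<in> S" "k < n" "agr 24 ?s t" "same_mem ?s t" "node S t" "ireg t 24 = int k" "?I k t"
    show "ok W ?b (d * 30 + 10 + 2 + 1) t (\<lambda>u. agr (24 + 2) t u \<and> same_mem t u \<and> ?I (Suc k) u)"
    proof (rule ok_Seq[OF ok_dist_prog])
      fix u assume u: "agr 27 t u" "same_mem t u" "rreg u (27 + 1) = dst (X i) (X k)"
      note r = agr_ireg[OF u(1)] agr_rreg[OF u(1)] agr_ireg[OF t(3)] agr_rreg[OF t(3)]
      show "ok W (Cond (RLess 3 28) SKIP (Do (IOp IPlus 26 26 2))) 2 u
          (\<lambda>u. agr (24 + 2) t u \<and> same_mem t u \<and> ?I (Suc k) u)"
        by (rule ok_wp) (use s t u num_W in \<open>simp_all add: r g\<close>, simp_all add: agr_def same_mem_def)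
    qed (use s t nodeD[OF t(5)] in \<open>auto simp: agr_def\<close>)
  next
    fix u assume u: "agr 24 ?s u" "same_mem ?s u" "node S u" "?I n u"
    show "Q u" using u by (intro Q) (auto simp: agr_def same_mem_def card_num nodeD(3)[OF s(1)])
  qed (use n' in auto)
  then show "wp W (Do (IConst 26 0)) (\<lambda>t. ok W (class_loop 24 ?b) (n * ((d * 30 + 10 + 2 + 1) + 12) + 3) t Q) s"
    using W_bounds by simp
qed (simp add: algebra_simps)

lemma ok_rep_prog:
  assumes s: "node S s" "ireg s 19 = int (card S)"
    and Q: "\<And>u. agr 20 s u \<Longrightarrow> same_mem s u \<Longrightarrow> node S u \<Longrightarrow> ireg u 22 = int (rep S) \<Longrightarrow>
      ireg u 23 = (if ball S then 1 else 0) \<Longrightarrow> Q u"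
  shows "ok W rep_prog (n * (n * (d * 30 + 30) + 40) + 10) s Q"
  unfolding rep_prog_def
proof (rule ok_Seq[OF ok_wp[OF _ order_refl]])
  note g = globD[OF nodeD(1)[OF s(1)]]
  let ?e = "Seq (Do (IOp IPlus 27 26 26)) (Cond (ILess 27 19) SKIP (blk [IOp ITimes 22 20 2, IConst 23 1]))"
  let ?T = "n * (d * 30 + 30) + 10 + 8"
  let ?s = "s\<lparr>ireg := (ireg s)(22 := 0, 23 := 0)\<rparr>"
  let ?I = "\<lambda>k t. ireg t 22 = int (last_of id (dense S) 0 k) \<and> ireg t 23 = (if \<exists>y<k. dense S y then 1 else 0)"
  have s': "agr 20 s ?s" "same_mem s ?s" by (simp_all add: agr_def same_mem_def)
  have n': "node S ?s" using node_agr[OF s(1) s'] by simp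
  have "ok W (class_loop 20 (Seq near_prog ?e)) (n * (?T + 12) + 3) ?s Q"
  proof (rule ok_class_loop[where I = ?I])
    fix k t assume t: "k \<in> S" "k < n" "agr 20 ?s t" "same_mem ?s t" "node S t" "ireg t 20 = int k" "?I k t"
    show "ok W (Seq near_prog ?e) ?T t (\<lambda>u. agr (20 + 2) t u \<and> same_mem t u \<and> ?I (Suc k) u)"
    proof (rule ok_Seq[OF ok_near_prog[OF t(5,6,2)]])
      fix u assume u: "agr 24 t u" "same_mem t u" "node S u" "ireg u 26 = int (card {y\<in>S. dst (X k) (X y) \<le> thr2})"
      note r = agr_ireg[OF u(1)] agr_rreg[OF u(1)] agr_ireg[OF t(3)] agr_rreg[OF t(3)]
      have c: "card {y\<in>S. dst (X k) (X y) \<le> thr2} \<le> n"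
        unfolding card_num[OF nodeD(3)[OF s(1)], symmetric] by (rule num_le)
      have D: "dense S k \<longleftrightarrow> \<not> 2 * int (card {y\<in>S. dst (X k) (X y) \<le> thr2}) < int (card S)"
        using t(1) by (auto simp: dense_def)
      have E: "(\<exists>y<Suc k. dense S y) \<longleftrightarrow> dense S k \<or> (\<exists>y<k. dense S y)"
        by (auto simp: less_Suc_eq)
      have b: "2 * int (card {y\<in>S. dst (X k) (X y) \<le> thr2}) \<le> W" "int k \<le> W"
        using c t(2) W_bounds(3) by linarith+
      show "ok W ?e 7 u (\<lambda>u. agr (20 + 2) t u \<and> same_mem t u \<and> ?I (Suc k) u)"
        by (rule ok_wp) (use s(2) t u b W_bounds(1) in \<open>simp_all add: r g D E del: One_nat_def\<close>,
          simp_all add: agr_def same_mem_def)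
    qed simp
  next
    fix u assume u: "agr 20 ?s u" "same_mem ?s u" "node S u" "?I n u"
    show "Q u" using u by (intro Q) (auto simp: agr_def same_mem_def rep_def ball_def)
  next
    fix i t assume "i \<notin> S" "?I i t"
    then show "?I (Suc i) t" by (auto simp: dense_def less_Suc_eq)
  qed (use n' in auto)
  then show "wp W (blk [IConst 22 0, IConst 23 0]) (\<lambda>t. ok W (class_loop 20 (Seq near_prog ?e)) (n * (?T + 12) + 3) t Q) s"
    using W_bounds by simp
qed (simp add: algebra_simps)

lemma card_le_n: "S \<subseteq> {..<n} \<Longrightarrow> card S \<le> n"
  using card_mono[of "{..<n}" S] by simp

lemma ok_ranks_prog:
  assumes s: "node S s" "ireg s 19 = int (card S)"
    and Q: "\<And>u. agr 24 s u \<Longrightarrow> same_mem s u \<Longrightarrow> node S u \<Longrightarrow> ireg u 24 = int (kap S) \<Longrightarrow>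
      ireg u 25 = int ((card S + 1) div 2) \<Longrightarrow> ireg u 26 = int (card S + 1 - kap S) \<Longrightarrow> Q u"
  shows "ok W ranks_prog 16 s Q"
proof -
  note g = globD[OF nodeD(1)[OF s(1)]]
  define m where "m = card S"
  have m: "m \<le> n" using card_le_n[OF nodeD(3)[OF s(1)]] by (simp add: m_def)
  have k: "(int m + 8 * int d - 1) div (8 * int d) = int (kap S)"
    using d by (simp add: kap_def m_def[symmetric] zdiv_int of_nat_diff)
  \<comment> \<open>Prevents truncation in the rank \<open>card S + 1 - kap S\<close>. The empty
    node is included, as every number of a level is processed, occupied or not.\<close>
  have kl: "kap S \<le> m + 1"
  proof (cases "m = 0")
    case True
    then show ?thesis using d by (simp add: kap_def m_def)
  next
    case False
    then show ?thesis using kap_bounds(2)[of S] by (simp add: m_def)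
  qed
  then have k2: "int m + 1 - int (kap S) = int (m + 1 - kap S)" by (simp add: of_nat_diff)
  have h: "(int m + 1) div 2 = int ((m + 1) div 2)" by simp
  have b: "int m + 8 * int d \<le> W" "int (kap S) \<le> W" "int m + 1 \<le> W" "int ((m + 1) div 2) \<le> W"
    "int (m + 1 - kap S) \<le> W" "2 \<le> W"
    using W_bounds(9,1) m kl d by linarith+
  show ?thesis
    unfolding ranks_prog_def
    by (rule ok_wp) (use s(2) b d in \<open>simp_all add: g m_def[symmetric] k k2 h del: of_nat_Suc\<close>,
      auto intro!: Q simp: agr_def same_mem_def m_def intro: node_agr[OF s(1), of 17])
qed

abbreviation "t_bounds \<equiv> 3 * (n * (n * 30 + 40) + 10) + 30"

definition ranked :: "nat set \<Rightarrow> ram \<Rightarrow> bool" where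
  "ranked S s \<longleftrightarrow> node S s \<and> ireg s 24 = int (kap S) \<and>
      ireg s 25 = int ((card S + 1) div 2) \<and> ireg s 26 = int (card S + 1 - kap S)"

lemma ranked_agr: "ranked S s \<Longrightarrow> agr K s t \<Longrightarrow> same_mem s t \<Longrightarrow> 27 \<le> K \<Longrightarrow> ranked S t"
  using node_agr[of S s K t] by (simp add: ranked_def agr_def)

lemma ok_total_prog:
  assumes s: "ranked S s" "ireg s 11 = int v"
    and Q: "\<And>u. agr 27 s u \<Longrightarrow> same_mem s u \<Longrightarrow> rreg u 28 = uu S v \<Longrightarrow> Q u"
  shows "ok W total_prog (d * (t_bounds + 10) + 20) s Q"
  unfolding total_prog_def
proof (rule ok_Seq[OF ok_wp[OF _ order_refl]])
  let ?b = "Seq (bounds_prog 29 27) (blk [ROp RMinus 42 41 39, ROp RPlus 28 28 42])"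
  let ?e = "blk [ROfInt 29 11, ROp RTimes 28 28 29, ROfInt 29 6, ROp RDivide 28 28 29]"
  let ?s = "s\<lparr>rreg := (rreg s)(28 := 0)\<rparr>"
  have s': "agr 27 s ?s" "same_mem s ?s" by (simp_all add: agr_def same_mem_def)
  have n': "ranked S ?s" using ranked_agr[OF s(1) s'] by simp
  then have g': "glob ?s" unfolding ranked_def by (elim conjE) (rule nodeD(1))
  have "ok W (Seq (upto_loop 27 1 ?b) ?e) (d * ((t_bounds + 4 + 1) + 4) + 3 + 8 + 1) ?s Q"
  proof (rule ok_Seq[OF ok_pure_loop[where I = "\<lambda>j t. rreg t 28 = pre S j"]])
    fix j t assume t: "j < d" "agr 27 ?s t" "same_mem ?s t" "ireg t 27 = int j" "rreg t 28 = pre S j"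
    have nt: "ranked S t" using ranked_agr[OF n' t(2,3)] by simp
    show "ok W ?b (t_bounds + 4 + 1) t (\<lambda>u. agr (Suc 27) t u \<and> same_mem t u \<and> rreg u 28 = pre S (Suc j))"
    proof (rule ok_Seq[OF ok_bounds_prog[of S t 29 27 j]])
      fix u assume u: "agr 29 t u" "same_mem t u" "rreg u (29 + 10) = cA S j" "rreg u (29 + 12) = cB S j"
      show "ok W (blk [ROp RMinus 42 41 39, ROp RPlus 28 28 42]) 4 u
          (\<lambda>u. agr (Suc 27) t u \<and> same_mem t u \<and> rreg u 28 = pre S (Suc j))"
        by (rule ok_wp) (use t u in \<open>simp_all add: pre_def agr_def same_mem_def\<close>)
    qed (use nt t in \<open>auto simp: ranked_def\<close>)
  next
    fix u assume u: "agr 27 ?s u" "same_mem ?s u" "rreg u 28 = pre S d"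
    have gu: "glob u" using glob_agr[OF u(1) _ g'] by simp
    show "ok W ?e 8 u Q"
      by (rule ok_wp) (use u s(2) in \<open>simp_all add: globD[OF gu]\<close>,
        auto intro!: Q simp: agr_def same_mem_def uu_def)
  qed (use g' globD[OF g'] W_bounds n d in \<open>auto simp: pre_def\<close>)
  then show "wp W (Do (ROp RMinus 28 6 6)) (\<lambda>t. ok W (Seq (upto_loop 27 1 ?b) ?e) (d * ((t_bounds + 4 + 1) + 4) + 3 + 8 + 1) t Q) s"
    by simp
qed (simp add: algebra_simps)

lemma ok_pick_prog:
  assumes s: "ranked S s" "rreg s 28 = uu S v"
    and Q: "\<And>u. agr 29 s u \<Longrightarrow> same_mem s u \<Longrightarrow> ireg u 30 = int (coord S v) \<Longrightarrow> rreg u 31 = thr S v \<Longrightarrow> Q u"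
  shows "ok W pick_prog (d * (t_bounds + 40) + 20) s Q"
  unfolding pick_prog_def
proof (rule ok_Seq[OF ok_wp[OF _ order_refl]])
  let ?s = "s\<lparr>ireg := (ireg s)(30 := 0), rreg := (rreg s)(30 := 0, 31 := 0)\<rparr>"
  let ?f = "\<lambda>j. med S j + spow (1 / p) (cA S j + (uu S v - pre S j))"
  let ?I = "\<lambda>j t. rreg t 30 = pre S j \<and> ireg t 30 = int (last_of id (pick S v) 0 j) \<and>
      rreg t 31 = last_of ?f (pick S v) 0 j"
  have s': "agr 29 s ?s" "same_mem s ?s" by (simp_all add: agr_def same_mem_def)
  have n': "ranked S ?s" using ranked_agr[OF s(1) s'] by simp
  then have g': "glob ?s" unfolding ranked_def by (elim conjE) (rule nodeD(1))
  have "ok W (upto_loop 29 1 pick_body) (d * ((t_bounds + 25 + 1) + 4) + 3) ?s Q"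
  proof (rule ok_pure_loop[where I = ?I])
    fix j t assume t: "j < d" "agr 29 ?s t" "same_mem ?s t" "ireg t 29 = int j" "?I j t"
    have nt: "ranked S t" using ranked_agr[OF n' t(2,3)] by simp
    have jW: "int j \<le> W" using t(1) W_bounds(8) by linarith
    show "ok W pick_body (t_bounds + 25 + 1) t (\<lambda>u. agr (Suc 29) t u \<and> same_mem t u \<and> ?I (Suc j) u)"
      unfolding pick_body_def
    proof (rule ok_Seq[OF ok_bounds_prog[of S t 32 29 j]])
      fix u assume u: "agr 32 t u" "same_mem t u" "node S u" "rreg u (32 + 2) = med S j"
        "rreg u (32 + 10) = cA S j" "rreg u (32 + 12) = cB S j"
      have pS: "pre S (Suc j) = pre S j + (cB S j - cA S j)" by (simp add: pre_def)
      have v28: "rreg u 28 = uu S v" using u t s(2) by (simp add: agr_def)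
      have vals: "rreg u 30 = pre S j" "ireg u 30 = int (last_of id (pick S v) 0 j)"
        "rreg u 31 = last_of ?f (pick S v) 0 j" "ireg u 29 = int j"
        using u(1) t by (simp_all add: agr_def)
      have pk: "pick S v j \<longleftrightarrow> \<not> uu S v < pre S j \<and> uu S v < pre S j + (cB S j - cA S j)"
        by (auto simp: pick_def pS)
      show "ok W (Seq (blk [ROp RMinus 45 44 42, ROp RPlus 46 30 45])
        (Seq (Cond (RLess 28 30) SKIP (Cond (RLess 28 46)
          (Seq (blk [IOp ITimes 30 29 2, ROp RMinus 47 28 30, ROp RPlus 47 42 47])
            (Seq (spow_prog 48 47 5) (Do (ROp RPlus 31 34 48)))) SKIP))
          (Do (ROp RPlus 30 46 6)))) 25 u (\<lambda>u. agr (Suc 29) t u \<and> same_mem t u \<and> ?I (Suc j) u)"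
        by (rule ok_wp) (use u(4-) vals v28 jW in \<open>simp_all add: globD[OF nodeD(1)[OF u(3)]] spow_prog_def pk pS\<close>,
          use u(1,2) in \<open>simp_all add: agr_def same_mem_def spow_def\<close>)
    qed (use nt t in \<open>auto simp: ranked_def\<close>)
  next
    fix u assume u: "agr 29 ?s u" "same_mem ?s u" "?I d u"
    show "Q u" using u by (intro Q) (auto simp: agr_def same_mem_def coord_def thr_def)
  qed (use g' globD[OF g'] W_bounds n d in \<open>auto simp: pre_def\<close>)
  then show "wp W (blk [IConst 30 0, ROp RMinus 30 6 6, ROp RMinus 31 6 6]) (\<lambda>t. ok W (upto_loop 29 1 pick_body) (d * ((t_bounds + 25 + 1) + 4) + 3) t Q) s"
    using W_bounds(1) by simp
qed (simp add: algebra_simps)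

definition decided :: "nat set \<Rightarrow> nat \<Rightarrow> ram \<Rightarrow> bool" where
  "decided S v s \<longleftrightarrow> glob s \<and> inp s = xs \<and> ireg s 22 = int (rep S) \<and> ireg s 23 = (if ball S then 1 else 0) \<and>
     ireg s 30 = int (coord S v) \<and> rreg s 31 = thr S v"

lemma decided_agr: "decided S v s \<Longrightarrow> agr K s t \<Longrightarrow> 32 \<le> K \<Longrightarrow> decided S v t"
  using glob_agr[of K s t] by (simp add: decided_def agr_def)

lemma coord_less: "coord S v < d"
  using last_of_hit[of d "pick S v" id 0] last_of_miss[of d "pick S v" id 0] d
  by (cases "\<exists>j<d. pick S v j") (auto simp: coord_def)

lemma ok_side_prog:
  assumes s: "decided S v s" "31 < c" "a < c" "ireg s a = int i" "i < n"
    and Q: "\<And>u. agr c s u \<Longrightarrow> same_mem s u \<Longrightarrow> ireg u c = (if lft S v i then 1 else 0) \<Longrightarrow> Q u"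
  shows "ok W (side_prog c a) (d * 30 + 20) s Q"
  unfolding side_prog_def
proof (rule ok_Cond)
  have gl: "glob s" using s(1) by (simp add: decided_def)
  note g = globD[OF gl]
  have dd: "inp s = xs" "ireg s 22 = int (rep S)" "ireg s 23 = (if ball S then 1 else 0)"
    "ireg s 30 = int (coord S v)" "rreg s 31 = thr S v" using s(1) by (simp_all add: decided_def)
  show "ok W (Seq (blk (input_instrs c a 30)) (Cond (RLess 31 c) (Do (IConst c 0)) (Do (IConst c 1))))
      (d * 30 + 13) s Q" if "test_sem (ILess 23 2) s"
  proof -
    have nb: "\<not> ball S" using that dd g by (auto split: if_splits)
    show ?thesis
      by (rule ok_wp) (use s(2-) dd coord_less W_bounds(1) in \<open>simp_all add: g input_simps\<close>,
        auto intro!: Q simp: agr_def same_mem_def lft_def cut_def nb input_instrs_def)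
  qed
  show "ok W (Seq (dist_prog (c + 1) 22 a) (Cond (RLess 3 (c + 2)) (Do (IConst c 0)) (Do (IConst c 1))))
      (d * 30 + 13) s Q" if "\<not> test_sem (ILess 23 2) s"
  proof (rule ok_Seq[OF ok_dist_prog[OF gl dd(1)]])
    have bl: "ball S" using that dd g by (auto split: if_splits)
    fix u assume u: "agr (c + 1) s u" "same_mem s u" "rreg u (c + 1 + 1) = dst (X (rep S)) (X i)"
    have gu: "glob u" using glob_agr[OF u(1) _ gl] s(2) by simp
    show "ok W (Cond (RLess 3 (c + 2)) (Do (IConst c 0)) (Do (IConst c 1))) 2 u Q"
      by (rule ok_wp) (use u s(2-) W_bounds(1) in \<open>simp_all add: globD[OF gu]\<close>,
        auto intro!: Q simp: agr_def same_mem_def lft_def bl)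
  qed (use s dd rep_less in auto)
qed simp

lemma ok_scan_prog:
  assumes s: "node S s" "decided S v s"
    and Q: "\<And>u. agr 32 s u \<Longrightarrow> same_mem s u \<Longrightarrow> ireg u 34 = pL S v \<Longrightarrow> ireg u 35 = pR S v \<Longrightarrow> Q u"
  shows "ok W scan_prog (n * (d * 30 + 40) + 20) s Q"
  unfolding scan_prog_def
proof (rule ok_Seq[OF ok_wp[OF _ order_refl]])
  let ?b = "Seq (side_prog 36 32) (Cond (ILess 36 2) (Do (IOp ITimes 35 32 2)) (Do (IOp ITimes 34 32 2)))"
  let ?s = "s\<lparr>ireg := (ireg s)(34 := - 1, 35 := - 1)\<rparr>"
  let ?I = "\<lambda>i t. ireg t 34 = last_of int (\<lambda>i. i \<in> S \<and> lft S v i) (- 1) i \<and>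
      ireg t 35 = last_of int (\<lambda>i. i \<in> S \<and> \<not> lft S v i) (- 1) i"
  have s': "agr 32 s ?s" "same_mem s ?s" by (simp_all add: agr_def same_mem_def)
  have n': "node S ?s" "decided S v ?s"
    using node_agr[OF s(1) s'] decided_agr[OF s(2) s'(1)] by simp_all
  have "ok W (class_loop 32 ?b) (n * ((d * 30 + 20 + 2 + 1) + 12) + 3) ?s Q"
  proof (rule ok_class_loop[where I = ?I])
    fix i t assume t: "i \<in> S" "i < n" "agr 32 ?s t" "same_mem ?s t" "node S t" "ireg t 32 = int i" "?I i t"
    have dt: "decided S v t" using decided_agr[OF n'(2) t(3)] by simp
    have iW: "int i \<le> W" using t(2) W_bounds(3) by linarith
    show "ok W ?b (d * 30 + 20 + 2 + 1) t (\<lambda>u. agr (32 + 2) t u \<and> same_mem t u \<and> ?I (Suc i) u)"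
    proof (rule ok_Seq[OF ok_side_prog[OF dt]])
      fix u assume u: "agr 36 t u" "same_mem t u" "ireg u 36 = (if lft S v i then 1 else 0)"
      have gu: "glob u" using glob_agr[OF u(1)] nodeD(1)[OF t(5)] by simp
      show "ok W (Cond (ILess 36 2) (Do (IOp ITimes 35 32 2)) (Do (IOp ITimes 34 32 2))) 2 u
          (\<lambda>u. agr (32 + 2) t u \<and> same_mem t u \<and> ?I (Suc i) u)"
        by (rule ok_wp) (use t u iW in \<open>simp_all add: globD[OF gu] agr_ireg[OF u(1)]\<close>,
          auto simp: agr_def same_mem_def)
    qed (use t in auto)
  next
    fix u assume u: "agr 32 ?s u" "same_mem ?s u" "?I n u"
    show "Q u" using u by (intro Q) (auto simp: agr_def same_mem_def pL_def pR_def)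
  qed (use n' in auto)
  then show "wp W (blk [IConst 34 (- 1), IConst 35 (- 1)]) (\<lambda>t. ok W (class_loop 32 ?b) (n * ((d * 30 + 20 + 2 + 1) + 12) + 3) t Q) s"
    using W_bounds(1) by simp
qed (simp add: algebra_simps)

end


context nns_program
begin

definition enc :: "nat \<Rightarrow> int \<Rightarrow> int" where
  "enc nb a = (if a < 0 then - 1 else int nb + a)"

lemma pL_less: "pL S v < int n" and pR_less: "pR S v < int n"
  using pL_cases[of S v] pR_cases[of S v] by auto

lemma pL_ge: "- 1 \<le> pL S v" and pR_ge: "- 1 \<le> pR S v"
  using pL_cases[of S v] pR_cases[of S v] by auto

lemma enc_W:
  assumes "nb \<le> NT * L * n" "- 1 \<le> a" "a < int n"
  shows "\<bar>enc nb a\<bar> \<le> W"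
proof -
  have "int nb \<le> int (NT * L * n)" using assms(1) by (simp del: of_nat_mult)
  then show ?thesis using W_bounds(1,6) assms by (auto simp: enc_def)
qed

lemma ok_emit_prog:
  assumes s: "decided S v s" "ireg s 34 = pL S v" "ireg s 35 = pR S v" "ireg s 13 = int nb" "nb \<le> NT * L * n"
    and Q: "\<And>u. agr 36 s u \<Longrightarrow> imem u = imem s \<Longrightarrow> rmem u = rmem s \<Longrightarrow> ireg u 38 = enc nb (pR S v) \<Longrightarrow>
      ireg u 37 = enc nb (chL S v) \<Longrightarrow>
      iout u = iout s @ [int (rep S), int (coord S v), enc nb (chL S v), enc nb (pR S v)] \<Longrightarrow>
      rout u = rout s @ [thr S v] \<Longrightarrow> Q u"
  shows "ok W emit_prog 30 s Q"
proof -
  have gl: "glob s" using s(1) by (simp add: decided_def)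
  note g = globD[OF gl]
  have dd: "ireg s 22 = int (rep S)" "ireg s 23 = (if ball S then 1 else 0)"
    "ireg s 30 = int (coord S v)" "rreg s 31 = thr S v" using s(1) by (simp_all add: decided_def)
  have e1: "pL S v < 0 \<Longrightarrow> enc nb (pL S v) = - 1" "\<not> pL S v < 0 \<Longrightarrow> pL S v + int nb = enc nb (pL S v)"
    and e2: "pR S v < 0 \<Longrightarrow> enc nb (pR S v) = - 1" "\<not> pR S v < 0 \<Longrightarrow> pR S v + int nb = enc nb (pR S v)"
    by (simp_all add: enc_def)
  have b: "\<bar>enc nb (pL S v)\<bar> \<le> W" "\<bar>enc nb (pR S v)\<bar> \<le> W"
    using enc_W[OF s(5)] pL_less pR_less pL_ge pR_ge by blast+
  show ?thesis unfolding emit_prog_def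
    by (rule ok_wp) (use s(2-4) dd b W_bounds(1) in \<open>simp_all add: g e1 e2\<close>,
      auto intro!: Q simp: agr_def chL_def e1 e2)
qed

definition newl :: "nat set \<Rightarrow> nat \<Rightarrow> int \<Rightarrow> nat \<Rightarrow> nat \<Rightarrow> int" where
  "newl S v k nb i = (if lft S v i then (if ball S then k else enc nb (pL S v)) else enc nb (pR S v))"

text \<open>The memory after the first \<open>i\<close> points have been treated, in the form of a
  loop invariant.\<close>

definition relabelled :: "nat set \<Rightarrow> nat \<Rightarrow> int \<Rightarrow> nat \<Rightarrow> nat \<Rightarrow> (nat \<Rightarrow> int) \<Rightarrow> nat \<Rightarrow> int" where
  "relabelled S v k nb i m x =
     (if NT * L \<le> x \<and> x < NT * L + i \<and> x - NT * L \<in> S then newl S v k nb (x - NT * L) else m x)"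

lemma ok_relabel_prog:
  assumes s: "node S s" "decided S v s" "ireg s 16 = k" "ireg s 38 = enc nb (pR S v)"
      "\<not> ball S \<Longrightarrow> ireg s 37 = enc nb (pL S v)"
    and Q: "\<And>u. agr 39 s u \<Longrightarrow> rmem u = rmem s \<Longrightarrow> iout u = iout s \<Longrightarrow> rout u = rout s \<Longrightarrow>
      imem u = relabelled S v k nb n (imem s) \<Longrightarrow> Q u"
  shows "ok W relabel_prog (n * (d * 30 + 50) + 10) s Q"
proof -
  note g = globD[OF nodeD(1)[OF s(1)]]
  let ?c = "Seq (side_prog 42 39)
       (Cond (ILess 42 2) (Do (IStore 40 38)) (Cond (ILess 23 2) (Do (IStore 40 37)) SKIP))"
  let ?b = "Seq (blk [IOp IPlus 40 5 39, ILoad 41 40]) (Cond (ILess 41 16) SKIP (Cond (ILess 16 41) SKIP ?c))"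
  let ?I = "\<lambda>i t. rmem t = rmem s \<and> iout t = iout s \<and> rout t = rout s \<and> imem t = relabelled S v k nb i (imem s)"
  have "ok W relabel_prog (n * ((d * 30 + 20 + 3 + 1 + 2 + 6) + 4) + 3) s Q"
    unfolding relabel_prog_def
  proof (rule ok_for[where I = ?I])
    show "ireg s 2 = 1" "ireg s 0 = int n" "int n \<le> W" using g W_bounds(3) by auto
    show "?I 0 (s\<lparr>ireg := (ireg s)(39 := 0)\<rparr>)" by (auto simp: relabelled_def)
    show "Q u" if "agr 39 s u" "?I n u" for u using that by (intro Q) auto
    fix i t assume t: "i < n" "agr 39 s t" "ireg t 39 = int i" "?I i t"
    note r = agr_ireg[OF t(2)]
    \<comment> \<open>The updates in place have reached smaller indices only, so point
      \<open>i\<close> still has its old number.\<close>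
    have m: "imem t (NT * L + i) = imem s (NT * L + i)" using t(4) by (simp add: relabelled_def)
    have b: "int NT * int L + int i \<le> W" using W_bounds(7) t(1) by simp
    have lW: "\<bar>imem s (NT * L + i)\<bar> \<le> W" using s(1) t(1) by (simp add: node_def)
    have nat_i: "nat (int NT * int L + int i) = NT * L + i" by (metis nat_int of_nat_add of_nat_mult)
    define t' where "t' = t\<lparr>ireg := (ireg t)(40 := int (NT * L + i), 41 := imem s (NT * L + i))\<rparr>"
    have t': "agr 40 t t'" "same_mem t t'" "ireg t' 40 = int (NT * L + i)" "ireg t' 41 = imem s (NT * L + i)"
      by (simp_all add: t'_def agr_def same_mem_def)
    define P where "P = (\<lambda>u. agr (Suc 39) t u \<and> ?I (Suc i) (u\<lparr>ireg := (ireg u)(39 := int (Suc i))\<rparr>))"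
    have keep: "relabelled S v k nb (Suc i) (imem s) = relabelled S v k nb i (imem s)" if "i \<notin> S"
    proof
      fix x
      show "relabelled S v k nb (Suc i) (imem s) x = relabelled S v k nb i (imem s) x"
        using that by (cases "x = NT * L + i") (auto simp: relabelled_def)
    qed
    have put: "relabelled S v k nb (Suc i) (imem s) =
        (relabelled S v k nb i (imem s))(NT * L + i := newl S v k nb i)" if "i \<in> S"
    proof
      fix x
      show "relabelled S v k nb (Suc i) (imem s) x =
          ((relabelled S v k nb i (imem s))(NT * L + i := newl S v k nb i)) x"
        using that by (cases "x = NT * L + i") (auto simp: relabelled_def)
    qed
    \<comment> \<open>A point removed with a ball is not written to: it already has the number
      \<open>k\<close> that \<open>newl\<close> prescribes.\<close>
    have stay: "(relabelled S v k nb i (imem s))(NT * L + i := k) = relabelled S v k nb i (imem s)" if "i \<in> S"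
      using nodeD(4)[OF s(1) t(1)] that s(3) by (auto simp: relabelled_def)
    have "ok W (Cond (ILess 41 16) SKIP (Cond (ILess 16 41) SKIP ?c)) (d * 30 + 20 + 3 + 1 + 2) t' P"
    proof (cases "i \<in> S")
      case False
      have "P t'" using t t' keep[OF False] by (simp add: P_def agr_def same_mem_def)
      then show ?thesis using False nodeD(4)[OF s(1) t(1)] r[of 16] t'
        by (intro ok_Cond[where T = "d * 30 + 20 + 3 + 1 + 1"] ok_Cond[where T = "d * 30 + 20 + 3 + 1"] ok_SKIP)
          (simp_all add: agr_def)
    next
      case True
      have dt: "decided S v t'"
        using decided_agr[OF s(2), of 39 t'] t(2) t'(1) by (simp add: agr_def)
      have "ok W ?c (d * 30 + 20 + 3 + 1) t' P"
      proof (rule ok_Seq[OF ok_side_prog[OF dt]])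
        fix u assume u: "agr 42 t' u" "same_mem t' u" "ireg u 42 = (if lft S v i then 1 else 0)"
        have du: "decided S v u" using decided_agr[OF dt u(1)] by simp
        then have gu: "glob u" by (simp add: decided_def)
        have R: "ireg u 40 = int (NT * L + i)" "ireg u 38 = enc nb (pR S v)"
          "ireg u 23 = (if ball S then 1 else 0)" "\<not> ball S \<Longrightarrow> ireg u 37 = enc nb (pL S v)"
          using u t' t s du by (simp_all add: agr_def decided_def)
        have M: "rmem u = rmem s" "iout u = iout s" "rout u = rout s" "imem u = relabelled S v k nb i (imem s)"
          using u(2) t'(2) t(4) by (simp_all add: same_mem_def)
        have A: "agr 40 t u" using u(1) t'(1) by (simp add: agr_def)
        show "ok W (Cond (ILess 42 2) (Do (IStore 40 38)) (Cond (ILess 23 2) (Do (IStore 40 37)) SKIP)) 3 u P"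
          by (rule ok_wp) (use R u(3) M A nat_i in \<open>auto simp: globD[OF gu] P_def put[OF True] newl_def stay[OF True] agr_def\<close>)
      qed (use t t' in \<open>auto simp: agr_def\<close>)
      then show ?thesis using True nodeD(4)[OF s(1) t(1)] r[of 16] t'
        by (intro ok_Cond[where T = "d * 30 + 20 + 3 + 1 + 1"] ok_Cond[where T = "d * 30 + 20 + 3 + 1"])
          (simp_all add: agr_def)
    qed
    then have C: "ok W (Cond (ILess 41 16) SKIP (Cond (ILess 16 41) SKIP ?c)) (d * 30 + 20 + 3 + 1 + 2)
        (t\<lparr>ireg := (ireg t)(40 := int NT * int L + int i, 41 := imem s (NT * L + i))\<rparr>) P"
      by (simp add: t'_def)
    show "ok W ?b (d * 30 + 20 + 3 + 1 + 2 + 6) t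
        (\<lambda>u. agr (Suc 39) t u \<and> ?I (Suc i) (u\<lparr>ireg := (ireg u)(39 := int (Suc i))\<rparr>))"
      unfolding P_def[symmetric]
      by (rule ok_Seq[OF ok_wp[OF _ order_refl]])
        (use C t(3) m b lW r[of 5] nat_i in \<open>simp add: g\<close>, simp)
  qed simp_all
  then show ?thesis by (rule ok_conseq) (auto simp: algebra_simps)
qed

definition t_class :: nat where
  "t_class = n * 20 + 10 + (n * (n * (d * 30 + 30) + 40) + 10) + 16 + (d * (t_bounds + 10) + 20) +
     (d * (t_bounds + 40) + 20) + (n * (d * 30 + 40) + 20) + 30 + (n * (d * 30 + 50) + 10) + 7"

lemma ok_class_prog:
  assumes s: "node S s" "ireg s 11 = int v" "ireg s 13 = int nb" "nb \<le> NT * L * n" "ireg s 16 = k"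
    and Q: "\<And>u. agr 17 s u \<Longrightarrow> rmem u = rmem s \<Longrightarrow>
      iout u = iout s @ [int (rep S), int (coord S v), enc nb (chL S v), enc nb (pR S v)] \<Longrightarrow>
      rout u = rout s @ [thr S v] \<Longrightarrow> imem u = relabelled S v k nb n (imem s) \<Longrightarrow> Q u"
  shows "ok W class_prog t_class s Q"
proof -
  let ?c7 = "Seq emit_prog relabel_prog"
  let ?T7 = "30 + (n * (d * 30 + 50) + 10) + 1"
  have "ok W class_prog (n * 20 + 10 + ((n * (n * (d * 30 + 30) + 40) + 10) + (16 + ((d * (t_bounds + 10) + 20) +
     ((d * (t_bounds + 40) + 20) + ((n * (d * 30 + 40) + 20) + ?T7 + 1) + 1) + 1) + 1) + 1) + 1) s Q"
    unfolding class_prog_def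
  proof (rule ok_Seq[OF ok_count_prog[OF s(1)] order_refl],
      rule ok_Seq[OF ok_rep_prog order_refl])
    fix a b assume a: "agr 17 s a" "same_mem s a" "node S a" "ireg a 19 = int (card S)"
    assume b: "agr 20 a b" "same_mem a b" "node S b" "ireg b 22 = int (rep S)" "ireg b 23 = (if ball S then 1 else 0)"
    show "ok W (Seq ranks_prog (Seq total_prog (Seq pick_prog (Seq scan_prog ?c7))))
        (16 + ((d * (t_bounds + 10) + 20) + ((d * (t_bounds + 40) + 20) + ((n * (d * 30 + 40) + 20) + ?T7 + 1) + 1) + 1) + 1) b Q"
    proof (rule ok_Seq[OF ok_ranks_prog[OF b(3)] order_refl])
      show "ireg b 19 = int (card S)" using a b by (simp add: agr_def)
      fix c assume c: "agr 24 b c" "same_mem b c" "node S c" "ireg c 24 = int (kap S)"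
        "ireg c 25 = int ((card S + 1) div 2)" "ireg c 26 = int (card S + 1 - kap S)"
      have rc: "ranked S c" using c by (simp add: ranked_def)
      have vc: "ireg c 11 = int v" using a b c s by (simp add: agr_def)
      show "ok W (Seq total_prog (Seq pick_prog (Seq scan_prog ?c7)))
         ((d * (t_bounds + 10) + 20) + ((d * (t_bounds + 40) + 20) + ((n * (d * 30 + 40) + 20) + ?T7 + 1) + 1) + 1) c Q"
      proof (rule ok_Seq[OF ok_total_prog[OF rc vc] order_refl])
        fix e assume e: "agr 27 c e" "same_mem c e" "rreg e 28 = uu S v"
        have re: "ranked S e" using ranked_agr[OF rc e(1,2)] by simp
        show "ok W (Seq pick_prog (Seq scan_prog ?c7))
           ((d * (t_bounds + 40) + 20) + ((n * (d * 30 + 40) + 20) + ?T7 + 1) + 1) e Q"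
        proof (rule ok_Seq[OF ok_pick_prog[OF re e(3)] order_refl])
          fix f assume f: "agr 29 e f" "same_mem e f" "ireg f 30 = int (coord S v)" "rreg f 31 = thr S v"
          have nf: "node S f" using ranked_agr[OF re f(1,2)] by (simp add: ranked_def)
          have df: "decided S v f"
          proof -
            have "ireg f 22 = int (rep S)" "ireg f 23 = (if ball S then 1 else 0)"
              using b(4,5) c(1) e(1) f(1) by (simp_all add: agr_def)
            then show ?thesis using nodeD(1,2)[OF nf] f(3,4) by (simp add: decided_def)
          qed
          show "ok W (Seq scan_prog ?c7) ((n * (d * 30 + 40) + 20) + ?T7 + 1) f Q"
          proof (rule ok_Seq[OF ok_scan_prog[OF nf df] order_refl])
            fix h assume h: "agr 32 f h" "same_mem f h" "ireg h 34 = pL S v" "ireg h 35 = pR S v"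
            have dh: "decided S v h" using decided_agr[OF df h(1)] by simp
            have nh: "node S h" using node_agr[OF nf h(1,2)] by simp
            have nb: "ireg h 13 = int nb" using a b c e f h s by (simp add: agr_def)
            have A: "agr 17 s h" using a b c e f h by (simp add: agr_def)
            have MM: "same_mem s h" using a b c e f h by (simp add: same_mem_def)
            show "ok W ?c7 ?T7 h Q"
            proof (rule ok_Seq[OF ok_emit_prog[OF dh h(3,4) nb s(4)] order_refl])
              fix y assume y: "agr 36 h y" "imem y = imem h" "rmem y = rmem h" "ireg y 38 = enc nb (pR S v)"
                "ireg y 37 = enc nb (chL S v)"
                "iout y = iout h @ [int (rep S), int (coord S v), enc nb (chL S v), enc nb (pR S v)]"
                "rout y = rout h @ [thr S v]"
              have dy: "decided S v y" using decided_agr[OF dh y(1)] by simp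
              have ny: "node S y" using nh y(1,2) glob_agr[OF y(1)] by (simp add: node_def agr_def)
              show "ok W relabel_prog (n * (d * 30 + 50) + 10) y Q"
              proof (rule ok_relabel_prog[OF ny dy _ y(4)])
                show "ireg y 16 = k" using A y(1) s(5) by (simp add: agr_def)
                show "ireg y 37 = enc nb (pL S v)" if "\<not> ball S" using y(5) that by (simp add: chL_def)
                fix u assume u: "agr 39 y u" "rmem u = rmem y" "iout u = iout y" "rout u = rout y"
                  "imem u = relabelled S v k nb n (imem y)"
                show "Q u" using u y A MM by (intro Q) (simp_all add: agr_def same_mem_def)
              qed
            qed
          qed
        qed
      qed
    qed
  qed
  then show ?thesis by (rule ok_conseq) (simp_all add: t_class_def)
qed

section \<open>The pre-processing program\<close>

context
  fixes vs :: "nat list"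
begin

text \<open>Inverts the numbering \<open>k = g * n + a\<close>.\<close>

definition node_of :: "nat \<Rightarrow> nat set" where
  "node_of k = cls (glam L vs (k div n)) (int (k mod n))"

definition irec :: "nat \<Rightarrow> int list" where
  "irec k = [int (rep (node_of k)), int (coord (node_of k) (vs ! (k div n))),
     enc (Suc (k div n) * n) (chL (node_of k) (vs ! (k div n))),
     enc (Suc (k div n) * n) (pR (node_of k) (vs ! (k div n)))]"

definition trec :: "nat \<Rightarrow> real" where
  "trec k = thr (node_of k) (vs ! (k div n))"

definition written :: "real list \<Rightarrow> nat \<Rightarrow> ram \<Rightarrow> bool" where
  "written out0 k t \<longleftrightarrow> iout t = concat (map irec [0..<k]) \<and> rout t = out0 @ map trec [0..<k] \<and>
     (\<forall>x<NT * L. imem t x = int (vs ! x))"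

text \<open>
  When the nodes below \<open>a\<close> of level \<open>g\<close> have been processed, the other points of level \<open>g\<close> still carry
  the number of their node, the processed ones that of their node at level \<open>g + 1\<close>, and the removed
  ones an older number.
\<close>

definition labels :: "nat \<Rightarrow> nat \<Rightarrow> ram \<Rightarrow> bool" where
  "labels g a t \<longleftrightarrow> (\<forall>i<n.
     if int a \<le> glam L vs g i then imem t (NT * L + i) = int (g * n) + glam L vs g i
     else if 0 \<le> ulam L vs (Suc g) i then imem t (NT * L + i) = int (Suc g * n) + ulam L vs (Suc g) i
     else 0 \<le> imem t (NT * L + i) \<and> imem t (NT * L + i) < int (g * n + a))"

lemma ulam_Suc: "ulam L vs (Suc g) = nx (glam L vs g) (vs ! g)"
  by (simp add: glam_def)

declare ulam.simps(2) [simp del]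

lemma ulam_range: "ulam L vs g i = - 1 \<or> (\<exists>j<n. ulam L vs g i = int j)"
  using nx_range n by (cases g) (auto simp: ulam_Suc)

lemma glam_range: "glam L vs g i = - 1 \<or> (\<exists>j<n. glam L vs g i = int j)"
  using ulam_range[of g i] n by (auto simp: glam_def)

lemma ulam_Suc_neg: "glam L vs g i < 0 \<Longrightarrow> ulam L vs (Suc g) i = - 1"
  by (simp add: ulam_Suc nx_def)

text \<open>Points that have moved on carry numbers from \<open>(g + 1) * n\<close> on, removed ones
  carry numbers below \<open>g * n + a\<close>; so this number singles out its node.\<close>

lemma labels_class:
  assumes "labels g a t" "a < n" "i < n"
  shows "imem t (NT * L + i) = int (g * n + a) \<longleftrightarrow> glam L vs g i = int a"
proof -
  have "int (Suc g * n) > int (g * n + a)" using assms(2) by (simp del: of_nat_add of_nat_mult)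
  then show ?thesis using assms(1,3)[unfolded labels_def] by (auto split: if_splits)
qed

lemma labels_W:
  assumes "labels g a t" "g < NT * L" "a \<le> n" "i < n"
  shows "\<bar>imem t (NT * L + i)\<bar> \<le> W"
proof -
  have "Suc g * n \<le> NT * L * n" using assms(2) by (intro mult_right_mono) auto
  then have 1: "int (Suc g * n) \<le> int (NT * L * n)" by linarith
  have 2: "int (g * n + a) \<le> int (Suc g * n)" "int (g * n) \<le> int (Suc g * n)" using assms(3) by (simp_all del: of_nat_add of_nat_mult)
  show ?thesis using assms(1,4)[unfolded labels_def] 1 2 W_bounds(6)
    using glam_range[of g i] ulam_range[of "Suc g" i] by (auto split: if_splits simp del: of_nat_mult)
qed

text \<open>Only members of node \<open>a\<close> change. Those that move on receive numbers of
  level \<open>g + 1\<close>; those removed keep \<open>g * n + a\<close>, which counts as an older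
  number now that the bound is \<open>g * n + Suc a\<close>.\<close>

lemma labels_step:
  assumes l: "labels g a t" and a: "a < n"
    and m: "imem u = relabelled (cls (glam L vs g) (int a)) (vs ! g) (int (g * n + a)) (Suc g * n) n (imem t)"
  shows "labels g (Suc a) u"
  unfolding labels_def
proof (intro allI impI)
  fix i assume i: "i < n"
  define S where "S = cls (glam L vs g) (int a)"
  have old: "imem u (NT * L + i) = imem t (NT * L + i)" if "i \<notin> S"
    using that by (simp add: m relabelled_def S_def)
  have new: "imem u (NT * L + i) = newl S (vs ! g) (int (g * n + a)) (Suc g * n) i" if "i \<in> S"
    using that i by (simp add: m relabelled_def S_def)
  show "if int (Suc a) \<le> glam L vs g i then imem u (NT * L + i) = int (g * n) + glam L vs g i
     else if 0 \<le> ulam L vs (Suc g) i then imem u (NT * L + i) = int (Suc g * n) + ulam L vs (Suc g) i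
     else 0 \<le> imem u (NT * L + i) \<and> imem u (NT * L + i) < int (g * n + Suc a)"
  proof (cases "i \<in> S")
    case True
    then have ga: "glam L vs g i = int a" by (simp add: S_def cls_def)
    have u: "ulam L vs (Suc g) i = newlab S (vs ! g) i" by (simp add: ulam_Suc nx_def ga S_def)
    show ?thesis
    proof (cases "lft S (vs ! g) i \<and> ball S")
      case True
      then show ?thesis using new[OF \<open>i \<in> S\<close>] ga u by (simp add: newl_def newlab_def)
    next
      case False
      have "0 \<le> newlab S (vs ! g) i"
        using False pL_nonneg[OF True i] pR_nonneg[OF True i] by (auto simp: newlab_def)
      moreover have "newl S (vs ! g) (int (g * n + a)) (Suc g * n) i = int (Suc g * n) + newlab S (vs ! g) i"
        using False \<open>0 \<le> newlab S (vs ! g) i\<close> by (auto simp: newl_def newlab_def enc_def)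
      ultimately show ?thesis using new[OF True] ga u by simp
    qed
  next
    case False
    then have "glam L vs g i \<noteq> int a" using i by (simp add: S_def cls_def)
    then show ?thesis using old[OF False] l[unfolded labels_def, rule_format, OF i] by (auto split: if_splits)
  qed
qed

text \<open>The interface between levels: what \<open>labels\<close> amounts to after the last node
  of a level and, unless a tree starts, before the first node of the next.\<close>

definition carried :: "nat \<Rightarrow> ram \<Rightarrow> bool" where
  "carried g t \<longleftrightarrow> (\<forall>i<n. if 0 \<le> ulam L vs g i then imem t (NT * L + i) = int (g * n) + ulam L vs g i
     else 0 \<le> imem t (NT * L + i) \<and> imem t (NT * L + i) < int (g * n))"

lemma labels_carried: "labels g n t \<Longrightarrow> carried (Suc g) t"
  unfolding labels_def carried_def
proof (intro allI impI)
  fix i assume *: "\<forall>i<n.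
     if int n \<le> glam L vs g i then imem t (NT * L + i) = int (g * n) + glam L vs g i
     else if 0 \<le> ulam L vs (Suc g) i then imem t (NT * L + i) = int (Suc g * n) + ulam L vs (Suc g) i
     else 0 \<le> imem t (NT * L + i) \<and> imem t (NT * L + i) < int (g * n + n)" "i < n"
  have e: "g * n + n = Suc g * n" by simp
  have "\<not> int n \<le> glam L vs g i" using glam_range[of g i] by auto
  then show "if 0 \<le> ulam L vs (Suc g) i then imem t (NT * L + i) = int (Suc g * n) + ulam L vs (Suc g) i
     else 0 \<le> imem t (NT * L + i) \<and> imem t (NT * L + i) < int (Suc g * n)"
    using *(1)[rule_format, OF *(2)] unfolding e by (simp only: if_False)
qed

lemma carried_labels: "g mod L \<noteq> 0 \<Longrightarrow> carried g t \<Longrightarrow> labels g 0 t"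
  unfolding labels_def carried_def
proof (intro allI impI)
  fix i assume g: "g mod L \<noteq> 0" and *: "\<forall>i<n. if 0 \<le> ulam L vs g i then imem t (NT * L + i) = int (g * n) + ulam L vs g i
     else 0 \<le> imem t (NT * L + i) \<and> imem t (NT * L + i) < int (g * n)" "i < n"
  have e: "glam L vs g = ulam L vs g" using g by (simp add: glam_def)
  show "if int 0 \<le> glam L vs g i then imem t (NT * L + i) = int (g * n) + glam L vs g i
     else if 0 \<le> ulam L vs (Suc g) i then imem t (NT * L + i) = int (Suc g * n) + ulam L vs (Suc g) i
     else 0 \<le> imem t (NT * L + i) \<and> imem t (NT * L + i) < int (g * n + 0)"
    using *(1)[rule_format, OF *(2)] ulam_Suc_neg[of g i] by (auto simp: e)
qed

end

end


lemma exc_of_ok: "ok W c T s (\<lambda>t. t = u) \<Longrightarrow> exc W c s T (return_pmf u)"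
  by (simp add: ok_def)

text \<open>For loops without a counter register whose number of rounds is known to the proof only,
  such as the doubling up to \<open>n\<close>.\<close>

lemma ok_counted_loop:
  assumes body: "\<And>k t. k < K \<Longrightarrow> I k t \<Longrightarrow> test_sem b t \<and> ok W c T t (I (Suc k))"
    and stop: "\<And>t. I K t \<Longrightarrow> \<not> test_sem b t \<and> Q t"
    and start: "I 0 s"
  shows "ok W (Loop b c) (K * (T + 2) + 1) s Q"
proof -
  have "ok W (Loop b c) ((K - k) * (T + 2) + 1) t Q" if "k \<le> K" "I k t" for k t
    using that
  proof (induction "K - k" arbitrary: k t)
    case 0
    then show ?case using stop[of t] by (intro ok_Loop_exit) auto
  next
    case (Suc m)
    then have k: "k < K" by simp
    have "ok W (Loop b c) ((K - Suc k) * (T + 2) + 1) u Q" if "I (Suc k) u" for u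
      by (rule Suc.hyps(1)) (use that k Suc.hyps(2) in auto)
    then have "ok W c T t (\<lambda>u. ok W (Loop b c) ((K - Suc k) * (T + 2) + 1) u Q)"
      using body[OF k Suc.prems(2)] by (blast intro: ok_conseq)
    moreover have "(K - k) * (T + 2) = (K - Suc k) * (T + 2) + (T + 2)"
      using k by (metis Suc_diff_Suc add.commute mult_Suc)
    then have "T + ((K - Suc k) * (T + 2) + 1) + 2 \<le> (K - k) * (T + 2) + 1" by linarith
    ultimately show ?case using body[OF k Suc.prems(2)] by (blast intro: ok_Loop_enter)
  qed
  from this[of 0 s] start show ?thesis by simp
qed

context nns_program
begin

lemma N_W: "int N \<le> W" using W_bounds(4) by (simp add: N_def)

definition t_level :: nat where "t_level = n * 10 + n * (t_class + 6) + 30"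

lemma ok_reset_prog:
  assumes s: "glob s" "ireg s 12 = l"
    and Q: "\<And>u. agr 15 s u \<Longrightarrow> rmem u = rmem s \<Longrightarrow> iout u = iout s \<Longrightarrow> rout u = rout s \<Longrightarrow>
      (\<forall>i<n. imem u (NT * L + i) = l) \<Longrightarrow> (\<forall>x<NT * L. imem u x = imem s x) \<Longrightarrow> Q u"
  shows "ok W reset_prog (n * 10 + 3) s Q"
proof -
  let ?I = "\<lambda>i t. rmem t = rmem s \<and> iout t = iout s \<and> rout t = rout s \<and> (\<forall>j<i. imem t (NT * L + j) = l) \<and>
    (\<forall>x<NT * L. imem t x = imem s x)"
  note g = globD[OF s(1)]
  have "ok W reset_prog (n * (4 + 4) + 3) s Q"
    unfolding reset_prog_def
  proof (rule ok_for[where I = ?I])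
    show "ireg s 2 = 1" "ireg s 0 = int n" "int n \<le> W" using g W_bounds(3) by auto
    show "Q u" if "agr 15 s u" "?I n u" for u using that by (intro Q) auto
    fix i t assume t: "i < n" "agr 15 s t" "ireg t 15 = int i" "?I i t"
    have b: "int NT * int L + int i \<le> W" using W_bounds(7) t(1) by simp
    have nat_i: "nat (int NT * int L + int i) = NT * L + i" by (metis nat_int of_nat_add of_nat_mult)
    have "ireg t 5 = int (NT * L)" "ireg t 12 = l" using t(2) s(2) g by (simp_all add: agr_def)
    then show "ok W (blk [IOp IPlus 16 5 15, IStore 16 12]) 4 t
        (\<lambda>u. agr (Suc 15) t u \<and> ?I (Suc i) (u\<lparr>ireg := (ireg u)(15 := int (Suc i))\<rparr>))"
      by (intro ok_wp) (use t(3,4) b nat_i in \<open>auto simp: agr_def less_Suc_eq\<close>)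
  qed simp_all
  then show ?thesis by (rule ok_conseq) simp_all
qed

context
  fixes vs :: "nat list"
  assumes vs: "length vs = NT * L" "\<And>x. x < NT * L \<Longrightarrow> vs ! x < N"
begin

lemma written_upd [simp]: "written vs out0 k (t\<lparr>ireg := f\<rparr>) = written vs out0 k t"
  by (simp add: written_def)

lemma labels_upd [simp]: "labels vs g a (t\<lparr>ireg := f\<rparr>) = labels vs g a t"
  by (simp add: labels_def)

lemma carried_upd [simp]: "carried vs g (t\<lparr>ireg := f\<rparr>) = carried vs g t"
  by (simp add: carried_def)

lemma ok_classes:
  assumes s: "glob s" "inp s = xs" "g < NT * L" "ireg s 11 = int (vs ! g)" "ireg s 12 = int (g * n)"
      "ireg s 13 = int (Suc g * n)" "labels vs g 0 s" "written vs out0 (g * n) s"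
    and Q: "\<And>u. agr 15 s u \<Longrightarrow> labels vs g n u \<Longrightarrow> written vs out0 (Suc g * n) u \<Longrightarrow> Q u"
  shows "ok W (upto_loop 15 0 (Seq (Do (IOp IPlus 16 12 15)) class_prog)) (n * ((t_class + 2) + 4) + 3) s Q"
proof (rule ok_for[where I = "\<lambda>a t. labels vs g a t \<and> written vs out0 (g * n + a) t"])
  note gg = globD[OF s(1)]
  show "ireg s 2 = 1" "ireg s 0 = int n" "int n \<le> W" using gg W_bounds(3) by auto
  show "labels vs g 0 (s\<lparr>ireg := (ireg s)(15 := 0)\<rparr>) \<and> written vs out0 (g * n + 0) (s\<lparr>ireg := (ireg s)(15 := 0)\<rparr>)"
    using s by simp
  show "Q u" if "agr 15 s u" "labels vs g n u \<and> written vs out0 (g * n + n) u" for u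
    using that by (intro Q) (simp_all add: add.commute)
  fix a t assume t: "a < n" "agr 15 s t" "ireg t 15 = int a" "labels vs g a t \<and> written vs out0 (g * n + a) t"
  have nb: "Suc g * n \<le> NT * L * n" using s(3) by (intro mult_right_mono) auto
  have kW: "int (g * n) + int a \<le> W"
  proof -
    have "g * n + a \<le> Suc g * n" using t(1) by simp
    then have "int (g * n) + int a \<le> int (NT * L * n)" using nb by linarith
    then show ?thesis using W_bounds(6) by linarith
  qed
  let ?k = "g * n + a"
  let ?t = "t\<lparr>ireg := (ireg t)(16 := int ?k)\<rparr>"
  have k: "?k div n = g" "?k mod n = a" using t(1) by simp_all
  have no: "node_of vs ?k = cls (glam L vs g) (int a)" by (simp only: node_of_def k)
  have at: "agr 15 s ?t" using t(2) by (simp add: agr_def)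
  have nt: "node (node_of vs ?k) ?t"
    unfolding node_def
  proof (intro conjI allI impI)
    show "glob ?t" using glob_agr[OF at _ s(1)] by simp
    show "inp ?t = xs" using at s(2) by (simp add: agr_def)
    show "node_of vs ?k = {i. i < n \<and> imem ?t (NT * L + i) = ireg ?t 16}"
      using labels_class[of vs g a t] t by (auto simp: no cls_def)
    show "\<bar>imem ?t (NT * L + i)\<bar> \<le> W" if "i < n" for i
      using labels_W[of vs g a t i] t s(3) that by simp
  qed
  have "ok W class_prog t_class ?t (\<lambda>u. agr (Suc 15) t u \<and>
      labels vs g (Suc a) (u\<lparr>ireg := (ireg u)(15 := int (Suc a))\<rparr>) \<and>
      written vs out0 (g * n + Suc a) (u\<lparr>ireg := (ireg u)(15 := int (Suc a))\<rparr>))"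
  proof (rule ok_class_prog[OF nt _ _ nb refl])
    show "ireg ?t 11 = int (vs ! g)" "ireg ?t 13 = int (Suc g * n)"
      using at s by (simp_all add: agr_def del: mult_Suc)
    fix u assume u: "agr 17 ?t u" "rmem u = rmem ?t"
      "iout u = iout ?t @ [int (rep (node_of vs ?k)), int (coord (node_of vs ?k) (vs ! g)),
         enc (Suc g * n) (chL (node_of vs ?k) (vs ! g)), enc (Suc g * n) (pR (node_of vs ?k) (vs ! g))]"
      "rout u = rout ?t @ [thr (node_of vs ?k) (vs ! g)]"
      "imem u = relabelled (node_of vs ?k) (vs ! g) (ireg ?t 16) (Suc g * n) n (imem ?t)"
    have "labels vs g (Suc a) u"
      using t u(5) by (intro labels_step[of vs g a t u]) (simp_all add: no)
    moreover have "written vs out0 (Suc ?k) u"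
      using t(4) u(3,4,5) by (simp add: written_def irec_def trec_def k relabelled_def)
    moreover have "agr (Suc 15) t u" using u(1) by (simp add: agr_def)
    ultimately show "agr (Suc 15) t u \<and>
      labels vs g (Suc a) (u\<lparr>ireg := (ireg u)(15 := int (Suc a))\<rparr>) \<and>
      written vs out0 (g * n + Suc a) (u\<lparr>ireg := (ireg u)(15 := int (Suc a))\<rparr>)"
      by simp
  qed
  moreover have "ireg t 12 = int (g * n)" using t(2) s(5) by (simp add: agr_def)
  ultimately have "wp W (Do (IOp IPlus 16 12 15)) (\<lambda>t'. ok W class_prog t_class t' (\<lambda>u. agr (Suc 15) t u \<and>
      labels vs g (Suc a) (u\<lparr>ireg := (ireg u)(15 := int (Suc a))\<rparr>) \<and>
      written vs out0 (g * n + Suc a) (u\<lparr>ireg := (ireg u)(15 := int (Suc a))\<rparr>))) t"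
    using t(3) kW by simp
  then show "ok W (Seq (Do (IOp IPlus 16 12 15)) class_prog) (t_class + 2) t (\<lambda>u. agr (Suc 15) t u \<and>
      labels vs g (Suc a) (u\<lparr>ireg := (ireg u)(15 := int (Suc a))\<rparr>) \<and>
      written vs out0 (g * n + Suc a) (u\<lparr>ireg := (ireg u)(15 := int (Suc a))\<rparr>))"
    by (rule ok_Seq[OF ok_wp[OF _ order_refl]]) simp
qed simp_all

lemma ok_level_prog:
  assumes s: "glob s" "inp s = xs" "g < NT * L" "ireg s 10 = int g"
      "g mod L \<noteq> 0 \<Longrightarrow> carried vs g s" "written vs out0 (g * n) s"
    and Q: "\<And>u. agr 11 s u \<Longrightarrow> carried vs (Suc g) u \<Longrightarrow> written vs out0 (Suc g * n) u \<Longrightarrow> Q u"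
  shows "ok W level_prog t_level s Q"
proof -
  note gg = globD[OF s(1)]
  let ?s = "s\<lparr>ireg := (ireg s)(11 := int (vs ! g), 12 := int (g * n), 13 := int (Suc g * n), 14 := int (g mod L))\<rparr>"
  let ?c = "upto_loop 15 0 (Seq (Do (IOp IPlus 16 12 15)) class_prog)"
  let ?Tc = "n * ((t_class + 2) + 4) + 3"
  have nb: "Suc g * n \<le> NT * L * n" using s(3) by (intro mult_right_mono) auto
  have b: "int g * int n \<le> W" "int g * int n + int n \<le> W" "int g \<le> W" "int g mod int L \<le> W"
  proof -
    have "int (Suc g * n) \<le> int (NT * L * n)" using nb by linarith
    then have "int g * int n + int n \<le> int (NT * L * n)" by (simp add: algebra_simps)
    moreover have gW: "int g \<le> int (NT * L)" using s(3) by linarith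
    moreover have "int g mod int L \<le> int g" by (simp add: zmod_le_nonneg_dividend)
    ultimately show "int g * int n \<le> W" "int g * int n + int n \<le> W" "int g \<le> W" "int g mod int L \<le> W"
      using W_bounds(6,7) n by linarith+
  qed
  have v: "imem s g = int (vs ! g)" "int (vs ! g) \<le> W"
    using s(3,6) vs(2)[OF s(3)] N_W by (auto simp: written_def)
  have as: "agr 11 s ?s" by (simp add: agr_def)
  have gs: "glob ?s" using glob_agr[OF as _ s(1)] by simp
  have classes: "ok W ?c ?Tc t Q" if t: "agr 15 ?s t" "labels vs g 0 t" "written vs out0 (g * n) t" for t
  proof (rule ok_classes[of t g out0])
    show "glob t" using glob_agr[OF t(1) _ gs] by simp
    show "inp t = xs" "ireg t 11 = int (vs ! g)" "ireg t 12 = int (g * n)" "ireg t 13 = int (Suc g * n)"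
      using t(1) s(2) by (simp_all add: agr_def)
    fix u assume u: "agr 15 t u" "labels vs g n u" "written vs out0 (Suc g * n) u"
    show "Q u" using u t(1) labels_carried[OF u(2)] by (intro Q) (auto simp: agr_def)
  qed (use s t in auto)
  have C: "ok W (Seq (Cond (ILess 14 2) reset_prog SKIP) ?c) ((n * 10 + 4) + ?Tc + 1) ?s Q"
  proof (rule ok_Seq[OF _ order_refl], rule ok_Cond)
    show "ok W reset_prog (n * 10 + 3) ?s (\<lambda>t. ok W ?c ?Tc t Q)" if "test_sem (ILess 14 2) ?s"
    proof (rule ok_reset_prog[OF gs])
      show "ireg ?s 12 = int (g * n)" by simp
      fix t assume t: "agr 15 ?s t" "rmem t = rmem ?s" "iout t = iout ?s" "rout t = rout ?s"
        "\<forall>i<n. imem t (NT * L + i) = int (g * n)" "\<forall>x<NT * L. imem t x = imem ?s x"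
      have "g mod L = 0" using that gg by simp
      then have "labels vs g 0 t" using t(5) by (simp add: labels_def glam_def)
      moreover have "written vs out0 (g * n) t" using t s(6) by (simp add: written_def)
      ultimately show "ok W ?c ?Tc t Q" using classes t(1) by blast
    qed
    show "ok W SKIP (n * 10 + 3) ?s (\<lambda>t. ok W ?c ?Tc t Q)" if "\<not> test_sem (ILess 14 2) ?s"
    proof (rule ok_SKIP, rule classes)
      have "g mod L \<noteq> 0" using that gg by (simp split: if_splits)
      then show "labels vs g 0 ?s" using s(5) carried_labels[of g vs s] by simp
      show "written vs out0 (g * n) ?s" using s(6) by simp
    qed (rule agr_refl)
  qed simp
  show ?thesis unfolding level_prog_def t_level_def
    by (rule ok_Seq[OF ok_wp[OF _ order_refl]])
      (use C b s(4) v LN in \<open>simp add: gg zmod_int add.commute\<close>, simp)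
qed

lemma ok_levels_prog:
  assumes s: "glob s" "inp s = xs" "iout s = []" "\<forall>x<NT * L. imem s x = int (vs ! x)"
    and Q: "\<And>u. iout u = concat (map (irec vs) [0..<NT * L * n]) \<Longrightarrow>
      rout u = rout s @ map (trec vs) [0..<NT * L * n] \<Longrightarrow> Q u"
  shows "ok W levels_prog (NT * L * (t_level + 4) + 3) s Q"
  unfolding levels_prog_def
proof (rule ok_for[where I = "\<lambda>g t. written vs (rout s) (g * n) t \<and> (g mod L \<noteq> 0 \<longrightarrow> carried vs g t)"])
  show "int (NT * L) \<le> W" using W_bounds(7) by linarith
  show "Q u" if "written vs (rout s) (NT * L * n) u \<and> (NT * L mod L \<noteq> 0 \<longrightarrow> carried vs (NT * L) u)" for u
    using that by (intro Q) (auto simp: written_def)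
  fix g t assume t: "g < NT * L" "agr 10 s t" "ireg t 10 = int g"
    "written vs (rout s) (g * n) t \<and> (g mod L \<noteq> 0 \<longrightarrow> carried vs g t)"
  show "ok W level_prog t_level t (\<lambda>u. agr (Suc 10) t u \<and>
      written vs (rout s) (Suc g * n) (u\<lparr>ireg := (ireg u)(10 := int (Suc g))\<rparr>) \<and>
      (Suc g mod L \<noteq> 0 \<longrightarrow> carried vs (Suc g) (u\<lparr>ireg := (ireg u)(10 := int (Suc g))\<rparr>)))"
  proof (rule ok_level_prog[OF _ _ t(1,3)])
    show "glob t" "inp t = xs" using glob_agr[OF t(2) _ s(1)] t(2) s(2) by (simp_all add: agr_def)
  qed (use t(4) in auto)
qed (use s globD[OF s(1)] in \<open>auto simp: written_def\<close>)

end

section \<open>Drawing the random numbers\<close>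

definition taped :: "ram \<Rightarrow> nat list \<Rightarrow> ram" where
  "taped s vs = s\<lparr>ireg := (ireg s)(10 := int (length vs), 11 := (if vs = [] then ireg s 11 else int (last vs))),
     imem := (\<lambda>x. if x < length vs then int (vs ! x) else imem s x)\<rparr>"

text \<open>\<open>exc_Seq\<close> needs the outcome as a function of the intermediate state.
  Register 11 still holds the number drawn, so it can be recovered there.\<close>

lemma exc_tape_body:
  assumes s: "glob s" "length vs < NT * L"
  shows "exc W tape_body (taped s vs) 5 (map_pmf (\<lambda>v. taped s (vs @ [v])) (pmf_of_set {..<N}))"
proof -
  note g = globD[OF s(1)]
  let ?s = "taped s vs"
  have g6: "ireg ?s 6 = int N" "ireg ?s 2 = 1" "ireg ?s 10 = int (length vs)" using g by (simp_all add: taped_def)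
  have "{0..<int N} = int ` {..<N}" by (simp add: image_int_atLeastLessThan lessThan_atLeast0)
  then have U: "pmf_of_set {0..<int N} = map_pmf int (pmf_of_set {..<N})"
    using N_pos by (subst map_pmf_of_set_inj) (auto simp: inj_on_def)
  define f where "f v = ?s\<lparr>ireg := (ireg ?s)(11 := int v)\<rparr>" for v
  have ne: "{..<N} \<noteq> {}" using N_pos by auto
  have "exec W (IRand 11 6) ?s = map_pmf (\<lambda>v. set_ireg W 11 (int v) ?s) (pmf_of_set {..<N})"
    using N_pos by (simp add: g6 U pmf.map_comp o_def)
  also have "\<dots> = map_pmf (\<lambda>v. Some (f v)) (pmf_of_set {..<N})"
  proof (intro map_pmf_cong refl)
    fix v assume "v \<in> set_pmf (pmf_of_set {..<N})"
    then have "v < N" using ne by simp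
    then have "int v \<le> W" using N_W by linarith
    then show "set_ireg W 11 (int v) ?s = Some (f v)" by (simp add: set_ireg_def f_def)
  qed
  finally have 1: "exc W (Do (IRand 11 6)) ?s 1 (map_pmf f (pmf_of_set {..<N}))"
    using exc_Do[of W "IRand 11 6" ?s "map_pmf f (pmf_of_set {..<N})"] by (simp add: pmf.map_comp o_def)
  have lW: "int (length vs) + 1 \<le> W" using s(2) W_bounds(7) n by linarith
  have 2: "exc W (Seq (Do (IStore 10 11)) (Do (IOp IPlus 10 10 2))) (f v) 3 (return_pmf (taped s (vs @ [v])))" for v
  proof (rule exc_of_ok, rule ok_wp)
    have "(\<lambda>x. if x < Suc (length vs) then int ((vs @ [v]) ! x) else imem s x) =
        (\<lambda>x. if x < length vs then int (vs ! x) else imem s x)(length vs := int v)"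
      by (auto simp: fun_eq_iff nth_append less_Suc_eq)
    then show "wp W (Seq (Do (IStore 10 11)) (Do (IOp IPlus 10 10 2))) (\<lambda>t. t = taped s (vs @ [v])) (f v)"
      using g6 lW by (simp add: f_def) (simp add: taped_def fun_eq_iff)
  qed simp
  have "exc W tape_body ?s (1 + 3 + 1) (bind_pmf (map_pmf f (pmf_of_set {..<N}))
      (\<lambda>t. return_pmf (taped s (vs @ [nat (ireg t 11)]))))"
    unfolding tape_body_def
  proof (rule exc_Seq[OF 1])
    fix t assume "t \<in> set_pmf (map_pmf f (pmf_of_set {..<N}))"
    then obtain v where "t = f v" by auto
    then show "exc W (Seq (Do (IStore 10 11)) (Do (IOp IPlus 10 10 2))) t 3 (return_pmf (taped s (vs @ [nat (ireg t 11)])))"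
      using 2[of v] by (simp add: f_def)
  qed
  moreover have "bind_pmf (map_pmf f (pmf_of_set {..<N})) (\<lambda>t. return_pmf (taped s (vs @ [nat (ireg t 11)]))) =
      map_pmf (\<lambda>v. taped s (vs @ [v])) (pmf_of_set {..<N})"
    unfolding bind_map_pmf by (simp add: f_def map_pmf_def)
  ultimately show ?thesis by simp
qed

lemma exc_tape_loop:
  assumes s: "glob s" "length vs + m = NT * L"
  shows "exc W (Loop (ILess 10 5) tape_body) (taped s vs) (m * 7 + 1) (map_pmf (\<lambda>ws. taped s (vs @ ws)) (tape m))"
  using assms(2)
proof (induction m arbitrary: vs)
  case 0
  then have "\<not> test_sem (ILess 10 5) (taped s vs)" using globD[OF s(1)] by (simp add: taped_def)
  then show ?case using exc_Loop[of W "ILess 10 5" "taped s vs" tape_body 0] exc_SKIP by simp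
next
  case (Suc m)
  then have "int (length vs) < int (NT * L)" by linarith
  then have t: "test_sem (ILess 10 5) (taped s vs)" using globD[OF s(1)] by (simp add: taped_def)
  define L' where "L' = Loop (ILess 10 5) tape_body"
  have "exc W (Seq tape_body L') (taped s vs) (5 + (m * 7 + 1) + 1)
      (bind_pmf (map_pmf (\<lambda>v. taped s (vs @ [v])) (pmf_of_set {..<N}))
        (\<lambda>t. map_pmf (\<lambda>ws. taped s (vs @ [nat (ireg t 11)] @ ws)) (tape m)))"
  proof (rule exc_Seq[OF exc_tape_body[OF s(1)]])
    show "length vs < NT * L" using Suc.prems by simp
    fix t assume "t \<in> set_pmf (map_pmf (\<lambda>v. taped s (vs @ [v])) (pmf_of_set {..<N}))"
    then obtain v where v: "t = taped s (vs @ [v])" by auto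
    then have "ireg t 11 = int v" by (simp add: taped_def)
    then show "exc W L' t (m * 7 + 1) (map_pmf (\<lambda>ws. taped s (vs @ [nat (ireg t 11)] @ ws)) (tape m))"
      using Suc.IH[of "vs @ [v]"] Suc.prems by (simp add: v L'_def)
  qed
  then have "exc W L' (taped s vs) (Suc (5 + (m * 7 + 1) + 1))
      (bind_pmf (map_pmf (\<lambda>v. taped s (vs @ [v])) (pmf_of_set {..<N}))
        (\<lambda>t. map_pmf (\<lambda>ws. taped s (vs @ [nat (ireg t 11)] @ ws)) (tape m)))"
    unfolding L'_def using t by (intro exc_Loop) simp
  moreover have "ireg (taped s (vs @ [v])) 11 = int v" for v by (simp add: taped_def)
  ultimately show ?case
    by (simp add: L'_def bind_map_pmf tape_Suc map_bind_pmf pmf.map_comp o_def del: replicate_pmf.simps)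
qed

lemma exc_tape_prog:
  assumes "glob s"
  shows "exc W tape_prog s (NT * L * 7 + 3) (map_pmf (taped s) (tape (NT * L)))"
proof -
  have 1: "exc W (Do (IConst 10 0)) s 1 (return_pmf (taped s []))"
    by (rule exc_of_ok, rule ok_wp) (use W_bounds(1) in \<open>simp_all add: taped_def fun_upd_idem\<close>)
  have 2: "exc W tape_prog s (1 + (NT * L * 7 + 1) + 1) (bind_pmf (return_pmf (taped s [])) (\<lambda>_. map_pmf (taped s) (tape (NT * L))))"
    unfolding tape_prog_def
    by (rule exc_Seq[OF 1]) (use exc_tape_loop[OF assms, of "[]" "NT * L"] in simp)
  show ?thesis using exc_mono[OF 2, of "NT * L * 7 + 3"] by (simp add: bind_return_pmf)
qed

lemma ok_points_prog:
  assumes s: "glob s" "inp s = xs" "rout s = []"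
    and Q: "\<And>u. agr 10 s u \<Longrightarrow> imem u = imem s \<Longrightarrow> iout u = iout s \<Longrightarrow> rout u = xs \<Longrightarrow> Q u"
  shows "ok W points_prog (n * d * (4 + 4) + 3) s Q"
  unfolding points_prog_def
proof (rule ok_for[where I = "\<lambda>i t. imem t = imem s \<and> iout t = iout s \<and> rout t = take i xs"])
  note g = globD[OF s(1)]
  show "ireg s 2 = 1" "ireg s 7 = int (n * d)" using g by simp_all
  have "0 \<le> int (n * d)" by simp
  then show "int (n * d) \<le> W" using W_bounds(5) by linarith
  show "Q u" if "agr 10 s u" "imem u = imem s \<and> iout u = iout s \<and> rout u = take (n * d) xs" for u
    using that xs(1) by (intro Q) auto
  fix i t assume t: "i < n * d" "agr 10 s t" "ireg t 10 = int i" "imem t = imem s \<and> iout t = iout s \<and> rout t = take i xs"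
  have "inp t = xs" using t(2) s(2) by (simp add: agr_def)
  then show "ok W (blk [RInput 11 10, REmit 11]) 4 t (\<lambda>u. agr (Suc 10) t u \<and>
      imem (u\<lparr>ireg := (ireg u)(10 := int (Suc i))\<rparr>) = imem s \<and>
      iout (u\<lparr>ireg := (ireg u)(10 := int (Suc i))\<rparr>) = iout s \<and>
      rout (u\<lparr>ireg := (ireg u)(10 := int (Suc i))\<rparr>) = take (Suc i) xs)"
    by (intro ok_wp) (use t xs(1) in \<open>simp_all add: agr_def take_Suc_conv_app_nth\<close>)
qed (use s in auto)

definition t_build :: nat where
  "t_build = NT * L * 7 + 3 + (n * d * 8 + 3 + (NT * L * (t_level + 4) + 3) + 1) + 1"

definition mem_of :: "nat list \<Rightarrow> words" where
  "mem_of vs = (concat (map (irec vs) [0..<NT * L * n]), xs @ map (trec vs) [0..<NT * L * n])"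

lemma tape_range: "vs \<in> set_pmf (tape k) \<Longrightarrow> length vs = k \<and> (\<forall>x<k. vs ! x < N)"
proof -
  have "{..<N} \<noteq> {}" using N_pos by auto
  then show "vs \<in> set_pmf (tape k) \<Longrightarrow> length vs = k \<and> (\<forall>x<k. vs ! x < N)"
    by (auto simp: set_replicate_pmf in_lists_conv_set)
qed

text \<open>All randomness is on the tape; once it is drawn the run is deterministic, so the output
  is an image of the tape.\<close>

lemma exc_build_prog:
  assumes s: "glob s" "inp s = xs" "iout s = []" "rout s = []"
  shows "\<exists>h. exc W build_prog s t_build (map_pmf h (tape (NT * L))) \<and>
    (\<forall>vs\<in>set_pmf (tape (NT * L)). iout (h vs) = fst (mem_of vs) \<and> rout (h vs) = snd (mem_of vs))"
proof -
  let ?T = "n * d * 8 + 3 + (NT * L * (t_level + 4) + 3) + 1"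
  have "\<exists>u. exc W (Seq points_prog levels_prog) (taped s vs) ?T (return_pmf u) \<and>
      iout u = fst (mem_of vs) \<and> rout u = snd (mem_of vs)" if "vs \<in> set_pmf (tape (NT * L))" for vs
  proof -
    have vs: "length vs = NT * L" "\<And>x. x < NT * L \<Longrightarrow> vs ! x < N" using tape_range[OF that] by auto
    have a: "agr 10 s (taped s vs)" by (simp add: agr_def taped_def)
    have gt: "glob (taped s vs)" using glob_agr[OF a _ s(1)] by simp
    have "ok W (Seq points_prog levels_prog) ?T (taped s vs) (\<lambda>u. iout u = fst (mem_of vs) \<and> rout u = snd (mem_of vs))"
    proof (rule ok_Seq[OF ok_points_prog[OF gt]])
      fix u assume u: "agr 10 (taped s vs) u" "imem u = imem (taped s vs)" "iout u = iout (taped s vs)" "rout u = xs"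
      show "ok W levels_prog (NT * L * (t_level + 4) + 3) u (\<lambda>u. iout u = fst (mem_of vs) \<and> rout u = snd (mem_of vs))"
      proof (rule ok_levels_prog[OF vs])
        show "glob u" using glob_agr[OF u(1) _ gt] by simp
      qed (use u s vs(1) in \<open>auto simp: agr_def taped_def mem_of_def\<close>)
    qed (use s in \<open>auto simp: taped_def\<close>)
    then show ?thesis by (simp add: ok_def)
  qed
  then obtain h where h: "\<And>vs. vs \<in> set_pmf (tape (NT * L)) \<Longrightarrow>
      exc W (Seq points_prog levels_prog) (taped s vs) ?T (return_pmf (h vs)) \<and>
      iout (h vs) = fst (mem_of vs) \<and> rout (h vs) = snd (mem_of vs)"
    by metis
  \<comment> \<open>Recovers the tape from memory, so that the final state becomes a function of the
    intermediate one.\<close>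
  define untape where "untape t = map (\<lambda>x. nat (imem t x)) [0..<NT * L]" for t :: ram
  have untape: "untape (taped s vs) = vs" if "vs \<in> set_pmf (tape (NT * L))" for vs
    using tape_range[OF that] by (intro nth_equalityI) (auto simp: untape_def taped_def)
  have "exc W build_prog s t_build (bind_pmf (map_pmf (taped s) (tape (NT * L))) (\<lambda>t. return_pmf (h (untape t))))"
    unfolding build_prog_def t_build_def
  proof (rule exc_Seq[OF exc_tape_prog[OF s(1)]])
    fix t assume "t \<in> set_pmf (map_pmf (taped s) (tape (NT * L)))"
    then obtain vs where "vs \<in> set_pmf (tape (NT * L))" "t = taped s vs" by auto
    then show "exc W (Seq points_prog levels_prog) t ?T (return_pmf (h (untape t)))"
      using h[of vs] untape[of vs] by simp
  qed
  also have "bind_pmf (map_pmf (taped s) (tape (NT * L))) (\<lambda>t. return_pmf (h (untape t))) = map_pmf h (tape (NT * L))"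
    unfolding bind_map_pmf map_pmf_def[of h] using untape by (intro bind_pmf_cong refl) simp
  finally show ?thesis using h by blast
qed

end


section \<open>The query program\<close>

lemma nth_concat_quadruples:
  assumes "\<And>k. length (f k) = 4" "k < K" "i < 4"
  shows "concat (map f [0..<K]) ! (4 * k + i) = f k ! i" "4 * k + i < length (concat (map f [0..<K]))"
proof -
  have len: "length (concat (map f [0..<K])) = 4 * K" for K
    by (induction K) (simp_all add: assms(1))
  show "4 * k + i < length (concat (map f [0..<K]))"
    unfolding len using assms(2,3) by linarith
  show "concat (map f [0..<K]) ! (4 * k + i) = f k ! i"
    using assms(2)
  proof (induction K)
    case (Suc K)
    show ?case
    proof (cases "k = K")
      case True
      then show ?thesis using len[of K] by (simp add: nth_append)
    next
      case False
      then have "k < K" using Suc.prems by simp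
      moreover from this have "4 * k + i < 4 * K" using assms(3) by linarith
      ultimately show ?thesis using Suc.IH len[of K] by (simp add: nth_append)
    qed
  qed simp
qed

context nns_program
begin

definition t_search :: nat where "t_search = NT * L * (d * 20 + 74) + 3 + (d * 10 + 30) + 10"

context
  fixes vs :: "nat list" and qs :: "real list"
  assumes qs: "length qs = d"
begin

definition loaded :: "ram \<Rightarrow> bool" where
  "loaded s \<longleftrightarrow> inp s = qs \<and>
     (\<forall>k<NT * L * n. \<forall>i<4. imem s (4 * k + i) = irec vs k ! i) \<and>
     (\<forall>i<n. \<forall>j<d. rmem s (i * d + j) = X i j) \<and>
     (\<forall>k<NT * L * n. rmem s (n * d + k) = trec vs k)"

lemma loaded_agr: "loaded s \<Longrightarrow> agr K s t \<Longrightarrow> same_mem s t \<Longrightarrow> loaded t"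
  by (simp add: loaded_def agr_def same_mem_def)

text \<open>The program does not distinguish balls from cuts: it tests the representative and
  otherwise follows the stored cut. At a ball both children are the remainder, so the outcome of the
  comparison does not matter there.\<close>

lemma ok_visit_prog:
  assumes s: "glob s" "loaded s" "g < NT * L" "a < n" "ireg s 13 = int (g * n + a)"
    and ab: "ab' = qstep (\<lambda>j. qs ! j) (cls (glam L vs g) (int a)) (vs ! g) (int a, b)"
    and Q: "\<And>u. agr 10 s u \<Longrightarrow> same_mem s u \<Longrightarrow>
      ireg u 10 = (if dst (\<lambda>j. qs ! j) (X (rep (cls (glam L vs g) (int a)))) \<le> thr4 then snd ab' else ireg s 10) \<Longrightarrow>
      ireg u 13 = enc (Suc g * n) (fst ab') \<Longrightarrow> Q u"
  shows "ok W visit_prog (d * 20 + 50) s Q"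
proof -
  define k where "k = g * n + a"
  define S where "S = cls (glam L vs g) (int a)"
  define v where "v = vs ! g"
  define q where "q j = qs ! j" for j
  have ka: "k div n = g" "k mod n = a" using s(4) by (simp_all add: k_def)
  have no: "node_of vs k = S" by (simp only: node_of_def ka S_def)
  have kK: "k < NT * L * n"
  proof -
    have "Suc g * n \<le> NT * L * n" using s(3) by (intro mult_right_mono) auto
    then show ?thesis using s(4) by (simp add: k_def)
  qed
  have nb: "Suc g * n \<le> NT * L * n" using s(3) by (intro mult_right_mono) auto
  have L4: "imem s (4 * k + i) = irec vs k ! i" if "i < 4" for i
    using s(2) kK that by (simp add: loaded_def)
  have iv: "imem s (4 * k) = int (rep S)" "imem s (4 * k + 1) = int (coord S v)"
    "imem s (4 * k + 2) = enc (Suc g * n) (chL S v)" "imem s (4 * k + 3) = enc (Suc g * n) (pR S v)"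
    using L4[of 0] L4[of 1] L4[of 2] L4[of 3] by (simp_all add: irec_def no v_def ka)
  have rv: "rmem s (n * d + k) = thr S v" using s(2) kK by (simp add: loaded_def trec_def no v_def ka)
  have kW: "4 * int k + 4 \<le> W"
  proof -
    have "int k \<le> int (NT * L * n)" using kK by linarith
    then show ?thesis using W_bounds(10) by linarith
  qed
  have nat4: "nat (4 * int k) = 4 * k" "nat (1 + 4 * int k) = 4 * k + 1" "nat (4 * int k + 1) = 4 * k + 1"
    "nat (2 + 4 * int k) = 4 * k + 2" "nat (4 * int k + 2) = 4 * k + 2" "nat (3 + 4 * int k) = 4 * k + 3" "nat (4 * int k + 3) = 4 * k + 3"
    by simp_all
  have chl: "\<bar>enc (Suc g * n) (chL S v)\<bar> \<le> W" "\<bar>enc (Suc g * n) (pR S v)\<bar> \<le> W"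
    using enc_W[OF nb] pL_less[of S v] pR_less[of S v] pL_ge[of S v] pR_ge[of S v]
    unfolding chL_def by auto
  have repW: "int (rep S) \<le> W" using rep_less[of S] W_bounds(3) by linarith
  have dW: "int (coord S v) \<le> W" using coord_less[of S v] W_bounds(8) by linarith
  note g = globD[OF s(1)]
  let ?s = "s\<lparr>ireg := (ireg s)(17 := 4 * int k, 18 := int (rep S)), rreg := (rreg s)(22 := 0)\<rparr>"
  let ?e = "Cond (RLess 4 22)
         (Seq (blk [IOp IPlus 17 17 2, ILoad 23 17, RInput 23 23, IOp IPlus 24 7 13, RLoad 24 24, IOp IPlus 17 17 2])
           (Cond (RLess 24 23) (blk [IOp IPlus 17 17 2, ILoad 13 17]) (Do (ILoad 13 17))))
         (blk [IOp ITimes 10 18 2, IConst 13 (- 1)])"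
  have as: "agr 17 s ?s" "same_mem s ?s" by (simp_all add: agr_def same_mem_def)
  have gs: "glob ?s" using glob_agr[OF as(1) _ s(1)] by simp
  have "ok W (Seq (upto_loop 19 1 qdist_body) ?e) ((d * (14 + 4) + 3) + 24 + 1) ?s Q"
  proof (rule ok_Seq[OF ok_pure_loop[where I = "\<lambda>j t. rreg t 22 = (\<Sum>l<j. (q l - X (rep S) l) powr p)"] order_refl])
    show "ireg ?s 2 = 1" "ireg ?s 1 = int d" "int d \<le> W" using g W_bounds(8) by auto
    fix j t assume t: "j < d" "agr 19 ?s t" "same_mem ?s t" "ireg t 19 = int j"
      "rreg t 22 = (\<Sum>l<j. (q l - X (rep S) l) powr p)"
    have R: "ireg t 18 = int (rep S)" "ireg t (Suc 0) = int d" "rreg t 2 = p" "inp t = qs"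
      "rmem t (rep S * d + j) = X (rep S) j"
      using t g s(2) rep_less[of S] by (simp_all add: agr_def same_mem_def loaded_def)
    show "ok W qdist_body 14 t (\<lambda>u. agr (Suc 19) t u \<and> same_mem t u \<and> rreg u 22 = (\<Sum>l<Suc j. (q l - X (rep S) l) powr p))"
      unfolding qdist_body_def
      by (rule ok_wp) (use R t qs idx_W(1)[OF rep_less[of S] t(1)] idx_W(2)[OF rep_less[of S]] in
        \<open>simp_all add: nat_idx q_def\<close>, simp_all add: agr_def same_mem_def)
  next
    fix u assume u: "agr 19 ?s u" "same_mem ?s u" "rreg u 22 = (\<Sum>l<d. (q l - X (rep S) l) powr p)"
    have gu: "glob u" using glob_agr[OF u(1) _ gs] by simp
    have D: "rreg u 22 = dst q (X (rep S))" using u(3) by (simp add: dst_def)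
    have R: "ireg u 17 = 4 * int k" "ireg u 18 = int (rep S)" "ireg u 13 = int k" "inp u = qs"
      "imem u (4 * k + 1) = int (coord S v)" "imem u (4 * k + 2) = enc (Suc g * n) (chL S v)"
      "imem u (4 * k + 3) = enc (Suc g * n) (pR S v)" "rmem u (n * d + k) = thr S v"
      using u s(2,5) iv rv by (simp_all add: agr_def same_mem_def loaded_def k_def)
    have ndk: "nat (int n * int d + int k) = n * d + k" by (metis nat_int of_nat_add of_nat_mult)
    have ndW: "int n * int d + int k \<le> W"
    proof -
      have "int (n * d) + int k \<le> W"
        using W[unfolded of_nat_add] kK by linarith
      then show ?thesis by simp
    qed
    have fin: "agr 10 s u'" if "agr 10 u u'" for u' using u(1) that by (simp add: agr_def)
    have fin2: "same_mem s u'" if "same_mem u u'" for u' using u(2) that by (simp add: same_mem_def)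
    have r10: "ireg u 10 = ireg s 10" using u(1) by (simp add: agr_def)
    have qq: "(!) qs = q" by (simp add: q_def fun_eq_iff)
    have abq: "ab' = qstep q S v (int a, b)" using ab by (simp add: qq S_def v_def)
    have ab1: "dst q (X (rep S)) \<le> thr4 \<Longrightarrow> ab' = (- 1, int (rep S))"
      and ab2: "\<not> dst q (X (rep S)) \<le> thr4 \<Longrightarrow> fst ab' = (if cut S v q then chL S v else pR S v)"
      using abq by (simp_all add: qstep_def)
    have ct: "cut S v q \<longleftrightarrow> \<not> thr S v < q (coord S v)" by (auto simp: cut_def)
    have Q': "Q u'" if "agr 10 u u'" "same_mem u u'"
      "ireg u' 10 = (if dst q (X (rep S)) \<le> thr4 then int (rep S) else ireg s 10)"
      "ireg u' 13 = enc (Suc g * n) (if dst q (X (rep S)) \<le> thr4 then - 1 else if thr S v < q (coord S v) then pR S v else chL S v)" for u'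
      using that fin fin2 ab1 ab2 ct by (intro Q) (simp_all add: qq S_def[symmetric])
    show "ok W ?e 24 u Q"
    proof (rule ok_wp)
      show "wp W ?e Q u"
        using R qs coord_less[of S v] kW dW chl repW W_bounds(1) ndW
        by (simp add: globD[OF gu] D r10 nat4 ndk q_def[symmetric])
          (auto intro!: Q' simp: agr_def same_mem_def r10 enc_def q_def)
    qed simp
  qed (use g in auto)
  then show ?thesis
    unfolding visit_prog_def
    by (intro ok_Seq[OF ok_wp[OF _ order_refl]])
      (use s(5) kW iv repW in \<open>simp add: g k_def[symmetric] nat4\<close>, simp)
qed

definition qinv :: "nat \<Rightarrow> ram \<Rightarrow> bool" where
  "qinv g t \<longleftrightarrow> ireg t 10 = snd (uq L vs (\<lambda>j. qs ! j) g) \<and> ireg t 13 = enc (g * n) (fst (uq L vs (\<lambda>j. qs ! j) g))"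

lemma qstep_range:
  "fst ab = - 1 \<or> 0 \<le> fst ab \<Longrightarrow> fst (qstep q S v ab) = - 1 \<or> (\<exists>j<n. fst (qstep q S v ab) = int j)"
  using pL_cases[of S v] pR_cases[of S v] by (auto simp: qstep_def chL_def)

lemma uq_range: "fst (uq L vs q g) = - 1 \<or> (\<exists>j<n. fst (uq L vs q g) = int j)"
proof (induction g)
  case (Suc g)
  then have "fst (if g mod L = 0 then (0, snd (uq L vs q g)) else uq L vs q g) = - 1 \<or>
      0 \<le> fst (if g mod L = 0 then (0, snd (uq L vs q g)) else uq L vs q g)"
    by auto
  from qstep_range[OF this] show ?case unfolding uq.simps Let_def by blast
qed simp

lemma ok_query_body:
  assumes s: "glob s" "loaded s" "g < NT * L" "ireg s 9 = int g" "qinv g s"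
  shows "ok W query_body (d * 20 + 70) s (\<lambda>u. agr 10 s u \<and> same_mem s u \<and> qinv (Suc g) u)"
proof -
  note gg = globD[OF s(1)]
  define q where "q = (\<lambda>j. qs ! j)"
  define st where "st = uq L vs q g"
  define ab where "ab = (if g mod L = 0 then (0, snd st) else st)"
  define S where "S = cls (glam L vs g) (fst ab)"
  have U: "uq L vs q (Suc g) = qstep q S (vs ! g) ab"
    by (simp add: Let_def ab_def S_def st_def)
  let ?P = "\<lambda>u. agr 10 s u \<and> same_mem s u \<and> qinv (Suc g) u"
  have st: "ireg s 10 = snd st" "ireg s 13 = enc (g * n) (fst st)" using s(5) by (simp_all add: qinv_def st_def q_def)
  have abr: "fst ab = - 1 \<or> (\<exists>a<n. fst ab = int a)"
    using uq_range[of q g] n by (auto simp: ab_def st_def)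
  have gW: "int g \<le> W" "int g * int n \<le> W" "int g mod int L \<le> W"
  proof -
    have "g * n \<le> NT * L * n" using s(3) by (intro mult_right_mono) auto
    then have "int (g * n) \<le> int (NT * L * n)" "int g \<le> int (NT * L)" using s(3) by linarith+
    moreover have "int g mod int L \<le> int g" by (simp add: zmod_le_nonneg_dividend)
    ultimately show "int g \<le> W" "int g * int n \<le> W" "int g mod int L \<le> W" using W_bounds(6,7) by simp_all
  qed
  define t where "t = s\<lparr>ireg := (ireg s)(17 := int (g mod L), 15 := 0, 13 := enc (g * n) (fst ab))\<rparr>"
  have at: "agr 13 s t" "same_mem s t" by (simp_all add: t_def agr_def same_mem_def)
  have gt: "glob t" using glob_agr[OF at(1) _ s(1)] by simp
  have V: "ok W (Cond (ILess 13 15) SKIP visit_prog) (d * 20 + 51) t ?P"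
  proof (rule ok_Cond)
    show "ok W SKIP (d * 20 + 50) t ?P" if "test_sem (ILess 13 15) t"
    proof (rule ok_SKIP)
      have "fst ab < 0" using that by (auto simp: t_def enc_def split: if_splits)
      then have a1: "fst ab = - 1" using abr by auto
      \<comment> \<open>A tree starts at node 0, so a negative node means that no restart takes
        place at this level.\<close>
      then have "ab = st" by (auto simp: ab_def split: if_splits)
      moreover have "uq L vs q (Suc g) = ab" unfolding U using a1 by (simp add: qstep_def)
      ultimately have "qinv (Suc g) t"
        using st(1) a1 unfolding qinv_def q_def[symmetric] by (simp add: t_def enc_def)
      then show "?P t" using at by (simp add: agr_def)
    qed
    show "ok W visit_prog (d * 20 + 50) t ?P" if "\<not> test_sem (ILess 13 15) t"
    proof -
      have "\<not> fst ab < 0" using that by (auto simp: t_def enc_def)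
      then obtain a where a: "a < n" "fst ab = int a" using abr by auto
      have ab: "ab = (int a, snd st)"
        by (rule prod_eqI) (use a in \<open>auto simp: ab_def\<close>)
      have S: "S = cls (glam L vs g) (int a)" by (simp add: S_def a)
      have Ua: "uq L vs q (Suc g) = qstep (\<lambda>j. qs ! j) (cls (glam L vs g) (int a)) (vs ! g) (int a, snd st)"
        unfolding U S ab by (simp add: q_def)
      show ?thesis
      proof (rule ok_visit_prog[OF gt _ s(3) a(1) _ Ua])
        show "loaded t" using loaded_agr[OF s(2) at] .
        show "ireg t 13 = int (g * n + a)" by (simp add: t_def enc_def a)
        fix u assume u: "agr 10 t u" "same_mem t u"
          "ireg u 10 = (if dst (\<lambda>j. qs ! j) (X (rep (cls (glam L vs g) (int a)))) \<le> thr4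
              then snd (uq L vs q (Suc g)) else ireg t 10)"
          "ireg u 13 = enc (Suc g * n) (fst (uq L vs q (Suc g)))"
        have "agr 10 s u" using u(1) at(1) by (simp add: agr_def)
        moreover have "same_mem s u" using u(2) at(2) by (simp add: same_mem_def)
        moreover have "qinv (Suc g) u"
          using u(3,4) st(1) unfolding qinv_def q_def[symmetric] Ua by (auto simp: t_def qstep_def q_def)
        ultimately show "?P u" by blast
      qed
    qed
  qed simp
  have C: "ok W (Seq (Cond (ILess 17 2) (Do (IOp ITimes 13 9 0)) SKIP) (Cond (ILess 13 15) SKIP visit_prog))
      (d * 20 + 60) (s\<lparr>ireg := (ireg s)(17 := int (g mod L), 15 := 0)\<rparr>) ?P"
  proof (rule ok_Seq[OF ok_wp[OF _ order_refl]])
    have "g mod L = 0 \<Longrightarrow> s\<lparr>ireg := (ireg s)(17 := int (g mod L), 15 := 0, 13 := int g * int n)\<rparr> = t"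
      "g mod L \<noteq> 0 \<Longrightarrow> s\<lparr>ireg := (ireg s)(17 := int (g mod L), 15 := 0)\<rparr> = t"
      using st(2) by (simp_all add: t_def ab_def enc_def fun_eq_iff)
    then show "wp W (Cond (ILess 17 2) (Do (IOp ITimes 13 9 0)) SKIP)
       (\<lambda>t. ok W (Cond (ILess 13 15) SKIP visit_prog) (d * 20 + 51) t ?P)
       (s\<lparr>ireg := (ireg s)(17 := int (g mod L), 15 := 0)\<rparr>)"
      using V gg s(4) gW by (cases "g mod L = 0") (auto simp: t_def)
  qed simp
  have "wp W (blk [IOp IMod 17 9 3, IConst 15 0])
      (\<lambda>t. ok W (Seq (Cond (ILess 17 2) (Do (IOp ITimes 13 9 0)) SKIP) (Cond (ILess 13 15) SKIP visit_prog))
        (d * 20 + 60) t ?P) s"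
    using C s(4) gW W_bounds(1) LN by (simp add: gg zmod_int)
  then show ?thesis unfolding query_body_def
    by (rule ok_Seq[OF ok_wp[OF _ order_refl]]) simp
qed

definition answer :: "real list" where
  "answer = (let b = snd (uq L vs (\<lambda>j. qs ! j) (NT * L)) in if b < 0 then [] else map (X (nat b)) [0..<d])"

lemma ok_answer_prog:
  assumes s: "glob s" "loaded s" "ireg s 10 = snd (uq L vs (\<lambda>j. qs ! j) (NT * L))" "rout s = []"
  shows "ok W answer_prog (d * 10 + 30) s (\<lambda>u. iout u = iout s \<and> rout u = answer)"
proof -
  note g = globD[OF s(1)]
  define b where "b = snd (uq L vs (\<lambda>j. qs ! j) (NT * L))"
  let ?s = "s\<lparr>ireg := (ireg s)(15 := 0)\<rparr>"
  let ?P = "\<lambda>u. iout u = iout s \<and> rout u = answer"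
  let ?l = "upto_loop 12 1 (blk [IOp IPlus 13 11 12, RLoad 13 13, REmit 13])"
  have "ok W (Cond (ILess 10 15) SKIP (Seq (Do (IOp ITimes 11 10 1)) ?l)) (d * (6 + 4) + 3 + 3) ?s ?P"
  proof (rule ok_Cond)
    show "ok W SKIP (d * (6 + 4) + 3 + 2) ?s ?P" if "test_sem (ILess 10 15) ?s"
      using that s by (intro ok_SKIP) (simp add: answer_def)
    show "ok W (Seq (Do (IOp ITimes 11 10 1)) ?l) (d * (6 + 4) + 3 + 2) ?s ?P" if "\<not> test_sem (ILess 10 15) ?s"
    proof -
      have b0: "0 \<le> b" using that s(3) by (simp add: b_def)
      then have bn: "nat b < n" using uq_found[of L vs "\<lambda>j. qs ! j" "NT * L"] by (simp add: b_def)
      let ?t = "?s\<lparr>ireg := (ireg ?s)(11 := b * int d)\<rparr>"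
      have "ok W ?l (d * (6 + 4) + 3) ?t ?P"
      proof (rule ok_for[where I = "\<lambda>j t. iout t = iout s \<and> rout t = map (X (nat b)) [0..<j] \<and> rmem t = rmem s"])
        show "ireg ?t 2 = 1" "ireg ?t 1 = int d" "int d \<le> W" using g W_bounds(8) by auto
        show "?P u" if "iout u = iout s \<and> rout u = map (X (nat b)) [0..<d] \<and> rmem u = rmem s" for u
          using that b0 by (simp add: answer_def b_def[symmetric] Let_def)
        fix j t assume t: "j < d" "agr 12 ?t t" "ireg t 12 = int j"
          "iout t = iout s \<and> rout t = map (X (nat b)) [0..<j] \<and> rmem t = rmem s"
        have "ireg t 11 = int (nat b) * int d" using t(2) b0 by (simp add: agr_def)
        moreover have "rmem s (nat b * d + j) = X (nat b) j" using s(2) bn t(1) by (simp add: loaded_def)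
        ultimately show "ok W (blk [IOp IPlus 13 11 12, RLoad 13 13, REmit 13]) 6 t (\<lambda>u. agr (Suc 12) t u \<and>
            iout (u\<lparr>ireg := (ireg u)(12 := int (Suc j))\<rparr>) = iout s \<and>
            rout (u\<lparr>ireg := (ireg u)(12 := int (Suc j))\<rparr>) = map (X (nat b)) [0..<Suc j] \<and>
            rmem (u\<lparr>ireg := (ireg u)(12 := int (Suc j))\<rparr>) = rmem s)"
          by (intro ok_wp) (use t(3,4) idx_W(1)[OF bn t(1)] in
            \<open>simp_all add: nat_idx agr_def del: int_nat_eq\<close>)
      qed (use s(4) in simp_all)
      then show ?thesis
        by (intro ok_Seq[OF ok_wp[OF _ order_refl]])
          (use s(3) g idx_W(2)[OF bn] b0 in \<open>simp add: b_def\<close>, simp)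
    qed
  qed simp
  then show ?thesis unfolding answer_prog_def
    by (intro ok_Seq[OF ok_wp[OF _ order_refl]]) (use W_bounds(1) in simp, simp)
qed

lemma ok_search_prog:
  assumes s: "glob s" "loaded s" "rout s = []"
  shows "ok W search_prog t_search s (\<lambda>u. iout u = iout s \<and> rout u = answer)"
proof -
  note g = globD[OF s(1)]
  let ?P = "\<lambda>u. iout u = iout s \<and> rout u = answer"
  let ?s = "s\<lparr>ireg := (ireg s)(10 := - 1, 13 := - 1)\<rparr>"
  have as: "agr 10 s ?s" "same_mem s ?s" by (simp_all add: agr_def same_mem_def)
  have gs: "glob ?s" using glob_agr[OF as(1) _ s(1)] by simp
  have ls: "loaded ?s" using loaded_agr[OF s(2) as] .
  have "ok W (Seq (upto_loop 9 5 query_body) answer_prog) (NT * L * ((d * 20 + 70) + 4) + 3 + (d * 10 + 30) + 1) ?s ?P"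
  proof (rule ok_Seq[OF ok_pure_loop[where I = qinv]])
    show "ireg ?s 2 = 1" "ireg ?s 5 = int (NT * L)" using g by simp_all
    show "int (NT * L) \<le> W" using W_bounds(7) by linarith
    show "qinv 0 ?s" by (simp add: qinv_def enc_def)
    show "qinv i (t\<lparr>ireg := (ireg t)(9 := x)\<rparr>) = qinv i t" for i t x by (simp add: qinv_def)
    fix i t assume t: "i < NT * L" "agr 9 ?s t" "same_mem ?s t" "ireg t 9 = int i" "qinv i t"
    show "ok W query_body (d * 20 + 70) t (\<lambda>u. agr (Suc 9) t u \<and> same_mem t u \<and> qinv (Suc i) u)"
      using ok_query_body[OF glob_agr[OF t(2) _ gs] loaded_agr[OF ls t(2,3)] t(1,4,5)] by simp
  next
    fix u assume u: "agr 9 ?s u" "same_mem ?s u" "qinv (NT * L) u"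
    have "ok W answer_prog (d * 10 + 30) u (\<lambda>w. iout w = iout u \<and> rout w = answer)"
      using u s(3) by (intro ok_answer_prog glob_agr[OF u(1) _ gs] loaded_agr[OF ls u(1,2)])
        (simp_all add: qinv_def same_mem_def)
    then show "ok W answer_prog (d * 10 + 30) u ?P"
      using u(2) by (simp add: same_mem_def)
  qed simp_all
  then show ?thesis unfolding search_prog_def t_search_def
    by (intro ok_Seq[OF ok_wp[OF _ order_refl]]) (use W_bounds(1) in simp, simp add: algebra_simps)
qed

lemma loaded_init:
  assumes "imem s = (\<lambda>k. if k < length (fst (mem_of vs)) then fst (mem_of vs) ! k else 0)"
    "rmem s = (\<lambda>k. if k < length (snd (mem_of vs)) then snd (mem_of vs) ! k else 0)" "inp s = qs"
  shows "loaded s"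
  unfolding loaded_def
proof (intro conjI allI impI)
  have 4: "length (irec vs k) = 4" for k by (simp add: irec_def)
  show "imem s (4 * k + i) = irec vs k ! i" if "k < NT * L * n" "i < 4" for k i
    using nth_concat_quadruples[of "irec vs", OF 4 that] by (simp add: assms(1) mem_of_def)
  show "rmem s (i * d + j) = X i j" if "i < n" "j < d" for i j
    using idx[OF that] xs_nth[of i j] by (simp add: assms(2) mem_of_def nth_append xs(1))
  show "rmem s (n * d + k) = trec vs k" if "k < NT * L * n" for k
    using that by (simp add: assms(2) mem_of_def nth_append xs(1))
qed (rule assms(3))

end

end


section \<open>Computing the parameters\<close>

text \<open>The bit length of \<open>n\<close>. Each bit is worth \<open>8 * d\<close> levels, as
  that many cuts at least halve a node.\<close>

definition levels_per_bit :: "nat \<Rightarrow> nat" where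
  "levels_per_bit n = (LEAST l. n < 2 ^ l)"

definition num_trees :: "nat \<Rightarrow> real \<Rightarrow> nat" where
  "num_trees n \<epsilon> = nat \<lceil>3 * real n powr \<epsilon>\<rceil>"

lemma levels_per_bit: "n < 2 ^ levels_per_bit n" "l < levels_per_bit n \<Longrightarrow> 2 ^ l \<le> n"
  "levels_per_bit n \<le> n"
proof -
  have n: "n < 2 ^ n" by (rule less_exp)
  show "n < 2 ^ levels_per_bit n" unfolding levels_per_bit_def using n by (rule LeastI)
  show "2 ^ l \<le> n" if "l < levels_per_bit n"
    using not_less_Least[of l "\<lambda>l. n < 2 ^ l"] that by (simp add: levels_per_bit_def)
  show "levels_per_bit n \<le> n" unfolding levels_per_bit_def using n by (rule Least_le)
qed

lemma levels_per_bit_pos: "1 \<le> n \<Longrightarrow> 1 \<le> levels_per_bit n"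
  using levels_per_bit(1)[of n] by (cases "levels_per_bit n") auto

text \<open>By \<open>ln 2 \<ge> 2 / 3\<close>, both the length minus 1 and the remaining 1 are at
  most \<open>3 / 2 * ln n\<close>, the latter because \<open>n \<ge> 2\<close>.\<close>

lemma levels_per_bit_le_ln:
  assumes "2 \<le> n"
  shows "real (levels_per_bit n) \<le> 3 * ln (real n)"
proof -
  have l2: "2 / 3 \<le> ln (2 :: real)" by (rule ln2_ge_two_thirds)
  have ln_n: "ln 2 \<le> ln (real n)" using assms by simp
  obtain l where l: "levels_per_bit n = Suc l"
    using levels_per_bit_pos[of n] assms by (cases "levels_per_bit n") auto
  have "2 ^ l \<le> n" using levels_per_bit(2)[of l n] l by simp
  then have "real (2 ^ l) \<le> real n" by (rule of_nat_mono)
  then have "ln (2 ^ l) \<le> ln (real n)" using assms by (subst ln_le_cancel_iff) auto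
  then have "real l * ln 2 \<le> ln (real n)" by (simp add: ln_realpow)
  moreover have "real l * (2 / 3) \<le> real l * ln 2" using l2 by (intro mult_left_mono) auto
  ultimately have "real l * (2 / 3) \<le> ln (real n)" by linarith
  then show ?thesis using l l2 ln_n by simp
qed

text \<open>Since \<open>n powr \<epsilon> \<ge> 1\<close>, rounding up is absorbed by passing from
  3 to 4. The last bound keeps the counting loop of \<open>params_prog\<close> running.\<close>

lemma num_trees_bounds:
  assumes "1 \<le> n" "0 < \<epsilon>" "\<epsilon> \<le> 1"
  shows "3 * real n powr \<epsilon> \<le> real (num_trees n \<epsilon>)" "real (num_trees n \<epsilon>) \<le> 4 * real n powr \<epsilon>"
    "num_trees n \<epsilon> \<le> 3 * n" "1 \<le> num_trees n \<epsilon>"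
    "k < num_trees n \<epsilon> \<Longrightarrow> real k < 3 * real n powr \<epsilon>"
proof -
  have n1: "1 \<le> real n" using assms by simp
  have p1: "1 \<le> real n powr \<epsilon>" using n1 assms by (intro ge_one_powr_ge_zero) auto
  have pn: "real n powr \<epsilon> \<le> real n" using powr_mono[of \<epsilon> 1 "real n"] n1 assms by simp
  have c: "real (num_trees n \<epsilon>) = of_int \<lceil>3 * real n powr \<epsilon>\<rceil>"
    unfolding num_trees_def using p1 by (subst of_nat_nat) auto
  show 1: "3 * real n powr \<epsilon> \<le> real (num_trees n \<epsilon>)" unfolding c by (rule le_of_int_ceiling)
  show "real (num_trees n \<epsilon>) \<le> 4 * real n powr \<epsilon>"
    unfolding c using p1 of_int_ceiling_le_add_one[of "3 * real n powr \<epsilon>"] by linarith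
  have "\<lceil>3 * real n powr \<epsilon>\<rceil> \<le> int (3 * n)" unfolding ceiling_le_iff using pn by simp
  then show "num_trees n \<epsilon> \<le> 3 * n" unfolding num_trees_def by linarith
  have "0 < real (num_trees n \<epsilon>)" using 1 p1 by linarith
  then show "1 \<le> num_trees n \<epsilon>" by simp
  show "real k < 3 * real n powr \<epsilon>" if "k < num_trees n \<epsilon>"
    using that unfolding num_trees_def by (simp add: zless_nat_eq_int_zless less_ceiling_iff)
qed

locale nns_system = nns_program +
  assumes L: "L = 8 * d * levels_per_bit n" and NT: "NT = num_trees n \<epsilon>"
begin

definition t_params :: nat where "t_params = 30 + (levels_per_bit n * 6 + 1) + 22 + (NT * 6 + 1) + 12 + 4"

definition started :: "ram \<Rightarrow> ram \<Rightarrow> bool" where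
  "started s t \<longleftrightarrow> ireg t 0 = int n \<and> ireg t (Suc 0) = int d \<and> ireg t 2 = 1 \<and>
     rreg t 0 = \<epsilon> \<and> rreg t (Suc 0) = r \<and> rreg t 2 = p \<and> rreg t 3 = thr2 \<and> rreg t 4 = thr4 \<and>
     rreg t 5 = 1 / p \<and> rreg t 6 = 0 \<and> inp t = inp s \<and> same_mem s t"

lemma ok_params_prog:
  assumes s: "ireg s 0 = int n" "ireg s (Suc 0) = int d" "rreg s 0 = \<epsilon>" "rreg s (Suc 0) = r" "rreg s 2 = p"
  shows "ok W params_prog t_params s (\<lambda>u. glob u \<and> inp u = inp s \<and> same_mem s u)"
proof -
  let ?Q = "\<lambda>u. glob u \<and> inp u = inp s \<and> same_mem s u"
  let ?lg = "levels_per_bit n"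
  let ?l1 = "Loop (ILess 9 10) (blk [IOp IPlus 9 9 9, IOp IPlus 3 3 2])"
  let ?b2 = "blk [IConst 8 8, IOp ITimes 8 8 1, IOp ITimes 3 8 3,
       ROfInt 7 0, ROp RPowr 7 7 0, IConst 9 3, ROfInt 8 9, ROp RTimes 7 8 7, IConst 4 0, ROfInt 8 4, ROfInt 9 2]"
  let ?l2 = "Loop (RLess 8 7) (blk [IOp IPlus 4 4 2, ROp RPlus 8 8 9])"
  let ?b3 = "blk [IOp ITimes 5 4 3, IOp ITimes 7 0 1, IConst 9 6, IOp ITimes 6 9 0, IOp ITimes 6 6 0, IOp ITimes 6 6 1]"
  define I1 where "I1 = (\<lambda>l t. started s t \<and> ireg t 9 = 2 ^ l \<and> ireg t 3 = int l \<and> ireg t 10 = int n + 1)"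
  define I2 where "I2 = (\<lambda>k t. started s t \<and> ireg t 4 = int k \<and> rreg t 8 = real k \<and> rreg t 7 = 3 * real n powr \<epsilon> \<and>
    rreg t 9 = 1 \<and> ireg t 3 = int L \<and> ireg t 8 = int (8 * d))"
  have nW: "int n + 1 \<le> W" "500 \<le> W" "8 * int d \<le> W" using W_bounds(3,1,8) n by linarith+
  have LW: "int L \<le> W" "int NT \<le> W" "int (NT * L) \<le> W"
  proof -
    have "L \<le> NT * L" "NT \<le> NT * L" using LN by simp_all
    then have "int L \<le> int (NT * L)" "int NT \<le> int (NT * L)" by linarith+
    then show "int L \<le> W" "int NT \<le> W" "int (NT * L) \<le> W" using W_bounds(7) by linarith+
  qed
  have ndW: "int n * int d \<le> W" "6 * int n * int n * int d \<le> W" "6 * int n \<le> W" "6 * int n * int n \<le> W"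
  proof -
    have a: "6 * n * n \<le> 6 * n * n * d" "6 * n \<le> 6 * n * n" "n * d \<le> 6 * n * n * d" using n d by simp_all
    have "6 * n \<le> 6 * n * n * d" using order_trans[OF a(2,1)] .
    then have "int (n * d) \<le> W" "int (6 * n * n * d) \<le> W" "int (6 * n) \<le> W" "int (6 * n * n) \<le> W"
      using a W_bounds(4) by linarith+
    then show "int n * int d \<le> W" "6 * int n * int n * int d \<le> W" "6 * int n \<le> W" "6 * int n * int n \<le> W"
      by simp_all
  qed
  have E: "ok W ?b3 12 u ?Q" if "I2 NT u" for u
    by (rule ok_wp)
      (use that LW ndW nW in \<open>simp_all add: I2_def started_def glob_def N_def same_mem_def\<close>)
  have D: "ok W (Seq ?l2 ?b3) (NT * 6 + 1 + 12 + 1) u ?Q" if "I2 0 u" for u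
  proof (rule ok_Seq[OF ok_counted_loop[where I = I2 and K = NT and T = 4]])
    show "I2 0 u" by fact
    show "\<not> test_sem (RLess 8 7) t \<and> ok W ?b3 12 t ?Q" if "I2 NT t" for t
      using E[OF that] num_trees_bounds(1)[OF n eps] that by (simp add: I2_def NT[symmetric])
    show "test_sem (RLess 8 7) t \<and> ok W (blk [IOp IPlus 4 4 2, ROp RPlus 8 8 9]) 4 t (I2 (Suc k))"
      if "k < NT" "I2 k t" for k t
    proof
      show "test_sem (RLess 8 7) t" using that num_trees_bounds(5)[OF n eps, of k] by (simp add: I2_def NT)
      show "ok W (blk [IOp IPlus 4 4 2, ROp RPlus 8 8 9]) 4 t (I2 (Suc k))"
        by (rule ok_wp) (use that LW(2) in \<open>simp_all add: I2_def started_def same_mem_def\<close>)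
    qed
  qed simp
  have D': "I2 0 u \<Longrightarrow> ok W (Seq ?l2 ?b3) (NT * 6 + 14) u ?Q" for u
    by (rule ok_conseq[OF D]) simp_all
  have C: "ok W (Seq ?b2 (Seq ?l2 ?b3)) (22 + (NT * 6 + 14) + 1) u ?Q" if "I1 ?lg u" for u
  proof (rule ok_Seq[OF ok_wp[OF _ order_refl]])
    have "8 * int d * int ?lg \<le> W" using LW(1) by (simp add: L)
    then show "wp W ?b2 (\<lambda>u. ok W (Seq ?l2 ?b3) (NT * 6 + 14) u ?Q) u"
      using that nW D' by (simp add: I1_def I2_def started_def same_mem_def L)
  qed simp_all
  have B: "ok W (Seq ?l1 (Seq ?b2 (Seq ?l2 ?b3))) ((?lg * 6 + 1) + (22 + (NT * 6 + 14) + 1) + 1) u ?Q" if "I1 0 u" for u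
  proof (rule ok_Seq[OF ok_counted_loop[where I = I1 and K = ?lg and T = 4]])
    show "I1 0 u" by fact
    show "\<not> test_sem (ILess 9 10) t \<and> ok W (Seq ?b2 (Seq ?l2 ?b3)) (22 + (NT * 6 + 14) + 1) t ?Q" if "I1 ?lg t" for t
    proof -
      have "int n < int (2 ^ ?lg)" using levels_per_bit(1)[of n] by (simp only: of_nat_less_iff)
      then have "\<not> test_sem (ILess 9 10) t" using that unfolding I1_def by simp
      then show ?thesis using C[OF that] by blast
    qed
    show "test_sem (ILess 9 10) t \<and> ok W (blk [IOp IPlus 9 9 9, IOp IPlus 3 3 2]) 4 t (I1 (Suc k))"
      if "k < ?lg" "I1 k t" for k t
    proof -
      \<comment> \<open>The last doubling goes beyond \<open>n\<close> but not beyond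
        \<open>2 * n\<close>, so it still fits into a word.\<close>
      have "int (2 ^ k) \<le> int n" using levels_per_bit(2)[OF that(1)] by (simp only: of_nat_le_iff)
      then have "2 ^ k \<le> int n" by (simp only: of_nat_power of_nat_numeral)
      moreover have "k < n" using that(1) levels_per_bit(3)[of n] by linarith
      ultimately have "2 ^ k \<le> int n" "2 * 2 ^ k \<le> W" "int k + 1 \<le> W"
        using W_bounds(3) by linarith+
      then show ?thesis using that(2)
        by (intro conjI ok_wp) (simp_all add: I1_def started_def same_mem_def)
    qed
  qed simp_all
  have "I1 0 u \<Longrightarrow> ok W (Seq ?l1 (Seq ?b2 (Seq ?l2 ?b3))) (?lg * 6 + NT * 6 + 39) u ?Q" for u
    by (rule ok_conseq[OF B]) simp_all
  then have A: "wp W (blk [IConst 2 1, IConst 9 240, ROfInt 7 9, ROp RTimes 7 7 2, ROp RDivide 7 7 0, ROp RTimes 7 7 1,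
       ROp RPowr 3 7 2, ROp RPlus 8 7 7, ROp RPowr 4 8 2, ROfInt 7 2, ROp RDivide 5 7 2, ROp RMinus 6 7 7,
       IConst 3 0, IConst 9 1, IOp IPlus 10 0 2])
      (\<lambda>u. ok W (Seq ?l1 (Seq ?b2 (Seq ?l2 ?b3))) (?lg * 6 + NT * 6 + 39) u ?Q) s"
    using s nW by (simp add: I1_def started_def same_mem_def thr2_def thr4_def)
  show ?thesis unfolding params_prog_def t_params_def
    by (rule ok_Seq[OF ok_wp[OF A order_refl]]) simp
qed


lemma computes_pre_prog:
  "computes W pre_prog (init [int n, int d] [\<epsilon>, r, p] xs ([], [])) (t_params + t_build + 1)
     (map_pmf mem_of (tape (NT * L)))"
proof -
  let ?s = "init [int n, int d] [\<epsilon>, r, p] xs ([], [])"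
  have "ok W params_prog t_params ?s (\<lambda>u. glob u \<and> inp u = inp ?s \<and> same_mem ?s u)"
    by (rule ok_params_prog) (simp_all add: init_def)
  then obtain u where u: "exc W params_prog ?s t_params (return_pmf u)" "glob u" "inp u = inp ?s" "same_mem ?s u"
    unfolding ok_def by blast
  have "inp u = xs" "iout u = []" "rout u = []" using u by (simp_all add: init_def same_mem_def)
  then obtain h where h: "exc W build_prog u t_build (map_pmf h (tape (NT * L)))"
    "\<And>vs. vs \<in> set_pmf (tape (NT * L)) \<Longrightarrow> iout (h vs) = fst (mem_of vs) \<and> rout (h vs) = snd (mem_of vs)"
    using exc_build_prog[OF u(2)] by blast
  have "exc W pre_prog ?s (t_params + t_build + 1) (bind_pmf (return_pmf u) (\<lambda>_. map_pmf h (tape (NT * L))))"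
    unfolding pre_prog_def by (rule exc_Seq[OF u(1)]) (use h(1) in simp)
  then have "map_pmf result (run W (t_params + t_build + 1) pre_prog ?s) =
      map_pmf (\<lambda>vs. Some (iout (h vs), rout (h vs))) (tape (NT * L))"
    by (simp add: bind_return_pmf exc_def pmf.map_comp o_def)
  also have "\<dots> = map_pmf (\<lambda>vs. Some (mem_of vs)) (tape (NT * L))"
    using h(2) by (intro map_pmf_cong refl) simp
  finally show ?thesis by (simp add: computes_def pmf.map_comp o_def)
qed

lemma computes_qry_prog:
  assumes "length qs = d"
  shows "computes W qry_prog (init [int n, int d] [\<epsilon>, r, p] qs (mem_of vs)) (t_params + t_search + 1)
     (return_pmf ([], answer vs qs))"
proof -
  let ?s = "init [int n, int d] [\<epsilon>, r, p] qs (mem_of vs)"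
  have "ok W params_prog t_params ?s (\<lambda>u. glob u \<and> inp u = inp ?s \<and> same_mem ?s u)"
    by (rule ok_params_prog) (simp_all add: init_def)
  then obtain u where u: "exc W params_prog ?s t_params (return_pmf u)" "glob u" "inp u = inp ?s" "same_mem ?s u"
    unfolding ok_def by blast
  have "loaded vs qs u"
    using u by (intro loaded_init[OF assms]) (simp_all add: init_def same_mem_def)
  moreover have "rout u = []" "iout u = []" using u by (simp_all add: init_def same_mem_def)
  ultimately have "ok W search_prog t_search u (\<lambda>w. iout w = [] \<and> rout w = answer vs qs)"
    using ok_search_prog[OF assms u(2)] by simp
  then obtain w where w: "exc W search_prog u t_search (return_pmf w)" "iout w = []" "rout w = answer vs qs"
    unfolding ok_def by blast
  have "exc W qry_prog ?s (t_params + t_search + 1) (bind_pmf (return_pmf u) (\<lambda>_. return_pmf w))"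
    unfolding qry_prog_def by (rule exc_Seq[OF u(1)]) (use w(1) in simp)
  then show ?thesis using w(2,3) by (simp add: computes_def exc_def bind_return_pmf)
qed

text \<open>A block of \<open>8 * d\<close> levels contributes a factor of at most
  \<open>exp (- 1) \<le> 1 / 2\<close>, and there is one block per bit of \<open>n\<close>.\<close>

lemma many_levels: "real n * (1 - 1 / (8 * real d)) ^ L < 1"
proof -
  let ?m = "8 * d"
  have m: "1 \<le> real ?m" using d by simp
  have "1 - 1 / real ?m \<le> exp (- (1 / real ?m))" using exp_ge_add_one_self[of "- (1 / real ?m)"] by simp
  then have "(1 - 1 / real ?m) ^ ?m \<le> exp (- (1 / real ?m)) ^ ?m" using m by (intro power_mono) auto
  also have "\<dots> = exp (- 1)" using d by (simp add: exp_of_nat_mult[symmetric])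
  also have "\<dots> \<le> 1 / 2"
    using exp_ge_add_one_self[of 1] by (simp add: exp_minus field_simps)
  finally have "((1 - 1 / real ?m) ^ ?m) ^ levels_per_bit n \<le> (1 / 2) ^ levels_per_bit n"
    using m by (intro power_mono) auto
  then have "(1 - 1 / real ?m) ^ L \<le> (1 / 2) ^ levels_per_bit n"
    by (simp add: L power_mult)
  then have "real n * (1 - 1 / real ?m) ^ L \<le> real n * (1 / 2) ^ levels_per_bit n"
    by (intro mult_left_mono) auto
  also have "\<dots> < 1"
  proof -
    have "real n < real (2 ^ levels_per_bit n)" using levels_per_bit(1)[of n] by (simp only: of_nat_less_iff)
    then show ?thesis by (simp add: power_divide)
  qed
  finally show ?thesis by simp
qed

lemma success:
  assumes "i < n" "dst (X i) q \<le> r powr p"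
  shows "2 / 3 \<le> measure_pmf.prob (tape (NT * L)) {vs. 0 \<le> snd (uq L vs q (NT * L))}"
  using found_prob[OF assms LN(1) many_levels] num_trees_bounds(1)[OF n eps] by (simp add: NT)

end

section \<open>The data structure\<close>

lemma nth_concat_uniform:
  assumes "set ps \<subseteq> points d" "i < length ps" "j < d"
  shows "concat ps ! (i * d + j) = ps ! i ! j"
  using assms
proof (induction ps arbitrary: i)
  case (Cons x ps)
  have x: "length x = d" using Cons.prems(1) by (simp add: points_def)
  show ?case
  proof (cases i)
    case 0
    then show ?thesis using x Cons.prems(3) by (simp add: nth_append)
  next
    case (Suc i')
    then have "Suc i' * d + j = length x + (i' * d + j)" using x by simp
    then show ?thesis using Suc Cons by (simp only: concat.simps nth_append_length_plus) simp
  qed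
qed simp

lemma length_concat_uniform: "set ps \<subseteq> points d \<Longrightarrow> length (concat ps) = length ps * d"
  by (induction ps) (auto simp: points_def)

lemma lp_dist_le_iff:
  assumes "length x = d" "length y = d" "0 < p" "0 \<le> M"
  shows "lp_dist p x y \<le> M \<longleftrightarrow> (\<Sum>j<d. \<bar>x ! j - y ! j\<bar> powr p) \<le> M powr p"
proof -
  let ?s = "\<Sum>j<d. \<bar>x ! j - y ! j\<bar> powr p"
  have s: "0 \<le> ?s" by (intro sum_nonneg) auto
  have e: "lp_dist p x y = ?s powr (1 / p)"
    unfolding lp_dist_def lp_norm_def
    using assms by (intro arg_cong2[of _ _ _ _ "(powr)"] sum.cong) auto
  have s': "(?s powr (1 / p)) powr p = ?s" using s assms(3) by (simp add: powr_powr)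
  have M': "(M powr p) powr (1 / p) = M" using assms(3,4) by (simp add: powr_powr)
  show ?thesis unfolding e
  proof
    assume "?s powr (1 / p) \<le> M"
    then have "(?s powr (1 / p)) powr p \<le> M powr p" using assms(3) by (intro powr_mono2) auto
    then show "?s \<le> M powr p" unfolding s' .
  next
    assume "?s \<le> M powr p"
    then have "?s powr (1 / p) \<le> (M powr p) powr (1 / p)" using s assms(3) by (intro powr_mono2) auto
    then show "?s powr (1 / p) \<le> M" unfolding M' .
  qed
qed

lemma (in nns_system) data_structure:
  assumes ps: "length ps = n" "set ps \<subseteq> points d" "xs = concat ps"
  shows "lp_NNS_data_structure W pre_prog qry_prog \<epsilon> r p (480 * (p / \<epsilon>)) d ps (t_params + t_build + 1)
    (5 * (NT * L * n) + n * d) (t_params + t_search + 1)"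
proof -
  let ?D = "map_pmf mem_of (tape (NT * L))"
  let ?Tq = "t_params + t_search + 1"
  \<comment> \<open>The answer has to be a total function of memory and query; reading it off the
    run gives the right value on the memories that occur.\<close>
  define ans where "ans m q = map_pmf (the \<circ> result) (run W ?Tq qry_prog (init [int n, int d] [\<epsilon>, r, p] q m))" for m q
  have ans: "ans (mem_of vs) q = return_pmf ([], answer vs q)" if "length q = d" for vs q
  proof -
    have "ans (mem_of vs) q = map_pmf the (map_pmf result (run W ?Tq qry_prog (init [int n, int d] [\<epsilon>, r, p] q (mem_of vs))))"
      by (simp add: ans_def pmf.map_comp)
    then show ?thesis using computes_qry_prog[OF that, of vs] by (simp add: computes_def)
  qed
  have Xps: "X i j = ps ! i ! j" if "i < n" "j < d" for i j
    using nth_concat_uniform[OF ps(2), of i j] that ps(1,3) by (simp add: xs(2))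
  have len: "length (ps ! i) = d" if "i < n" for i
  proof -
    have "ps ! i \<in> set ps" using that ps(1) by simp
    then show ?thesis using ps(2) by (auto simp: points_def)
  qed
  have distX: "lp_dist p (ps ! i) q \<le> M \<longleftrightarrow> dst (X i) (\<lambda>j. q ! j) \<le> M powr p"
    if "i < n" "length q = d" "0 \<le> M" for i q M
  proof -
    have "dst (X i) (\<lambda>j. q ! j) = (\<Sum>j<d. \<bar>ps ! i ! j - q ! j\<bar> powr p)"
      unfolding dst_abs using that(1) by (intro sum.cong refl) (simp add: Xps)
    then show ?thesis using lp_dist_le_iff[of "ps ! i" d q p M] that p len by simp
  qed
  have solves: "2 / 3 \<le> measure_pmf.prob (bind_pmf ?D (\<lambda>m. map_pmf snd (ans m q)))
      {x \<in> set ps. lp_dist p x q \<le> 480 * (p / \<epsilon>) * r}"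
    if q: "length q = d" and x: "x \<in> set ps" "lp_dist p x q \<le> r" for q x
  proof -
    obtain i where i: "i < n" "x = ps ! i" using x(1) ps(1) by (metis in_set_conv_nth)
    have near: "dst (X i) (\<lambda>j. q ! j) \<le> r powr p" using distX[OF i(1) q] x(2) i(2) r by simp
    have A: "bind_pmf ?D (\<lambda>m. map_pmf snd (ans m q)) = map_pmf (\<lambda>vs. answer vs q) (tape (NT * L))"
      unfolding bind_map_pmf map_pmf_def[of "\<lambda>vs. answer vs q"]
      by (intro bind_pmf_cong refl) (simp add: ans[OF q])
    \<comment> \<open>\<open>thr4\<close> is taken at twice the radius
      \<open>240 * p / \<epsilon> * r\<close>: the approximation factor is
      \<open>4R / r\<close>.\<close>
    have c: "thr4 = (480 * (p / \<epsilon>) * r) powr p" by (simp add: thr4_def mult.assoc)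
    have c0: "0 \<le> 480 * (p / \<epsilon>) * r" using p eps r by simp
    have "{vs. 0 \<le> snd (uq L vs (\<lambda>j. q ! j) (NT * L))} \<subseteq>
        (\<lambda>vs. answer vs q) -` {x \<in> set ps. lp_dist p x q \<le> 480 * (p / \<epsilon>) * r}"
    proof
      fix vs assume "vs \<in> {vs. 0 \<le> snd (uq L vs (\<lambda>j. q ! j) (NT * L))}"
      then have b: "0 \<le> snd (uq L vs (\<lambda>j. q ! j) (NT * L))" by simp
      define k where "k = nat (snd (uq L vs (\<lambda>j. q ! j) (NT * L)))"
      have k: "k < n" "dst (\<lambda>j. q ! j) (X k) \<le> thr4" using uq_found[OF b] by (auto simp: k_def)
      have "answer vs q = map (X k) [0..<d]" using b by (simp add: answer_def[OF q] Let_def k_def)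
      also have "\<dots> = ps ! k" using k(1) len by (intro nth_equalityI) (auto simp: Xps)
      finally have a: "answer vs q = ps ! k" .
      have "lp_dist p (ps ! k) q \<le> 480 * (p / \<epsilon>) * r"
        using distX[OF k(1) q c0] k(2) c dst_commute[of "X k"] by simp
      then show "vs \<in> (\<lambda>vs. answer vs q) -` {x \<in> set ps. lp_dist p x q \<le> 480 * (p / \<epsilon>) * r}"
        using a k(1) ps(1) by simp
    qed
    then have "measure_pmf.prob (tape (NT * L)) {vs. 0 \<le> snd (uq L vs (\<lambda>j. q ! j) (NT * L))} \<le>
        measure_pmf.prob (tape (NT * L)) ((\<lambda>vs. answer vs q) -` {x \<in> set ps. lp_dist p x q \<le> 480 * (p / \<epsilon>) * r})"
      by (intro measure_pmf.finite_measure_mono) auto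
    then show ?thesis unfolding A using success[OF i(1) near] by simp
  qed
  have size: "length (fst (mem_of vs)) + length (snd (mem_of vs)) \<le> 5 * (NT * L * n) + n * d" for vs
  proof -
    have "length (concat (map (irec vs) [0..<k])) = 4 * k" for k
      by (induction k) (simp_all add: irec_def)
    then show ?thesis by (simp add: mem_of_def xs(1))
  qed
  show ?thesis
    unfolding lp_NNS_data_structure_def solves_NNS_def Let_def ps(1)
  proof (intro exI[of _ ?D] exI[of _ ans] conjI ballI impI)
    show "computes W pre_prog (init [int n, int d] [\<epsilon>, r, p] (concat ps) ([], [])) (t_params + t_build + 1) ?D"
      using computes_pre_prog unfolding ps(3) .
    show "length (fst m) + length (snd m) \<le> 5 * (NT * L * n) + n * d" if "m \<in> set_pmf ?D" for m
      using that size by auto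
    show "computes W qry_prog (init [int n, int d] [\<epsilon>, r, p] q m) ?Tq (ans m q)"
      if m: "m \<in> set_pmf ?D" and "q \<in> points d" for m q
    proof -
      have q: "length q = d" using that by (simp add: points_def)
      obtain vs where "m = mem_of vs" using m by auto
      then show ?thesis using computes_qry_prog[OF q, of vs] ans[OF q, of vs] by simp
    qed
    show "2 / 3 \<le> measure_pmf.prob (bind_pmf ?D (\<lambda>m. map_pmf snd (ans m q)))
      {x \<in> set ps. lp_dist p x q \<le> 480 * (p / \<epsilon>) * r}"
      if "q \<in> points d" "\<exists>x\<in>set ps. lp_dist p x q \<le> r" for q
      using that solves by (auto simp: points_def)
  qed
qed

section \<open>Resource bounds\<close>

text \<open>For \<open>n\<close> and \<open>d\<close> at least 1 a multiple of one power of
  \<open>n * d\<close> dominates any polynomial. The class is closed under sums and products, so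
  concrete time bounds follow structurally.\<close>

definition polyb :: "(nat \<Rightarrow> nat \<Rightarrow> nat) \<Rightarrow> bool" where
  "polyb f \<longleftrightarrow> (\<exists>c k. \<forall>n d. 1 \<le> n \<longrightarrow> 1 \<le> d \<longrightarrow> f n d \<le> c * (n * d) ^ k)"

lemma polyb_const: "polyb (\<lambda>n d. c)"
  unfolding polyb_def by (intro exI[of _ c] exI[of _ 0]) simp

lemma polyb_fst: "polyb (\<lambda>n d. n)" and polyb_snd: "polyb (\<lambda>n d. d)"
  unfolding polyb_def by (intro exI[of _ 1] exI[of _ 1]; simp)+

lemma polyb_add:
  assumes "polyb f" "polyb g"
  shows "polyb (\<lambda>n d. f n d + g n d)"
proof -
  obtain a i b j where f: "\<And>n d. 1 \<le> n \<Longrightarrow> 1 \<le> d \<Longrightarrow> f n d \<le> a * (n * d) ^ i"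
    and g: "\<And>n d. 1 \<le> n \<Longrightarrow> 1 \<le> d \<Longrightarrow> g n d \<le> b * (n * d) ^ j"
    using assms unfolding polyb_def by metis
  have "f n d + g n d \<le> (a + b) * (n * d) ^ (i + j)" if "1 \<le> n" "1 \<le> d" for n d
  proof -
    have "1 \<le> n * d" using that by simp
    then have "(n * d) ^ i \<le> (n * d) ^ (i + j)" "(n * d) ^ j \<le> (n * d) ^ (i + j)"
      by (intro power_increasing; simp)+
    then have "a * (n * d) ^ i + b * (n * d) ^ j \<le> a * (n * d) ^ (i + j) + b * (n * d) ^ (i + j)"
      by (intro add_mono mult_left_mono) auto
    then show ?thesis using f[OF that] g[OF that] by (simp add: distrib_right)
  qed
  then show ?thesis unfolding polyb_def by blast
qed

lemma polyb_mult:
  assumes "polyb f" "polyb g"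
  shows "polyb (\<lambda>n d. f n d * g n d)"
proof -
  obtain a i b j where f: "\<And>n d. 1 \<le> n \<Longrightarrow> 1 \<le> d \<Longrightarrow> f n d \<le> a * (n * d) ^ i"
    and g: "\<And>n d. 1 \<le> n \<Longrightarrow> 1 \<le> d \<Longrightarrow> g n d \<le> b * (n * d) ^ j"
    using assms unfolding polyb_def by metis
  have "f n d * g n d \<le> (a * b) * (n * d) ^ (i + j)" if "1 \<le> n" "1 \<le> d" for n d
    using mult_mono[OF f[OF that] g[OF that]] by (simp add: power_add mult_ac)
  then show ?thesis unfolding polyb_def by blast
qed

lemmas polyb_intros = polyb_const polyb_fst polyb_snd polyb_add polyb_mult

definition class_time :: "nat \<Rightarrow> nat \<Rightarrow> nat" where
  "class_time n d = n * 20 + 10 + (n * (n * (d * 30 + 30) + 40) + 10) + 16 +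
     (d * (3 * (n * (n * 30 + 40) + 10) + 30 + 10) + 20) + (d * (3 * (n * (n * 30 + 40) + 10) + 30 + 40) + 20) +
     (n * (d * 30 + 40) + 20) + 30 + (n * (d * 30 + 50) + 10) + 7"

text \<open>At most \<open>3 * n\<close> trees and \<open>n\<close> bits, crude but free of
  \<epsilon>: the time polynomial and the word size must serve all \<epsilon> at once.\<close>

definition level_bound :: "nat \<Rightarrow> nat \<Rightarrow> nat" where
  "level_bound n d = 3 * n * (8 * d * n)"

definition pre_time :: "nat \<Rightarrow> nat \<Rightarrow> nat" where
  "pre_time n d = 30 + (n * 6 + 1) + 22 + (3 * n * 6 + 1) + 12 + 4 +
     (level_bound n d * 7 + 3 + (n * d * 8 + 3 +
       (level_bound n d * (n * 10 + n * (class_time n d + 6) + 30 + 4) + 3) + 1) + 1) + 1"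

definition word_bound :: "nat \<Rightarrow> nat \<Rightarrow> nat" where
  "word_bound n d = 4 * (level_bound n d * n) + 4 * n + 6 * n * n * d + 20 * (n * d) + 500"

lemma polyb_pre_time: "polyb pre_time"
  unfolding pre_time_def level_bound_def class_time_def by (intro polyb_intros)

lemma polyb_word_bound: "polyb word_bound"
  unfolding word_bound_def level_bound_def by (intro polyb_intros)

lemma num_levels_le:
  assumes "1 \<le> n" "0 < \<epsilon>" "\<epsilon> \<le> 1"
  shows "num_trees n \<epsilon> * (8 * d * levels_per_bit n) \<le> level_bound n d"
  unfolding level_bound_def
  using num_trees_bounds(3)[OF assms] levels_per_bit(3)[of n] by (intro mult_mono) auto

text \<open>The factor \<open>c\<close> is absorbed by
  \<open>c < 2 ^ c \<le> (n * d + 1) ^ c\<close>; adding 1 makes the base at least 2 even for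
  \<open>n = d = 1\<close>.\<close>

lemma word_bound_power: "\<exists>k. \<forall>n d. 1 \<le> n \<longrightarrow> 1 \<le> d \<longrightarrow> word_bound n d \<le> (n * d + 1) ^ k"
proof -
  obtain c k where ck: "\<And>n d. 1 \<le> n \<Longrightarrow> 1 \<le> d \<Longrightarrow> word_bound n d \<le> c * (n * d) ^ k"
    using polyb_word_bound unfolding polyb_def by metis
  have "word_bound n d \<le> (n * d + 1) ^ (c + k)" if "1 \<le> n" "1 \<le> d" for n d
  proof -
    have "2 \<le> n * d + 1" using that by simp
    then have "2 ^ c \<le> (n * d + 1) ^ c" by (intro power_mono) auto
    then have "c \<le> (n * d + 1) ^ c" using less_exp[of c] by linarith
    moreover have "(n * d) ^ k \<le> (n * d + 1) ^ k" by (intro power_mono) auto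
    ultimately have "c * (n * d) ^ k \<le> (n * d + 1) ^ c * (n * d + 1) ^ k" by (intro mult_mono) auto
    then show ?thesis using ck[OF that] by (simp add: power_add)
  qed
  then show ?thesis by blast
qed

lemma (in nns_system) t_pre_le: "t_params + t_build + 1 \<le> pre_time n d"
proof -
  have a: "NT \<le> 3 * n" "levels_per_bit n \<le> n" "NT * L \<le> level_bound n d"
    using num_trees_bounds(3)[OF n eps] levels_per_bit(3) num_levels_le[OF n eps] by (simp_all add: NT L)
  have "NT * L * (t_level + 4) \<le> level_bound n d * (t_level + 4)" using a(3) by (rule mult_right_mono) simp
  moreover have tl: "t_level = n * 10 + n * (class_time n d + 6) + 30"
    by (simp only: t_level_def t_class_def class_time_def)
  ultimately show ?thesis
    using a unfolding t_params_def t_build_def pre_time_def tl[symmetric] by linarith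
qed

text \<open>For \<open>n \<ge> 2\<close> the logarithm is at least \<open>2 / 3\<close>, so
  constants and lower-order terms are multiples of the leading one. All trees together have of order
  \<open>n powr \<epsilon> * ln n * d\<close> levels, and a query spends of order \<open>d\<close>
  on each, hence \<open>d^2\<close>.\<close>

lemma (in nns_system) size_bounds:
  assumes "2 \<le> n"
  shows "real (NT * L) \<le> 96 * (real n powr \<epsilon> * ln (real n) * real d)"
    "real (5 * (NT * L * n) + n * d) \<le> 500 * (real n powr (1 + \<epsilon>) * ln (real n) * real d)"
    "real (t_params + t_search + 1) \<le> 20000 * (real n powr \<epsilon> * ln (real n) * real d ^ 2)"
proof -
  define a l e where "a = real n powr \<epsilon>" and "l = ln (real n)" and "e = real d"
  have n1: "1 \<le> real n" using n by simp
  have a1: "1 \<le> a" unfolding a_def using n1 eps by (intro ge_one_powr_ge_zero) auto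
  have e1: "1 \<le> e" using d by (simp add: e_def)
  have l1: "2 / 3 \<le> l"
    unfolding l_def using ln2_ge_two_thirds assms by (intro order_trans[OF ln2_ge_two_thirds]) simp
  have lg: "real (levels_per_bit n) \<le> 3 * l" unfolding l_def by (rule levels_per_bit_le_ln[OF assms])
  have nt: "real NT \<le> 4 * a" unfolding a_def NT by (rule num_trees_bounds(2)[OF n eps])
  have "real (NT * L) = real NT * (8 * e * real (levels_per_bit n))" by (simp add: L e_def)
  also have "\<dots> \<le> 4 * a * (8 * e * (3 * l))"
    using nt lg a1 e1 l1 by (intro mult_mono) auto
  finally have M: "real (NT * L) \<le> 96 * (a * l * e)" by (simp add: mult_ac)
  then show "real (NT * L) \<le> 96 * (real n powr \<epsilon> * ln (real n) * real d)" by (simp add: a_def l_def e_def)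
  have na: "real n powr (1 + \<epsilon>) = real n * a" using n1 by (simp add: a_def powr_add)
  have al: "2 / 3 \<le> a * l" using mult_mono[OF a1 l1] a1 l1 by simp
  have "real (5 * (NT * L * n) + n * d) = real n * (5 * real (NT * L) + e)"
    by (simp add: e_def algebra_simps)
  also have "\<dots> \<le> real n * (500 * (a * l * e))"
  proof (intro mult_left_mono)
    have "2 / 3 * e \<le> a * l * e" using al e1 by (intro mult_right_mono) auto
    then have "e \<le> 20 * (a * l * e)" using e1 by linarith
    then show "5 * real (NT * L) + e \<le> 500 * (a * l * e)" using M by linarith
  qed simp
  also have "\<dots> = 500 * (real n powr (1 + \<epsilon>) * l * e)" by (simp add: na mult_ac)
  finally show "real (5 * (NT * L * n) + n * d) \<le> 500 * (real n powr (1 + \<epsilon>) * ln (real n) * real d)"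
    by (simp add: l_def e_def)
  have e2: "e \<le> e ^ 2" "1 \<le> e ^ 2" using e1 power_increasing[of 1 2 e] by simp_all
  let ?Y = "a * l * e ^ 2"
  have Y: "2 / 3 * e ^ 2 \<le> ?Y" using al by (intro mult_right_mono) auto
  have ale: "a * l * e \<le> ?Y" using al e2 by (intro mult_left_mono) auto
  have L1: "l \<le> ?Y"
  proof -
    have "1 * l * 1 \<le> a * l * e ^ 2" using a1 l1 e2 by (intro mult_mono) auto
    then show ?thesis by simp
  qed
  have A1: "a \<le> 3 / 2 * ?Y"
  proof -
    have "a * (2 / 3) * 1 \<le> a * l * e ^ 2" using a1 l1 e2 by (intro mult_mono) auto
    then show ?thesis by simp
  qed
  have D1: "e \<le> 3 / 2 * ?Y" "1 \<le> 3 / 2 * ?Y" using Y e2 by linarith+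
  have "real (NT * L) * e \<le> 96 * (a * l * e) * e" using M e1 by (intro mult_right_mono) auto
  moreover have "96 * (a * l * e) * e = 96 * ?Y" by (simp add: power2_eq_square mult_ac)
  ultimately have Me: "real (NT * L) * e \<le> 96 * ?Y" by linarith
  have "real (t_params + t_search + 1) =
      6 * real (levels_per_bit n) + 6 * real NT + 20 * (real (NT * L) * e) + 74 * real (NT * L) + 10 * e + 114"
    by (simp add: t_params_def t_search_def e_def algebra_simps)
  also have "\<dots> \<le> 6 * (3 * ?Y) + 6 * (4 * (3 / 2 * ?Y)) + 20 * (96 * ?Y) + 74 * (96 * ?Y) + 10 * (3 / 2 * ?Y) + 114 * (3 / 2 * ?Y)"
    using lg nt M Me ale L1 A1 D1 by linarith
  also have "\<dots> \<le> 20000 * ?Y" using D1 by linarith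
  finally show "real (t_params + t_search + 1) \<le> 20000 * (real n powr \<epsilon> * ln (real n) * real d ^ 2)"
    by (simp add: a_def l_def e_def)
qed

text \<open>At \<open>n = 1\<close> the logarithm vanishes while the data structure still takes
  space and time, so the bounds on space and query time start at \<open>n = 2\<close>. The word size
  is a fixed power of \<open>n * d + 1\<close>.\<close>

theorem theorem1p3:
  shows "\<exists>(C\<^sub>0 :: real) (k :: nat) (K :: real) (Qpre :: real poly) (Qspace :: real poly) (Qqry :: real poly).
    \<forall>(\<epsilon> :: real) (r :: real) (p :: real). 0 < \<epsilon> \<and> \<epsilon> \<le> 1 \<and> 0 < r \<and> 2 \<le> p \<longrightarrow>
      (\<exists>c :: real. c \<le> C\<^sub>0 * (p / \<epsilon>) \<and>
        (\<exists>(pre :: com) (qry :: com). \<forall>(n :: nat) (d :: nat) (ps :: real list list).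
          1 \<le> n \<and> 1 \<le> d \<and> length ps = n \<and> distinct ps \<and> set ps \<subseteq> points d \<longrightarrow>
          (\<exists>(Tpre :: nat) (S :: nat) (Tqry :: nat).
            lp_NNS_data_structure (int ((n * d + 1) ^ k)) pre qry \<epsilon> r p c d ps Tpre S Tqry \<and>
            real Tpre \<le> poly Qpre (real (n * d)) \<and>
            (2 \<le> n \<longrightarrow>
              real S \<le> K * (real n powr (1 + \<epsilon>) * ln (real n) * poly Qspace (real d)) \<and>
              real Tqry \<le> K * (real n powr \<epsilon> * ln (real n) * poly Qqry (real d))))))"
proof -
  obtain k where k: "\<And>n d. 1 \<le> n \<Longrightarrow> 1 \<le> d \<Longrightarrow> word_bound n d \<le> (n * d + 1) ^ k"
    using word_bound_power by blast
  obtain a b where ab: "\<And>n d. 1 \<le> n \<Longrightarrow> 1 \<le> d \<Longrightarrow> pre_time n d \<le> a * (n * d) ^ b"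
    using polyb_pre_time unfolding polyb_def by metis
  show ?thesis
  \<comment> \<open>The 480 is \<open>4 * 120\<close>, and 20000 covers the constants of both space
    and query time; the polynomials in \<open>d\<close> are \<open>d\<close> for space and
    \<open>d^2\<close> for queries.\<close>
  proof (rule exI[of _ 480], rule exI[of _ k], rule exI[of _ 20000], rule exI[of _ "monom (real a) b"],
      rule exI[of _ "monom 1 1"], rule exI[of _ "monom 1 2"], intro allI impI, elim conjE)
    fix \<epsilon> r p :: real
    assume asm: "0 < \<epsilon>" "\<epsilon> \<le> 1" "0 < r" "2 \<le> p"
    have main: "\<exists>Tpre S Tqry.
        lp_NNS_data_structure (int ((n * d + 1) ^ k)) pre_prog qry_prog \<epsilon> r p (480 * (p / \<epsilon>)) d ps Tpre S Tqry \<and>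
        real Tpre \<le> poly (monom (real a) b) (real (n * d)) \<and>
        (2 \<le> n \<longrightarrow>
          real S \<le> 20000 * (real n powr (1 + \<epsilon>) * ln (real n) * poly (monom 1 1) (real d)) \<and>
          real Tqry \<le> 20000 * (real n powr \<epsilon> * ln (real n) * poly (monom 1 2) (real d)))"
      if nd: "1 \<le> n" "1 \<le> d" and ps: "length ps = n" "set ps \<subseteq> points d" for n d ps
    proof -
      define L where "L = 8 * d * levels_per_bit n"
      define NT where "NT = num_trees n \<epsilon>"
      have M: "NT * L \<le> level_bound n d"
        unfolding NT_def L_def by (rule num_levels_le[OF nd(1) asm(1,2)])
      interpret nns_system n d "\<lambda>i j. concat ps ! (i * d + j)" p \<epsilon> r "concat ps" "int ((n * d + 1) ^ k)" L NT
      proof unfold_locales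
        show "length (concat ps) = n * d" using length_concat_uniform[OF ps(2)] ps(1) by simp
        have "4 * (NT * L * n) + 4 * n + 6 * n * n * d + 20 * (n * d) + 500 \<le> word_bound n d"
          unfolding word_bound_def using M by (intro add_mono mult_mono) auto
        also have "\<dots> \<le> (n * d + 1) ^ k" using k[OF nd] .
        finally show "int (4 * (NT * L * n) + 4 * n + 6 * n * n * d + 20 * (n * d) + 500) \<le> int ((n * d + 1) ^ k)"
          by (simp only: of_nat_le_iff)
        show "1 \<le> L" using nd levels_per_bit_pos[OF nd(1)] by (simp add: L_def)
        show "1 \<le> NT" using num_trees_bounds(4)[OF nd(1) asm(1,2)] by (simp add: NT_def)
      qed (use nd asm in \<open>simp_all add: L_def NT_def\<close>)
      show ?thesis
      proof (intro exI conjI impI)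
        show "lp_NNS_data_structure (int ((n * d + 1) ^ k)) pre_prog qry_prog \<epsilon> r p (480 * (p / \<epsilon>)) d ps
            (t_params + t_build + 1) (5 * (NT * L * n) + n * d) (t_params + t_search + 1)"
          by (rule data_structure[OF ps refl])
        have "t_params + t_build + 1 \<le> a * (n * d) ^ b" using t_pre_le ab[OF nd] by (rule order_trans)
        then have "real (t_params + t_build + 1) \<le> real (a * (n * d) ^ b)" by (rule of_nat_mono)
        then show "real (t_params + t_build + 1) \<le> poly (monom (real a) b) (real (n * d))"
          by (simp add: poly_monom)
        assume n2: "2 \<le> n"
        have "500 * (real n powr (1 + \<epsilon>) * ln (real n) * real d) \<le>
            20000 * (real n powr (1 + \<epsilon>) * ln (real n) * real d)"
          using n2 by (intro mult_right_mono) auto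
        from order_trans[OF size_bounds(2)[OF n2] this]
        show "real (5 * (NT * L * n) + n * d) \<le> 20000 * (real n powr (1 + \<epsilon>) * ln (real n) * poly (monom 1 1) (real d))"
          by (simp add: poly_monom)
        show "real (t_params + t_search + 1) \<le> 20000 * (real n powr \<epsilon> * ln (real n) * poly (monom 1 2) (real d))"
          using size_bounds(3)[OF n2] by (simp add: poly_monom)
      qed
    qed
    show "\<exists>c. c \<le> 480 * (p / \<epsilon>) \<and>
        (\<exists>pre qry. \<forall>n d ps. 1 \<le> n \<and> 1 \<le> d \<and> length ps = n \<and> distinct ps \<and> set ps \<subseteq> points d \<longrightarrow>
          (\<exists>Tpre S Tqry.
            lp_NNS_data_structure (int ((n * d + 1) ^ k)) pre qry \<epsilon> r p c d ps Tpre S Tqry \<and>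
            real Tpre \<le> poly (monom (real a) b) (real (n * d)) \<and>
            (2 \<le> n \<longrightarrow>
              real S \<le> 20000 * (real n powr (1 + \<epsilon>) * ln (real n) * poly (monom 1 1) (real d)) \<and>
              real Tqry \<le> 20000 * (real n powr \<epsilon> * ln (real n) * poly (monom 1 2) (real d)))))"
      by (rule exI[of _ "480 * (p / \<epsilon>)"], rule conjI[OF order_refl], rule exI[of _ pre_prog],
          rule exI[of _ qry_prog], intro allI impI, elim conjE, rule main)
  qed
qed

end
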